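(* Let $R$ be a unital ring and $N=\{1<2<\dots<n\}$. Let $h_1,\dots,h_n$ be pairwise commuting cochain self-maps of a cochain complex $D$ of $R$-modules. Let $C$ be a cochain complex of $R$-modules, let $\alpha\colon C\to D$ and $\beta\colon D\to C$ be cochain maps, and let $G\colon\mathrm{id}_D\simeq\alpha\circ\beta$ be a homotopy, so that $dG+Gd=\alpha\beta-\mathrm{id}_D$. Put $$Y=\mathrm{Tot}\,\mathfrak{Der}(D;\alpha\beta,\mathrm{id}_D,G;h_1,\dots,h_n),\qquad Z=\mathrm{Tot}\,\mathfrak{Der}(C;\alpha,\beta,G;h_1,\dots,h_n).$$ Then the (constant) diagonal matrix $\mathcal L$, indexed by the subsets of $N$, with all diagonal entries equal to $\beta$, defines a cochain map $\mathcal L\colon Y\to Z$. If $\beta$ is a quasi-isomorphism, then $\mathcal L$ is a quasi-isomorphism as well. If in addition $C$ and $D$ are bounded above complexes of projective $R$-modules, then $\mathcal L$ is a homotopy equivalence $Y\simeq Z$.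
   Context: Subsets $A,B,S\subseteq N$ have cardinalities $a,b,s$. Complexes are cochain complexes. Total incidence numbers: for $B=\{b_1<\dots<b_b\}\subseteq N$ write $d_i(B)=B\setminus\{b_i\}$. For $A\subset B$ write uniquely $A=d_{i_1}d_{i_2}\cdots d_{i_{b-a}}(B)$ with $i_1<\dots<i_{b-a}$; set $[B:A]=(-1)^{b-a}(-1)^{i_1+\dots+i_{b-a}}$, and $[A:A]=1$. A special $N$-cube is given by a cochain complex $C$ with differential $d$, cochain maps $f_k\colon C\to C$ ($k\in N$) and graded maps $H_S\colon C\to C$ of degree $1-s$ ($S\subseteq N$, $s\ge2$) such that the following totalisation is a cochain complex: $\mathrm{Tot}^\ell=\bigoplus_{A\subseteq N}C^{\ell-a}$ with differential the matrix $(D_{B,A})_{A,B\subseteq N}$, $D_{B,A}=(-1)^{ab}[B:A]\cdot H_{B,A}$ for $A\subseteq B$ and $D_{B,A}=0$ otherwise, where $H_{A,A}=d$, $H_{B,A}=f_k$ if $B\setminus A=\{k\}$, and $H_{B,A}=H_{B\setminus A}$ if $b-a\ge2$. Derived cube: given cochain complexes $C,D$, pairwise commuting cochain maps $h_k\colon D\to D$ ($k\in N$), cochain maps $\alpha\colon C\to D$, $\beta\colon D\to C$ and a homotopy $G$ with $dG+Gd=\alpha\beta-\mathrm{id}_D$, $\mathfrak{Der}(C;\alpha,\beta,G;h_1,\dots,h_n)$ denotes the special $N$-cube on $C$ with $f_k=\beta h_k\alpha$ and, for $S=\{z_1<\dots<z_s\}$ with $s\ge2$, $H_S=\beta\circ\sum_{\sigma\in\Sigma(S)}\mathrm{sgn}(\sigma)h_{\sigma(z_1)}Gh_{\sigma(z_2)}G\cdots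 Gh_{\sigma(z_s)}\circ\alpha$ (this is indeed a special $N$-cube). $\mathfrak{Der}(D;\alpha\beta,\mathrm{id}_D,G;h_1,\dots,h_n)$ is the case in which $C,\alpha,\beta$ are replaced by $D,\alpha\beta,\mathrm{id}_D$. *)

theory Defs
  imports "HOL-Combinatorics.Permutations" "HOL-Algebra.AbelCoset" "HOL-Algebra.Module"
begin

section \<open>Modules over a unital ring\<close>

text \<open>
  The locale \<open>module\<close> of HOL-Algebra requires a commutative ring. We reuse its
  record type; the multiplication and unit fields of a module record carry no meaning and
  are left undefined in the constructions below.
\<close>

locale left_module = R?: ring R + M?: abelian_group M
  for R :: "('r, 'k) ring_scheme" (structure) and M :: "('r, 'm) module" (structure) +
  assumes smult_closed [simp, intro]:
      "\<lbrakk>a \<in> carrier R; x \<in> carrier M\<rbrakk> \<Longrightarrow> a \<odot>\<^bsub>M\<^esub> x \<in> carrier M"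
    and smult_l_distr:
      "\<lbrakk>a \<in> carrier R; b \<in> carrier R; x \<in> carrier M\<rbrakk> \<Longrightarrow>
        (a \<oplus> b) \<odot>\<^bsub>M\<^esub> x = a \<odot>\<^bsub>M\<^esub> x \<oplus>\<^bsub>M\<^esub> b \<odot>\<^bsub>M\<^esub> x"
    and smult_r_distr:
      "\<lbrakk>a \<in> carrier R; x \<in> carrier M; y \<in> carrier M\<rbrakk> \<Longrightarrow>
        a \<odot>\<^bsub>M\<^esub> (x \<oplus>\<^bsub>M\<^esub> y) = a \<odot>\<^bsub>M\<^esub> x \<oplus>\<^bsub>M\<^esub> a \<odot>\<^bsub>M\<^esub> y"
    and smult_assoc1:
      "\<lbrakk>a \<in> carrier R; b \<in> carrier R; x \<in> carrier M\<rbrakk> \<Longrightarrow>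
        (a \<otimes> b) \<odot>\<^bsub>M\<^esub> x = a \<odot>\<^bsub>M\<^esub> (b \<odot>\<^bsub>M\<^esub> x)"
    and smult_one [simp]: "x \<in> carrier M \<Longrightarrow> \<one> \<odot>\<^bsub>M\<^esub> x = x"

definition mod_hom ::
  "('r, 'k) ring_scheme \<Rightarrow> ('r, 'a) module \<Rightarrow> ('r, 'b) module \<Rightarrow> ('a \<Rightarrow> 'b) set" where
  "mod_hom R M N = {f \<in> carrier M \<rightarrow> carrier N.
     (\<forall>x\<in>carrier M. \<forall>y\<in>carrier M. f (x \<oplus>\<^bsub>M\<^esub> y) = f x \<oplus>\<^bsub>N\<^esub> f y) \<and>
     (\<forall>r\<in>carrier R. \<forall>x\<in>carrier M. f (r \<odot>\<^bsub>M\<^esub> x) = r \<odot>\<^bsub>N\<^esub> f x)}"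

definition mod_iso ::
  "('r, 'k) ring_scheme \<Rightarrow> ('r, 'a) module \<Rightarrow> ('r, 'b) module \<Rightarrow> ('a \<Rightarrow> 'b) set" where
  "mod_iso R M N = {f \<in> mod_hom R M N. bij_betw f (carrier M) (carrier N)}"

definition quot_module :: "('r, 'm) module \<Rightarrow> 'm set \<Rightarrow> ('r, 'm set) module" where
  "quot_module M B = \<lparr>carrier = a_rcosets\<^bsub>M\<^esub> B, monoid.mult = undefined, one = undefined,
     zero = B, add = set_add M,
     smult = (\<lambda>r X. \<Union>x\<in>X. B +>\<^bsub>M\<^esub> (r \<odot>\<^bsub>M\<^esub> x))\<rparr>"

text \<open>For a finite index set \<open>I\<close> this is the direct sum.\<close>

definition prod_module :: "'i set \<Rightarrow> ('i \<Rightarrow> ('r, 'm) module) \<Rightarrow> ('r, 'i \<Rightarrow> 'm) module" where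
  "prod_module I M = \<lparr>carrier = (\<Pi>\<^sub>E i\<in>I. carrier (M i)), monoid.mult = undefined, one = undefined,
     zero = (\<lambda>i\<in>I. \<zero>\<^bsub>M i\<^esub>),
     add = (\<lambda>x y. \<lambda>i\<in>I. x i \<oplus>\<^bsub>M i\<^esub> y i),
     smult = (\<lambda>r x. \<lambda>i\<in>I. r \<odot>\<^bsub>M i\<^esub> x i)\<rparr>"

text \<open>The map given by a matrix \<open>F\<close> whose entry \<open>F j i\<close> goes from the \<open>i\<close>-th summand of
  the source to the \<open>j\<close>-th summand \<open>M j\<close> of the target.\<close>

definition matrix_map ::
  "'i set \<Rightarrow> ('i \<Rightarrow> ('r, 'b) module) \<Rightarrow> ('i \<Rightarrow> 'i \<Rightarrow> 'a \<Rightarrow> 'b) \<Rightarrow> ('i \<Rightarrow> 'a) \<Rightarrow> 'i \<Rightarrow> 'b" where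
  "matrix_map I M F x = (\<lambda>j\<in>I. \<Oplus>\<^bsub>M j\<^esub>i\<in>I. F j i (x i))"

text \<open>
  Projectivity is the lifting property along surjections. A definition cannot quantify over
  types, so the test modules live on two fixed types. These are large enough to contain \<open>P\<close>
  and the free module on the set of elements of \<open>P\<close>, hence the lifting property holds
  against modules on arbitrary types; see \<open>projective_lift\<close> below.
\<close>

definition projective :: "('r, 'k) ring_scheme \<Rightarrow> ('r, 'm) module \<Rightarrow> bool" where
  "projective R P \<longleftrightarrow> left_module R P \<and>
     (\<forall>(M :: ('r, 'm \<Rightarrow> 'r) module) (N :: ('r, 'm) module). \<forall>g \<in> mod_hom R M N. \<forall>f \<in> mod_hom R P N.
        left_module R M \<longrightarrow> left_module R N \<longrightarrow> g ` carrier M = carrier N \<longrightarrow>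
        (\<exists>f' \<in> mod_hom R P M. \<forall>x\<in>carrier P. g (f' x) = f x))"


definition free_module :: "('r, 'k) ring_scheme \<Rightarrow> 'm set \<Rightarrow> ('r, 'm \<Rightarrow> 'r) module" where
  "free_module R X = \<lparr>
     carrier = {\<phi>. range \<phi> \<subseteq> carrier R \<and> finite {x. \<phi> x \<noteq> \<zero>\<^bsub>R\<^esub>} \<and> {x. \<phi> x \<noteq> \<zero>\<^bsub>R\<^esub>} \<subseteq> X},
     monoid.mult = undefined, one = undefined, zero = (\<lambda>x. \<zero>\<^bsub>R\<^esub>),
     add = (\<lambda>\<phi> \<psi> x. \<phi> x \<oplus>\<^bsub>R\<^esub> \<psi> x), smult = (\<lambda>r \<phi> x. r \<otimes>\<^bsub>R\<^esub> \<phi> x)\<rparr>"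

lemma free_module_left_module:
  fixes R :: "('r, 'k) ring_scheme" and X :: "'m set"
  assumes "ring R"
  shows "left_module R (free_module R X)"
proof -
  interpret ring R by fact
  let ?F = "free_module R X"
  have sub: "finite {x. \<phi> x \<noteq> \<zero>\<^bsub>R\<^esub>} \<Longrightarrow> finite {x. \<psi> x \<noteq> \<zero>\<^bsub>R\<^esub>} \<Longrightarrow>
      finite {x. \<phi> x \<oplus>\<^bsub>R\<^esub> \<psi> x \<noteq> \<zero>\<^bsub>R\<^esub>}" for \<phi> \<psi> :: "'m \<Rightarrow> 'r"
    by (rule finite_subset[of _ "{x. \<phi> x \<noteq> \<zero>\<^bsub>R\<^esub>} \<union> {x. \<psi> x \<noteq> \<zero>\<^bsub>R\<^esub>}"]) auto
  have sub2: "finite {x. r \<otimes>\<^bsub>R\<^esub> \<phi> x \<noteq> \<zero>\<^bsub>R\<^esub>}"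
    if "r \<in> carrier R" "finite {x. \<phi> x \<noteq> \<zero>\<^bsub>R\<^esub>}" for \<phi> :: "'m \<Rightarrow> 'r" and r
    by (rule finite_subset[OF _ that(2)]) (use that(1) in auto)
  have abg: "abelian_group ?F"
  proof (rule abelian_groupI)
    fix \<phi> \<psi> assume "\<phi> \<in> carrier ?F" "\<psi> \<in> carrier ?F"
    then have "\<And>x. \<phi> x \<in> carrier R" "\<And>x. \<psi> x \<in> carrier R"
        "finite {x. \<phi> x \<noteq> \<zero>\<^bsub>R\<^esub>}" "finite {x. \<psi> x \<noteq> \<zero>\<^bsub>R\<^esub>}"
        and out: "\<And>x. x \<notin> X \<Longrightarrow> \<phi> x = \<zero>\<^bsub>R\<^esub> \<and> \<psi> x = \<zero>\<^bsub>R\<^esub>"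
      by (auto simp: free_module_def image_subset_iff)
    moreover have "{x. \<phi> x \<oplus>\<^bsub>R\<^esub> \<psi> x \<noteq> \<zero>\<^bsub>R\<^esub>} \<subseteq> X"
    proof
      fix x assume "x \<in> {x. \<phi> x \<oplus>\<^bsub>R\<^esub> \<psi> x \<noteq> \<zero>\<^bsub>R\<^esub>}"
      then show "x \<in> X" using out[of x] by (cases "x \<in> X") auto
    qed
    ultimately show "\<phi> \<oplus>\<^bsub>?F\<^esub> \<psi> \<in> carrier ?F"
      by (simp add: free_module_def sub image_subset_iff)
  next
    show "\<zero>\<^bsub>?F\<^esub> \<in> carrier ?F" by (auto simp: free_module_def)
  next
    fix \<phi> \<psi> \<chi> assume "\<phi> \<in> carrier ?F" "\<psi> \<in> carrier ?F" "\<chi> \<in> carrier ?F"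
    then show "\<phi> \<oplus>\<^bsub>?F\<^esub> \<psi> \<oplus>\<^bsub>?F\<^esub> \<chi> = \<phi> \<oplus>\<^bsub>?F\<^esub> (\<psi> \<oplus>\<^bsub>?F\<^esub> \<chi>)"
      by (auto simp: free_module_def image_subset_iff a_assoc)
  next
    fix \<phi> \<psi> assume "\<phi> \<in> carrier ?F" "\<psi> \<in> carrier ?F"
    then show "\<phi> \<oplus>\<^bsub>?F\<^esub> \<psi> = \<psi> \<oplus>\<^bsub>?F\<^esub> \<phi>"
      by (auto simp: free_module_def image_subset_iff a_comm)
  next
    fix \<phi> assume "\<phi> \<in> carrier ?F"
    then show "\<zero>\<^bsub>?F\<^esub> \<oplus>\<^bsub>?F\<^esub> \<phi> = \<phi>" by (auto simp: free_module_def image_subset_iff)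
  next
    fix \<phi> assume phi: "\<phi> \<in> carrier ?F"
    have "\<ominus>\<^bsub>R\<^esub> \<phi> x = \<zero>\<^bsub>R\<^esub> \<longleftrightarrow> \<phi> x = \<zero>\<^bsub>R\<^esub>" for x
    proof -
      have "\<phi> x \<in> carrier R" using phi by (auto simp: free_module_def image_subset_iff)
      then show ?thesis by (metis minus_minus minus_zero)
    qed
    with phi have "(\<lambda>x. \<ominus>\<^bsub>R\<^esub> \<phi> x) \<in> carrier ?F"
      by (auto simp: free_module_def image_subset_iff)
    moreover have "(\<lambda>x. \<ominus>\<^bsub>R\<^esub> \<phi> x) \<oplus>\<^bsub>?F\<^esub> \<phi> = \<zero>\<^bsub>?F\<^esub>"
      using phi by (auto simp: free_module_def image_subset_iff l_neg)
    ultimately show "\<exists>\<psi>\<in>carrier ?F. \<psi> \<oplus>\<^bsub>?F\<^esub> \<phi> = \<zero>\<^bsub>?F\<^esub>" by blast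
  qed
  show ?thesis
  proof (intro left_module.intro left_module_axioms.intro assms abg)
    fix a \<phi> assume "a \<in> carrier R" "\<phi> \<in> carrier ?F"
    then have a: "a \<in> carrier R" and "\<And>x. \<phi> x \<in> carrier R" "finite {x. \<phi> x \<noteq> \<zero>\<^bsub>R\<^esub>}"
        and out: "\<And>x. x \<notin> X \<Longrightarrow> \<phi> x = \<zero>\<^bsub>R\<^esub>"
      by (auto simp: free_module_def image_subset_iff)
    moreover have "{x. a \<otimes>\<^bsub>R\<^esub> \<phi> x \<noteq> \<zero>\<^bsub>R\<^esub>} \<subseteq> X"
    proof
      fix x assume "x \<in> {x. a \<otimes>\<^bsub>R\<^esub> \<phi> x \<noteq> \<zero>\<^bsub>R\<^esub>}"
      then show "x \<in> X" using out[of x] a by (cases "x \<in> X") auto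
    qed
    ultimately show "a \<odot>\<^bsub>?F\<^esub> \<phi> \<in> carrier ?F"
      by (simp add: free_module_def sub2 image_subset_iff)
  qed (auto simp: free_module_def image_subset_iff l_distr r_distr m_assoc)
qed

lemma free_module_hom:
  assumes M: "left_module R M" and m: "m \<in> X \<rightarrow> carrier M"
  defines "t \<equiv> (\<lambda>\<phi>. \<Oplus>\<^bsub>M\<^esub>x\<in>{x. \<phi> x \<noteq> \<zero>\<^bsub>R\<^esub>}. \<phi> x \<odot>\<^bsub>M\<^esub> m x)"
  shows "t \<in> mod_hom R (free_module R X) M"
proof -
  interpret left_module R M by fact
  let ?F = "free_module R X"
  interpret F: left_module R ?F by (rule free_module_left_module) (rule R.ring_axioms)
  have zsm: "\<zero>\<^bsub>R\<^esub> \<odot>\<^bsub>M\<^esub> y = \<zero>\<^bsub>M\<^esub>" if "y \<in> carrier M" for y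
  proof -
    have "\<zero>\<^bsub>R\<^esub> \<odot>\<^bsub>M\<^esub> y \<oplus>\<^bsub>M\<^esub> \<zero>\<^bsub>R\<^esub> \<odot>\<^bsub>M\<^esub> y = \<zero>\<^bsub>R\<^esub> \<odot>\<^bsub>M\<^esub> y"
      using smult_l_distr[of "\<zero>\<^bsub>R\<^esub>" "\<zero>\<^bsub>R\<^esub>" y] that by simp
    then show ?thesis using that by (metis M.add.l_cancel_one smult_closed R.zero_closed)
  qed
  have smz: "r \<odot>\<^bsub>M\<^esub> \<zero>\<^bsub>M\<^esub> = \<zero>\<^bsub>M\<^esub>" if "r \<in> carrier R" for r
    using smult_r_distr[of r "\<zero>\<^bsub>M\<^esub>" "\<zero>\<^bsub>M\<^esub>"] that
    by (metis M.add.l_cancel_one smult_closed M.zero_closed M.l_zero)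
  have inM: "\<phi> x \<odot>\<^bsub>M\<^esub> m x \<in> carrier M" if "\<phi> \<in> carrier ?F" "x \<in> X" for \<phi> x
    using that m by (auto simp: free_module_def image_subset_iff)
  have supp: "{x. \<phi> x \<noteq> \<zero>\<^bsub>R\<^esub>} \<subseteq> X" "finite {x. \<phi> x \<noteq> \<zero>\<^bsub>R\<^esub>}" if "\<phi> \<in> carrier ?F" for \<phi>
    using that by (auto simp: free_module_def)
  have t_eq: "t \<phi> = (\<Oplus>\<^bsub>M\<^esub>x\<in>S. \<phi> x \<odot>\<^bsub>M\<^esub> m x)"
    if "\<phi> \<in> carrier ?F" "finite S" "{x. \<phi> x \<noteq> \<zero>\<^bsub>R\<^esub>} \<subseteq> S" "S \<subseteq> X" for \<phi> S
    unfolding t_def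
  proof (rule M.add.finprod_mono_neutral_cong_left)
    fix i assume "i \<in> S - {x. \<phi> x \<noteq> \<zero>\<^bsub>R\<^esub>}"
    then show "\<phi> i \<odot>\<^bsub>M\<^esub> m i = \<zero>\<^bsub>M\<^esub>" using that(4) m zsm by auto
  qed (use that inM in auto)
  have smsum: "r \<odot>\<^bsub>M\<^esub> (\<Oplus>\<^bsub>M\<^esub>x\<in>S. f x) = (\<Oplus>\<^bsub>M\<^esub>x\<in>S. r \<odot>\<^bsub>M\<^esub> f x)"
    if "finite S" "r \<in> carrier R" "f \<in> S \<rightarrow> carrier M" for r S f
    using that
  proof (induction S rule: finite_induct)
    case empty
    then show ?case using smz by simp
  next
    case (insert x S)
    then have f: "f x \<in> carrier M" "f \<in> S \<rightarrow> carrier M" by auto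
    then have rf: "r \<odot>\<^bsub>M\<^esub> f x \<in> carrier M" "(\<lambda>y. r \<odot>\<^bsub>M\<^esub> f y) \<in> S \<rightarrow> carrier M"
      using insert.prems(1) by auto
    show ?case
      using insert f rf by (simp add: M.finsum_insert smult_r_distr M.finsum_closed)
  qed
  show ?thesis
    unfolding mod_hom_def
  proof (intro CollectI conjI ballI funcsetI)
    fix \<phi> assume "\<phi> \<in> carrier ?F"
    then show "t \<phi> \<in> carrier M"
      unfolding t_def using inM supp(1) by (intro M.finsum_closed) auto
  next
    fix \<phi> \<psi> assume p: "\<phi> \<in> carrier ?F" "\<psi> \<in> carrier ?F"
    let ?S = "{x. \<phi> x \<noteq> \<zero>\<^bsub>R\<^esub>} \<union> {x. \<psi> x \<noteq> \<zero>\<^bsub>R\<^esub>}"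
    have S: "finite ?S" "?S \<subseteq> X" using supp p by auto
    have val: "(\<phi> \<oplus>\<^bsub>?F\<^esub> \<psi>) x = \<phi> x \<oplus>\<^bsub>R\<^esub> \<psi> x" for x by (simp add: free_module_def)
    have pc: "\<phi> x \<in> carrier R" "\<psi> x \<in> carrier R" for x
      using p by (auto simp: free_module_def image_subset_iff)
    have "t (\<phi> \<oplus>\<^bsub>?F\<^esub> \<psi>) = (\<Oplus>\<^bsub>M\<^esub>x\<in>?S. (\<phi> \<oplus>\<^bsub>?F\<^esub> \<psi>) x \<odot>\<^bsub>M\<^esub> m x)"
      using p S by (intro t_eq) (auto simp: val)
    also have "\<dots> = (\<Oplus>\<^bsub>M\<^esub>x\<in>?S. \<phi> x \<odot>\<^bsub>M\<^esub> m x \<oplus>\<^bsub>M\<^esub> \<psi> x \<odot>\<^bsub>M\<^esub> m x)"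
    proof (rule M.finsum_cong')
      fix x assume "x \<in> ?S"
      then have "m x \<in> carrier M" using m S(2) by blast
      then show "(\<phi> \<oplus>\<^bsub>?F\<^esub> \<psi>) x \<odot>\<^bsub>M\<^esub> m x = \<phi> x \<odot>\<^bsub>M\<^esub> m x \<oplus>\<^bsub>M\<^esub> \<psi> x \<odot>\<^bsub>M\<^esub> m x"
        using pc by (simp add: val smult_l_distr)
    next
      show "(\<lambda>x. \<phi> x \<odot>\<^bsub>M\<^esub> m x \<oplus>\<^bsub>M\<^esub> \<psi> x \<odot>\<^bsub>M\<^esub> m x) \<in> ?S \<rightarrow> carrier M"
        using inM[OF p(1)] inM[OF p(2)] S(2) by blast
    qed simp
    also have "\<dots> = (\<Oplus>\<^bsub>M\<^esub>x\<in>?S. \<phi> x \<odot>\<^bsub>M\<^esub> m x) \<oplus>\<^bsub>M\<^esub> (\<Oplus>\<^bsub>M\<^esub>x\<in>?S. \<psi> x \<odot>\<^bsub>M\<^esub> m x)"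
      using inM[OF p(1)] inM[OF p(2)] S(2) by (intro M.finsum_addf) blast+
    also have "\<dots> = t \<phi> \<oplus>\<^bsub>M\<^esub> t \<psi>"
      using t_eq[OF p(1) S(1) _ S(2)] t_eq[OF p(2) S(1) _ S(2)] by auto
    finally show "t (\<phi> \<oplus>\<^bsub>?F\<^esub> \<psi>) = t \<phi> \<oplus>\<^bsub>M\<^esub> t \<psi>" .
  next
    fix r \<phi> assume p: "r \<in> carrier R" "\<phi> \<in> carrier ?F"
    let ?S = "{x. \<phi> x \<noteq> \<zero>\<^bsub>R\<^esub>}"
    have val: "(r \<odot>\<^bsub>?F\<^esub> \<phi>) x = r \<otimes>\<^bsub>R\<^esub> \<phi> x" for x by (simp add: free_module_def)
    have pc: "\<phi> x \<in> carrier R" for x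
      using p by (auto simp: free_module_def image_subset_iff)
    have "t (r \<odot>\<^bsub>?F\<^esub> \<phi>) = (\<Oplus>\<^bsub>M\<^esub>x\<in>?S. (r \<odot>\<^bsub>?F\<^esub> \<phi>) x \<odot>\<^bsub>M\<^esub> m x)"
      using p supp[OF p(2)] by (intro t_eq) (auto simp: val)
    also have "\<dots> = (\<Oplus>\<^bsub>M\<^esub>x\<in>?S. r \<odot>\<^bsub>M\<^esub> (\<phi> x \<odot>\<^bsub>M\<^esub> m x))"
    proof (rule M.finsum_cong')
      fix x assume "x \<in> ?S"
      then have "m x \<in> carrier M" using m supp(1)[OF p(2)] by blast
      then show "(r \<odot>\<^bsub>?F\<^esub> \<phi>) x \<odot>\<^bsub>M\<^esub> m x = r \<odot>\<^bsub>M\<^esub> (\<phi> x \<odot>\<^bsub>M\<^esub> m x)"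
        using pc p(1) by (simp add: val smult_assoc1)
    next
      show "(\<lambda>x. r \<odot>\<^bsub>M\<^esub> (\<phi> x \<odot>\<^bsub>M\<^esub> m x)) \<in> ?S \<rightarrow> carrier M"
        using inM[OF p(2)] p(1) supp(1)[OF p(2)] by blast
    qed simp
    also have "\<dots> = r \<odot>\<^bsub>M\<^esub> t \<phi>"
      unfolding t_def using p inM[OF p(2)] supp[OF p(2)] by (intro smsum[symmetric]) auto
    finally show "t (r \<odot>\<^bsub>?F\<^esub> \<phi>) = r \<odot>\<^bsub>M\<^esub> t \<phi>" .
  qed
qed

lemma mod_hom_finsum:
  assumes M: "left_module R M" and N: "left_module R N" and g: "g \<in> mod_hom R M N"
    and fin: "finite S" and f: "f \<in> S \<rightarrow> carrier M"
  shows "g (\<Oplus>\<^bsub>M\<^esub>x\<in>S. f x) = (\<Oplus>\<^bsub>N\<^esub>x\<in>S. g (f x))"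
proof -
  interpret M: left_module R M by fact
  interpret N: left_module R N by fact
  have gc: "g x \<in> carrier N" if "x \<in> carrier M" for x using g that by (auto simp: mod_hom_def)
  have ga: "g (x \<oplus>\<^bsub>M\<^esub> y) = g x \<oplus>\<^bsub>N\<^esub> g y" if "x \<in> carrier M" "y \<in> carrier M" for x y
    using g that by (auto simp: mod_hom_def)
  have g0: "g \<zero>\<^bsub>M\<^esub> = \<zero>\<^bsub>N\<^esub>"
    using ga[of "\<zero>\<^bsub>M\<^esub>" "\<zero>\<^bsub>M\<^esub>"] gc[of "\<zero>\<^bsub>M\<^esub>"]
    by (metis M.M.l_zero M.M.zero_closed N.M.add.l_cancel_one)
  show ?thesis using fin f
  proof (induction S rule: finite_induct)
    case empty
    then show ?case by (simp add: g0)
  next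
    case (insert x S)
    then have c: "f x \<in> carrier M" "f \<in> S \<rightarrow> carrier M" by auto
    then have "(\<lambda>y. g (f y)) \<in> S \<rightarrow> carrier N" "g (f x) \<in> carrier N" using gc by auto
    then show ?case using insert c
      by (simp add: M.M.finsum_insert N.M.finsum_insert ga M.M.finsum_closed)
  qed
qed

lemma projective_lift:
  fixes P :: "('r, 'm) module" and M :: "('r, 'a) module" and N :: "('r, 'b) module"
  assumes P: "projective R P" and M: "left_module R M" and N: "left_module R N"
    and g: "g \<in> mod_hom R M N" and surj: "g ` carrier M = carrier N"
    and f: "f \<in> mod_hom R P N"
  shows "\<exists>f' \<in> mod_hom R P M. \<forall>x\<in>carrier P. g (f' x) = f x"
proof -
  have LP: "left_module R P" using P by (simp add: projective_def)
  interpret P: left_module R P by fact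
  interpret N: left_module R N by fact
  let ?F = "free_module R (carrier P)"
  have F: "left_module R ?F" by (rule free_module_left_module) (rule P.R.ring_axioms)
  define p where "p = (\<lambda>\<phi>. \<Oplus>\<^bsub>P\<^esub>x\<in>{x. \<phi> x \<noteq> \<zero>\<^bsub>R\<^esub>}. \<phi> x \<odot>\<^bsub>P\<^esub> x)"
  have p: "p \<in> mod_hom R ?F P"
    using free_module_hom[OF LP, of "\<lambda>x. x" "carrier P"] by (simp add: p_def)
  have psurj: "p ` carrier ?F = carrier P"
  proof
    show "p ` carrier ?F \<subseteq> carrier P" using p by (auto simp: mod_hom_def)
    show "carrier P \<subseteq> p ` carrier ?F"
    proof
      fix x assume x: "x \<in> carrier P"
      define \<delta> where "\<delta> = (\<lambda>y. if y = x then \<one>\<^bsub>R\<^esub> else \<zero>\<^bsub>R\<^esub>)"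
      have supp: "{y. \<delta> y \<noteq> \<zero>\<^bsub>R\<^esub>} = (if \<one>\<^bsub>R\<^esub> = \<zero>\<^bsub>R\<^esub> then {} else {x})"
        by (auto simp: \<delta>_def)
      have d: "\<delta> \<in> carrier ?F"
        using x supp by (auto simp: free_module_def \<delta>_def)
      have "p \<delta> = x"
      proof (cases "\<one>\<^bsub>R\<^esub> = \<zero>\<^bsub>R\<^esub>")
        case True
        have "\<zero>\<^bsub>R\<^esub> \<odot>\<^bsub>P\<^esub> x \<oplus>\<^bsub>P\<^esub> \<zero>\<^bsub>R\<^esub> \<odot>\<^bsub>P\<^esub> x = \<zero>\<^bsub>R\<^esub> \<odot>\<^bsub>P\<^esub> x"
          using P.smult_l_distr[of "\<zero>\<^bsub>R\<^esub>" "\<zero>\<^bsub>R\<^esub>" x] x by simp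
        then have "x \<oplus>\<^bsub>P\<^esub> x = x" using P.smult_one[OF x] True by simp
        then have "x = \<zero>\<^bsub>P\<^esub>" using x by (metis P.M.add.l_cancel_one)
        then show ?thesis unfolding p_def supp using True by simp
      next
        case False
        then show ?thesis unfolding p_def supp using x
          by (simp add: P.M.finsum_insert[of "{}" x, simplified] \<delta>_def)
      qed
      with d show "x \<in> p ` carrier ?F" by blast
    qed
  qed
  have idP: "(\<lambda>x. x) \<in> mod_hom R P P" by (auto simp: mod_hom_def)
  have "\<exists>s \<in> mod_hom R P ?F. \<forall>x\<in>carrier P. p (s x) = x"
    using P[unfolded projective_def, THEN conjunct2, rule_format, OF p idP F LP psurj] .
  then obtain s where s: "s \<in> mod_hom R P ?F" "\<And>x. x \<in> carrier P \<Longrightarrow> p (s x) = x"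
    by blast
  have "\<forall>x\<in>carrier P. \<exists>y\<in>carrier M. g y = f x"
  proof
    fix x assume "x \<in> carrier P"
    then have "f x \<in> g ` carrier M" using f surj by (auto simp: mod_hom_def)
    then show "\<exists>y\<in>carrier M. g y = f x" by force
  qed
  then obtain m where m: "\<And>x. x \<in> carrier P \<Longrightarrow> m x \<in> carrier M \<and> g (m x) = f x" by metis
  define t where "t = (\<lambda>\<phi>. \<Oplus>\<^bsub>M\<^esub>x\<in>{x. \<phi> x \<noteq> \<zero>\<^bsub>R\<^esub>}. \<phi> x \<odot>\<^bsub>M\<^esub> m x)"
  have t: "t \<in> mod_hom R ?F M"
    unfolding t_def using m by (intro free_module_hom[OF M]) auto
  have gt: "g (t \<phi>) = f (p \<phi>)" if phi: "\<phi> \<in> carrier ?F" for \<phi>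
  proof -
    interpret M: left_module R M by fact
    let ?S = "{x. \<phi> x \<noteq> \<zero>\<^bsub>R\<^esub>}"
    have S: "finite ?S" "?S \<subseteq> carrier P" and c: "\<And>x. \<phi> x \<in> carrier R"
      using phi by (auto simp: free_module_def image_subset_iff)
    have "g (t \<phi>) = (\<Oplus>\<^bsub>N\<^esub>x\<in>?S. g (\<phi> x \<odot>\<^bsub>M\<^esub> m x))"
      unfolding t_def using m S c by (intro mod_hom_finsum[OF M N g]) auto
    also have "\<dots> = (\<Oplus>\<^bsub>N\<^esub>x\<in>?S. f (\<phi> x \<odot>\<^bsub>P\<^esub> x))"
    proof (rule N.M.finsum_cong')
      fix x assume "x \<in> ?S"
      then have x: "x \<in> carrier P" using S by blast
      have "g (\<phi> x \<odot>\<^bsub>M\<^esub> m x) = \<phi> x \<odot>\<^bsub>N\<^esub> g (m x)" using g m[OF x] c by (auto simp: mod_hom_def)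
      also have "\<dots> = f (\<phi> x \<odot>\<^bsub>P\<^esub> x)" using f m[OF x] c x by (auto simp: mod_hom_def)
      finally show "g (\<phi> x \<odot>\<^bsub>M\<^esub> m x) = f (\<phi> x \<odot>\<^bsub>P\<^esub> x)" .
    next
      have "f (\<phi> x \<odot>\<^bsub>P\<^esub> x) \<in> carrier N" if "x \<in> ?S" for x
      proof -
        have "\<phi> x \<odot>\<^bsub>P\<^esub> x \<in> carrier P" using that S(2) c by blast
        then show ?thesis using f by (auto simp: mod_hom_def)
      qed
      then show "(\<lambda>x. f (\<phi> x \<odot>\<^bsub>P\<^esub> x)) \<in> ?S \<rightarrow> carrier N" by blast
    qed simp
    also have "\<dots> = f (p \<phi>)"
      unfolding p_def using S c by (intro mod_hom_finsum[OF LP N f, symmetric]) auto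
    finally show ?thesis .
  qed
  have sc: "s x \<in> carrier ?F" if "x \<in> carrier P" for x using s(1) that by (auto simp: mod_hom_def)
  have "(\<lambda>x. t (s x)) \<in> mod_hom R P M"
    using s(1) t sc by (auto simp: mod_hom_def Pi_iff)
  moreover have "\<forall>x\<in>carrier P. g (t (s x)) = f x" using gt sc s(2) by simp
  ultimately show ?thesis by (intro bexI[where x = "\<lambda>x. t (s x)"])
qed


section \<open>Cochain complexes\<close>

record ('r, 'm) cochain =
  obj :: "int \<Rightarrow> ('r, 'm) module"
  diff :: "int \<Rightarrow> 'm \<Rightarrow> 'm"

definition graded_map ::
  "('r, 'k) ring_scheme \<Rightarrow> ('r, 'a) cochain \<Rightarrow> ('r, 'b) cochain \<Rightarrow> int \<Rightarrow> (int \<Rightarrow> 'a \<Rightarrow> 'b) \<Rightarrow> bool" where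
  "graded_map R C D p f \<longleftrightarrow> (\<forall>k. f k \<in> mod_hom R (obj C k) (obj D (k + p)))"

definition cochain_complex :: "('r, 'k) ring_scheme \<Rightarrow> ('r, 'm) cochain \<Rightarrow> bool" where
  "cochain_complex R C \<longleftrightarrow> (\<forall>k. left_module R (obj C k)) \<and> graded_map R C C 1 (diff C) \<and>
     (\<forall>k. \<forall>x\<in>carrier (obj C k). diff C (k + 1) (diff C k x) = \<zero>\<^bsub>obj C (k + 2)\<^esub>)"

definition cochain_map ::
  "('r, 'k) ring_scheme \<Rightarrow> ('r, 'a) cochain \<Rightarrow> ('r, 'b) cochain \<Rightarrow> (int \<Rightarrow> 'a \<Rightarrow> 'b) \<Rightarrow> bool" where
  "cochain_map R C D f \<longleftrightarrow> cochain_complex R C \<and> cochain_complex R D \<and> graded_map R C D 0 f \<and>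
     (\<forall>k. \<forall>x\<in>carrier (obj C k). f (k + 1) (diff C k x) = diff D k (f k x))"

text \<open>\<open>K\<close> is a homotopy from \<open>f\<close> to \<open>g\<close>, with the sign convention \<open>d K + K d = g - f\<close>.\<close>

definition homotopy ::
  "('r, 'k) ring_scheme \<Rightarrow> ('r, 'a) cochain \<Rightarrow> ('r, 'b) cochain \<Rightarrow> (int \<Rightarrow> 'a \<Rightarrow> 'b) \<Rightarrow> (int \<Rightarrow> 'a \<Rightarrow> 'b) \<Rightarrow>
    (int \<Rightarrow> 'a \<Rightarrow> 'b) \<Rightarrow> bool" where
  "homotopy R C D f g K \<longleftrightarrow> graded_map R C D (-1) K \<and>
     (\<forall>k. \<forall>x\<in>carrier (obj C k).
        diff D (k - 1) (K k x) \<oplus>\<^bsub>obj D k\<^esub> K (k + 1) (diff C k x) = g k x \<ominus>\<^bsub>obj D k\<^esub> f k x)"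

definition homotopy_equivalence ::
  "('r, 'k) ring_scheme \<Rightarrow> ('r, 'a) cochain \<Rightarrow> ('r, 'b) cochain \<Rightarrow> (int \<Rightarrow> 'a \<Rightarrow> 'b) \<Rightarrow> bool" where
  "homotopy_equivalence R C D f \<longleftrightarrow> cochain_map R C D f \<and>
     (\<exists>g. cochain_map R D C g \<and>
        (\<exists>K. homotopy R C C (\<lambda>k x. x) (\<lambda>k x. g k (f k x)) K) \<and>
        (\<exists>K. homotopy R D D (\<lambda>k x. x) (\<lambda>k x. f k (g k x)) K))"

definition cocycles :: "('r, 'm) cochain \<Rightarrow> int \<Rightarrow> 'm set" where
  "cocycles C k = {x \<in> carrier (obj C k). diff C k x = \<zero>\<^bsub>obj C (k + 1)\<^esub>}"

definition coboundaries :: "('r, 'm) cochain \<Rightarrow> int \<Rightarrow> 'm set" where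
  "coboundaries C k = diff C (k - 1) ` carrier (obj C (k - 1))"

definition cohomology :: "('r, 'm) cochain \<Rightarrow> int \<Rightarrow> ('r, 'm set) module" where
  "cohomology C k = quot_module ((obj C k)\<lparr>carrier := cocycles C k\<rparr>) (coboundaries C k)"

definition cohomology_map ::
  "('r, 'b) cochain \<Rightarrow> (int \<Rightarrow> 'a \<Rightarrow> 'b) \<Rightarrow> int \<Rightarrow> 'a set \<Rightarrow> 'b set" where
  "cohomology_map D f k X = (\<Union>x\<in>X. coboundaries D k +>\<^bsub>obj D k\<^esub> f k x)"

definition quasi_iso ::
  "('r, 'k) ring_scheme \<Rightarrow> ('r, 'a) cochain \<Rightarrow> ('r, 'b) cochain \<Rightarrow> (int \<Rightarrow> 'a \<Rightarrow> 'b) \<Rightarrow> bool" where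
  "quasi_iso R C D f \<longleftrightarrow> cochain_map R C D f \<and>
     (\<forall>k. cohomology_map D f k \<in> mod_iso R (cohomology C k) (cohomology D k))"

definition bounded_above :: "('r, 'm) cochain \<Rightarrow> bool" where
  "bounded_above C \<longleftrightarrow> (\<exists>m. \<forall>k>m. carrier (obj C k) = {\<zero>\<^bsub>obj C k\<^esub>})"


section \<open>Cubes and their totalisation\<close>

text \<open>\<open>face i B\<close> removes the \<open>i\<close>-th smallest element of \<open>B\<close>, counting from 1.\<close>

definition face :: "nat \<Rightarrow> nat set \<Rightarrow> nat set" where
  "face i B = B - {sorted_list_of_set B ! (i - 1)}"

text \<open>For \<open>A = B\<close> the index list is empty and the incidence number is 1.\<close>

definition incidence :: "nat set \<Rightarrow> nat set \<Rightarrow> int" where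
  "incidence B A = (-1) ^ (card B - card A) *
     (-1) ^ sum_list (THE is. sorted_wrt (<) is \<and> set is \<subseteq> {1..card B} \<and> foldr face is B = A)"

text \<open>The data of a special cube; that its totalisation is a cochain complex is not part of
  the record.\<close>

record ('r, 'm) cube =
  base :: "('r, 'm) cochain"
  edge :: "nat \<Rightarrow> int \<Rightarrow> 'm \<Rightarrow> 'm"
  higher :: "nat set \<Rightarrow> int \<Rightarrow> 'm \<Rightarrow> 'm"

text \<open>\<open>cube_map Q S\<close> is the map between the vertices \<open>A\<close> and \<open>B\<close> with \<open>B - A = S\<close>; it has
  degree \<open>1 - card S\<close>.\<close>

definition cube_map :: "('r, 'm) cube \<Rightarrow> nat set \<Rightarrow> int \<Rightarrow> 'm \<Rightarrow> 'm" where
  "cube_map Q S = (if card S = 0 then diff (base Q)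
     else if card S = 1 then edge Q (the_elem S) else higher Q S)"

definition Tot_entry ::
  "('r, 'm) cube \<Rightarrow> int \<Rightarrow> nat set \<Rightarrow> nat set \<Rightarrow> 'm \<Rightarrow> 'm" where
  "Tot_entry Q l B A x =
     (let M = obj (base Q) (l + 1 - int (card B)) in
      if A \<subseteq> B then [((-1) ^ (card A * card B) * incidence B A)] \<cdot>\<^bsub>M\<^esub>
        cube_map Q (B - A) (l - int (card A)) x
      else \<zero>\<^bsub>M\<^esub>)"

definition Tot :: "nat set \<Rightarrow> ('r, 'm) cube \<Rightarrow> ('r, nat set \<Rightarrow> 'm) cochain" where
  "Tot N Q = \<lparr>
     obj = (\<lambda>l. prod_module (Pow N) (\<lambda>A. obj (base Q) (l - int (card A)))),
     diff = (\<lambda>l. matrix_map (Pow N) (\<lambda>B. obj (base Q) (l + 1 - int (card B))) (Tot_entry Q l))\<rparr>"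

text \<open>The map of totalisations into \<open>Tot N Q\<close> given by the diagonal matrix with all diagonal
  entries equal to \<open>\<beta>\<close>.\<close>

definition diag_map ::
  "nat set \<Rightarrow> ('r, 'b) cube \<Rightarrow> (int \<Rightarrow> 'a \<Rightarrow> 'b) \<Rightarrow> int \<Rightarrow> (nat set \<Rightarrow> 'a) \<Rightarrow> nat set \<Rightarrow> 'b" where
  "diag_map N Q \<beta> l = matrix_map (Pow N) (\<lambda>B. obj (base Q) (l - int (card B)))
     (\<lambda>B A x. if A = B then \<beta> (l - int (card A)) x else \<zero>\<^bsub>obj (base Q) (l - int (card B))\<^esub>)"


section \<open>Derived cubes\<close>

text \<open>\<open>hG_word h G [z1, ..., zs] k\<close> is the composite \<open>h z1 G h z2 G ... G h zs\<close> on degree \<open>k\<close>.\<close>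

fun hG_word ::
  "(nat \<Rightarrow> int \<Rightarrow> 'm \<Rightarrow> 'm) \<Rightarrow> (int \<Rightarrow> 'm \<Rightarrow> 'm) \<Rightarrow> nat list \<Rightarrow> int \<Rightarrow> 'm \<Rightarrow> 'm" where
  "hG_word h G [] k x = x"
| "hG_word h G [z] k x = h z k x"
| "hG_word h G (z # w # zs) k x =
     (let j = k - int (length (w # zs)) in h z j (G (j + 1) (hG_word h G (w # zs) k x)))"

definition Der ::
  "('r, 'c) cochain \<Rightarrow> ('r, 'd) cochain \<Rightarrow> (int \<Rightarrow> 'c \<Rightarrow> 'd) \<Rightarrow> (int \<Rightarrow> 'd \<Rightarrow> 'c) \<Rightarrow>
    (int \<Rightarrow> 'd \<Rightarrow> 'd) \<Rightarrow> (nat \<Rightarrow> int \<Rightarrow> 'd \<Rightarrow> 'd) \<Rightarrow> ('r, 'c) cube" where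
  "Der C D \<alpha> \<beta> G h = \<lparr>
     base = C,
     edge = (\<lambda>i k x. \<beta> k (h i k (\<alpha> k x))),
     higher = (\<lambda>S k x.
       let j = k + 1 - int (card S) in
       \<beta> j (\<Oplus>\<^bsub>obj D j\<^esub>\<sigma>\<in>{\<sigma>. \<sigma> permutes S}.
              [sign \<sigma>] \<cdot>\<^bsub>obj D j\<^esub> hG_word h G (map \<sigma> (sorted_list_of_set S)) k (\<alpha> k x)))\<rparr>"

end

theory Submission
  imports Defs
begin

text \<open>
  On \<open>D\<close> tensored with the exterior algebra on \<open>N\<close> let \<open>\<delta>\<close> be the sum of the \<open>h k\<close> with cube signs.
  As the \<open>h k\<close> commute, \<open>\<delta>\<close> squares to zero and anticommutes with the signed differential \<open>d\<close>.
  Expanding the alternating sums along their first letter shows that the off-diagonal part \<open>\<Delta>\<close> of the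
  differential of the derived cube (before \<open>\<alpha>\<close> and \<open>\<beta>\<close>) satisfies \<open>\<Delta> u = \<delta> (u + G \<Delta> u)\<close>. Hence
  \<open>e = d \<Delta> u + \<Delta> d u + \<Delta> \<alpha> \<beta> \<Delta> u\<close> solves \<open>e = \<delta> G e\<close>, and \<open>e = 0\<close> because \<open>\<delta>\<close> raises the
  cardinality of vertices. This is the statement that the totalisations, with differential
  \<open>d + \<beta> \<Delta> \<alpha>\<close>, are complexes, and in this form the diagonal map visibly commutes with them.
  The cone of the diagonal map is filtered by cardinality of vertices with subquotients sums of
  copies of the cone of \<open>\<beta>\<close>, so it is acyclic if \<open>\<beta>\<close> is a quasi-isomorphism; when it is moreover
  bounded above and projective, it is contractible, and the entries of a contraction provide a
  homotopy inverse and the two homotopies.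
\<close>

section \<open>Signs of faces and permutations\<close>

text \<open>Checking directly that the totalisation squares to zero would mean comparing, for every
  \<open>S\<close>, alternating sums over permutations with products of such sums over all
  splittings of \<open>S\<close>. The recursion for \<open>\<Delta>\<close> avoids this:
  permutations enter only through the expansion along the first letter, and the rest is algebra in
  \<open>d\<close>, \<open>\<delta>\<close> and \<open>G\<close>. The equation
  \<open>e = \<delta> G e\<close> arises as follows. With \<open>v = \<Delta> u\<close> one has
  \<open>\<delta> v = 0\<close>, so applying \<open>\<delta>\<close> to
  \<open>d G v + G d v = \<alpha> \<beta> v - v\<close> turns \<open>- \<delta> d G v\<close> into
  \<open>\<delta> G d v - \<delta> \<alpha> \<beta> v\<close>. The last term and
  \<open>- \<delta> d u\<close> cancel against the recursions for the other two summands of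
  \<open>e\<close>. Here \<open>G\<close> carries the same vertex sign as \<open>d\<close>, so that
  the homotopy formula keeps its form. A second constraint comes from types:
  \<open>projective\<close> tests against modules on two fixed types, while the cone consists of
  pairs of families. Hence projectivity of the cone is never formulated; only the lifting property
  against the two modules at hand is used, and it passes from the summands to the cone.\<close>

definition below :: "nat set \<Rightarrow> nat \<Rightarrow> nat" where
  "below B k = card {y \<in> B. y < k}"

text \<open>\<open>below B k\<close> is the zero-based index of \<open>k\<close>, and deleting
  \<open>k\<close> from the set deletes one letter of the list. Both the face maps and the move of
  \<open>k\<close> to the front of a word rest on this.\<close>

lemma sorted_list_of_set_split:
  assumes "finite B" "k \<in> B"
  obtains xs ys where "sorted_list_of_set B = xs @ k # ys"
    "sorted_list_of_set (B - {k}) = xs @ ys" "length xs = below B k"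
proof -
  have "k \<in> set (sorted_list_of_set B)" using assms by simp
  then obtain xs ys where eq: "sorted_list_of_set B = xs @ k # ys" and kx: "k \<notin> set xs"
    by (meson split_list_first)
  have s: "sorted_wrt (<) (xs @ k # ys)"
    using eq by (metis strict_sorted_list_of_set)
  have "B = set (xs @ k # ys)" using eq assms(1) by (metis set_sorted_list_of_set)
  then have "{y \<in> B. y < k} = set xs"
    using s by (auto simp: sorted_wrt_append)
  moreover have "distinct xs"
    using eq by (metis distinct_append distinct_sorted_list_of_set)
  ultimately have "length xs = below B k"
    by (simp add: below_def distinct_card)
  moreover have "sorted_list_of_set (B - {k}) = xs @ ys"
    using assms eq kx by (simp add: sorted_list_of_set_remove remove1_append)
  ultimately show thesis using that eq by blast
qed

lemma nth_below:
  assumes "finite B" "k \<in> B"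
  shows "sorted_list_of_set B ! below B k = k"
  by (rule sorted_list_of_set_split[OF assms]) (metis nth_append_length)

lemma below_less_card:
  assumes "finite B" "k \<in> B"
  shows "below B k < card B"
  unfolding below_def using assms by (intro psubset_card_mono) auto

lemma below_nth:
  assumes "finite B" "i < card B"
  shows "below B (sorted_list_of_set B ! i) = i"
proof -
  have "sorted_list_of_set B ! i \<in> B"
    using assms by (metis nth_mem length_sorted_list_of_set set_sorted_list_of_set)
  then show ?thesis
    using nth_below[OF assms(1)] below_less_card[OF assms(1)] assms
    by (metis distinct_sorted_list_of_set length_sorted_list_of_set nth_eq_iff_index_eq)
qed

lemma inj_on_below: "finite B \<Longrightarrow> inj_on (below B) B"
  by (metis inj_onI nth_below)

text \<open>As the index list increases, \<open>foldr\<close> strikes the largest position first.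
  Smaller positions are then undisturbed, so every index can be read as a position in
  \<open>B\<close> itself.\<close>

lemma foldr_face:
  assumes B: "finite B"
  shows "sorted_wrt (<) is \<Longrightarrow> set is \<subseteq> {1..card B} \<Longrightarrow>
    foldr face is B = {k \<in> B. Suc (below B k) \<notin> set is}"
proof (induction "is")
  case (Cons i "is")
  let ?B = "{k \<in> B. Suc (below B k) \<notin> set is}"
  define x where "x = sorted_list_of_set B ! (i - 1)"
  have i: "1 \<le> i" "i - 1 < card B" using Cons.prems by auto
  have x: "x \<in> B" "below B x = i - 1"
    unfolding x_def using i(2) B below_nth
    by (metis nth_mem length_sorted_list_of_set set_sorted_list_of_set)+
  \<comment> \<open>All indices in \<open>is\<close> exceed \<open>i\<close>, so nothing below
    \<open>x\<close> has been struck yet and \<open>x\<close> still has position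
    \<open>i\<close>.\<close>
  have "{y \<in> ?B. y < x} = {y \<in> B. y < x}"
  proof -
    have "Suc (below B y) \<notin> set is" if "y \<in> B" "y < x" for y
    proof -
      have "below B y \<le> below B x"
        unfolding below_def using B that by (intro card_mono) auto
      then have "Suc (below B y) \<le> i" using x i by simp
      then show ?thesis using Cons.prems(1) by auto
    qed
    then show ?thesis by auto
  qed
  then have "below ?B x = i - 1" using x(2) by (simp add: below_def)
  moreover have "x \<in> ?B" using x i Cons.prems(1) by auto
  ultimately have "sorted_list_of_set ?B ! (i - 1) = x"
    using nth_below[of ?B x] B by simp
  then have "face i ?B = ?B - {x}" by (simp add: face_def)
  also have "\<dots> = {k \<in> B. Suc (below B k) \<notin> set (i # is)}"
    using x i inj_on_below[OF B] by (auto dest: inj_onD)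
  finally show ?case using Cons by simp
qed simp

lemma incidence_eq:
  assumes B: "finite B" and AB: "A \<subseteq> B"
  shows "incidence B A = (\<Prod>z\<in>B - A. (-1) ^ below B z)"
proof -
  let ?P = "\<lambda>is. sorted_wrt (<) is \<and> set is \<subseteq> {1..card B} \<and> foldr face is B = A"
  \<comment> \<open>By \<open>foldr_face\<close> an admissible index list must enumerate the
    one-based positions of \<open>B - A\<close>; this settles existence and uniqueness for
    \<open>THE\<close>.\<close>
  define I where "I = (\<lambda>k. Suc (below B k)) ` (B - A)"
  have I: "finite I" "I \<subseteq> {1..card B}"
    using B below_less_card[OF B] by (auto simp: I_def Suc_le_eq)
  have inj: "inj_on (\<lambda>k. Suc (below B k)) B"
    using inj_on_below[OF B] by (auto simp: inj_on_def)
  have "?P (sorted_list_of_set I)"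
    using I foldr_face[OF B, of "sorted_list_of_set I"] AB inj
    by (auto simp: I_def inj_on_def)
  moreover have "is = sorted_list_of_set I" if "?P is" for "is"
  proof -
    have A: "A = {k \<in> B. Suc (below B k) \<notin> set is}" using that foldr_face[OF B] by auto
    have "set is = I"
    proof
      show "set is \<subseteq> I"
      proof
        fix i assume i: "i \<in> set is"
        then have i': "1 \<le> i" "i - 1 < card B" using that by fastforce+
        have "sorted_list_of_set B ! (i - 1) \<in> B"
          using i' B by (metis nth_mem length_sorted_list_of_set set_sorted_list_of_set)
        then show "i \<in> I" unfolding I_def A using below_nth[OF B i'(2)] i' i
          by (intro image_eqI[of _ _ "sorted_list_of_set B ! (i - 1)"]) auto
      qed
      show "I \<subseteq> set is" unfolding I_def A by auto
    qed
    then show ?thesis using that I(1) by (intro strict_sorted_equal) auto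
  qed
  ultimately have the: "(THE is. ?P is) = sorted_list_of_set I" by (rule the_equality)
  have "sum_list (sorted_list_of_set I) = \<Sum>I"
    using I(1) distinct_sum_list_conv_Sum[of "sorted_list_of_set I"] by simp
  also have "\<dots> = (\<Sum>k\<in>B - A. Suc (below B k))"
    unfolding I_def using inj_on_subset[OF inj] by (subst sum.reindex) auto
  finally have "(-1::int) ^ sum_list (sorted_list_of_set I) = (\<Prod>k\<in>B - A. (-1) ^ Suc (below B k))"
    by (simp add: power_sum)
  also have "\<dots> = (-1) ^ card (B - A) * (\<Prod>k\<in>B - A. (-1) ^ below B k)"
    by (simp only: power_Suc prod.distrib prod_constant)
  finally have e: "(-1::int) ^ sum_list (sorted_list_of_set I) =
    (-1) ^ card (B - A) * (\<Prod>k\<in>B - A. (-1) ^ below B k)" .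
  show ?thesis
    unfolding incidence_def the e using AB B
    by (simp add: card_Diff_subset finite_subset flip: power_add mult.assoc)
qed

definition tot_sign :: "nat set \<Rightarrow> nat set \<Rightarrow> int" where
  "tot_sign B A = (-1) ^ (card A * card B) * incidence B A"

lemma tot_sign_self: "finite A \<Longrightarrow> tot_sign A A = (-1) ^ card A"
  by (simp add: tot_sign_def incidence_eq minus_one_power_iff)

text \<open>The coefficient of a word from \<open>A\<close> to \<open>B\<close> with first letter
  \<open>k\<close>, read in two ways: as a Laplace term in the entry of \<open>\<Delta>\<close> at
  \<open>(B, A)\<close>, and as the product of the sign of the edge into \<open>B\<close>, the sign
  of \<open>G\<close> at \<open>B - {k}\<close> and the sign of the entry of \<open>\<Delta>\<close>
  at \<open>(B - {k}, A)\<close>.\<close>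

lemma tot_sign_step:
  assumes B: "finite B" and k: "k \<in> B" and A: "A \<subseteq> B - {k}"
  shows "tot_sign B A * (-1) ^ below (B - A) k =
    (-1) ^ below B k * ((-1) ^ card (B - {k}) * tot_sign (B - {k}) A)"
proof -
  let ?S = "B - {k} - A"
  have fA: "finite A" "A \<subseteq> B" "k \<notin> A" using A B finite_subset by auto
  have "(\<Prod>z\<in>B - A. (-1::int) ^ below B z) = (-1) ^ below B k * (\<Prod>z\<in>?S. (-1) ^ below B z)"
  proof -
    have "B - A = insert k ?S" using k fA by auto
    then show ?thesis using B by (metis Diff_iff finite_Diff prod.insert singletonI)
  qed
  \<comment> \<open>Deleting \<open>k\<close> lowers by one the position of the elements above
    \<open>k\<close> and of no others.\<close>
  also have "(\<Prod>z\<in>?S. (-1::int) ^ below B z) =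
     (\<Prod>z\<in>?S. (-1) ^ below (B - {k}) z * (if k < z then -1 else 1))"
  proof (rule prod.cong[OF refl])
    fix z assume z: "z \<in> ?S"
    show "(-1::int) ^ below B z = (-1) ^ below (B - {k}) z * (if k < z then -1 else 1)"
    proof (cases "k < z")
      case True
      then have "{y \<in> B. y < z} = insert k {y \<in> B - {k}. y < z}" using k by auto
      then show ?thesis using True B by (simp add: below_def)
    next
      case False
      then have "{y \<in> B. y < z} = {y \<in> B - {k}. y < z}" using z by auto
      then show ?thesis using False by (simp add: below_def)
    qed
  qed
  also have "\<dots> = (\<Prod>z\<in>?S. (-1) ^ below (B - {k}) z) * (-1) ^ card {z \<in> ?S. k < z}"
    using B by (simp add: prod.distrib prod.If_cases Int_def conj_commute)
  finally have inc: "incidence B A = (-1) ^ below B k * incidence (B - {k}) A * (-1) ^ card {z \<in> ?S. k < z}"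
    using B fA A by (simp add: incidence_eq)
  \<comment> \<open>The elements of \<open>B - A\<close> other than \<open>k\<close> lie above or
    below \<open>k\<close>. Hence, up to the parity of \<open>card ?S\<close>, the sign counted from
    above equals the Laplace sign counted from below.\<close>
  have "?S = {z \<in> ?S. k < z} \<union> {y \<in> B - A. y < k}" using k fA by auto
  then have "card ?S = card ({z \<in> ?S. k < z} \<union> {y \<in> B - A. y < k})" by (rule arg_cong)
  also have "\<dots> = card {z \<in> ?S. k < z} + below (B - A) k"
    unfolding below_def using B by (intro card_Un_disjoint) auto
  finally have c1: "card ?S = card {z \<in> ?S. k < z} + below (B - A) k" .
  have c2: "card (B - {k}) = card A + card ?S"
    using B A fA by (simp add: card_Diff_subset card_mono)
  have c3: "card B = Suc (card (B - {k}))" using B k by (metis card.remove)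
  have "even (card A * card B + card {z \<in> ?S. k < z} + below (B - A) k) \<longleftrightarrow>
    even (card (B - {k}) + card A * card (B - {k}))"
    unfolding c3 using c1 c2 by auto
  then have "(-1::int) ^ (card A * card B + card {z \<in> ?S. k < z} + below (B - A) k) =
     (-1) ^ (card (B - {k}) + card A * card (B - {k}))"
    by (simp add: minus_one_power_iff)
  then have "(-1::int) ^ (card A * card B) * (-1) ^ card {z \<in> ?S. k < z} * (-1) ^ below (B - A) k =
     (-1) ^ card (B - {k}) * (-1) ^ (card A * card (B - {k}))"
    unfolding power_add .
  note e = this
  have r: "a * b * c = d * e \<Longrightarrow> a * (x * i * b) * c = x * (d * (e * i))" for a b c d e x i :: int
  proof -
    assume e: "a * b * c = d * e"
    have "a * (x * i * b) * c = x * i * (a * b * c)" by (simp only: mult_ac)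
    also have "\<dots> = x * (d * (e * i))" unfolding e by (simp only: mult_ac)
    finally show ?thesis .
  qed
  show ?thesis unfolding tot_sign_def inc by (rule r[OF e])
qed

section \<open>Permutations sorted by the first letter of their word\<close>

text \<open>Induction on \<open>xs\<close> from its last letter \<open>a\<close>: a transposition of
  letters moves \<open>k\<close> one place to the left and costs one sign. Permutations act on
  letters, so \<open>?t\<close> is applied before the permutation from the induction
  hypothesis.\<close>

lemma exists_permutes_front:
  assumes "distinct (xs @ k # ys)"
  shows "\<exists>c. c permutes set (xs @ k # ys) \<and> map c (xs @ k # ys) = k # xs @ ys \<and>
    sign c = (-1) ^ length xs"
  using assms
proof (induction xs arbitrary: ys rule: rev_induct)
  case Nil
  show ?case using permutes_id[unfolded id_def] by (intro exI[of _ "\<lambda>x. x"]) (auto simp: sign_id[unfolded id_def])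
next
  case (snoc a xs)
  then have "distinct (xs @ k # a # ys)" by auto
  from snoc.IH[OF this] obtain c where c: "c permutes set (xs @ k # a # ys)"
    "map c (xs @ k # a # ys) = k # xs @ a # ys" "sign c = (-1) ^ length xs"
    by (elim exE conjE) (rule that)
  let ?t = "transpose a k"
  have S: "set ((xs @ [a]) @ k # ys) = set (xs @ k # a # ys)" by auto
  have t: "?t permutes set (xs @ k # a # ys)" by (intro permutes_swap_id) auto
  have "map ?t ((xs @ [a]) @ k # ys) = xs @ k # a # ys"
  proof -
    have "map ?t zs = zs" if "a \<notin> set zs" "k \<notin> set zs" for zs
      using that by (intro map_idI) (auto simp: transpose_def)
    then show ?thesis using snoc.prems by simp
  qed
  then have "map (c \<circ> ?t) ((xs @ [a]) @ k # ys) = k # (xs @ [a]) @ ys"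
    using c(2) by (metis (no_types, lifting) append.assoc append_Cons append_Nil map_map)
  moreover have "sign (c \<circ> ?t) = (-1) ^ length (xs @ [a])"
    using snoc.prems c(3) permutes_imp_permutation[OF _ c(1)] permutes_imp_permutation[OF _ t]
    by (subst sign_compose) (auto simp: sign_swap_id)
  moreover have "c \<circ> ?t permutes set ((xs @ [a]) @ k # ys)"
    unfolding S by (rule permutes_compose[OF t c(1)])
  ultimately show ?case by (intro exI[of _ "c \<circ> ?t"] conjI)
qed

lemma permutes_first_letter:
  assumes S: "finite S" and k: "k \<in> S"
  obtains c where "c permutes S"
    "map c (sorted_list_of_set S) = k # sorted_list_of_set (S - {k})"
    "sign c = (-1) ^ below S k"
proof -
  obtain xs ys where l: "sorted_list_of_set S = xs @ k # ys"
    "sorted_list_of_set (S - {k}) = xs @ ys" "length xs = below S k"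
    by (rule sorted_list_of_set_split[OF S k])
  have "distinct (xs @ k # ys)" using l by (metis distinct_sorted_list_of_set)
  moreover have "set (xs @ k # ys) = S" using l S by (metis set_sorted_list_of_set)
  ultimately show thesis using exists_permutes_front[of xs k ys] l that by metis
qed

text \<open>The permutations whose word begins with \<open>k\<close> form one coset of those of
  \<open>S - {k}\<close>, with representative \<open>c k\<close>, whose sign is the Laplace sign.
  For empty \<open>S\<close> the union would miss the identity, hence the condition in the last
  clause.\<close>

lemma permutations_by_first_letter:
  assumes S: "finite S"
  obtains c where "\<And>k. k \<in> S \<Longrightarrow> c k permutes S"
    and "\<And>k. k \<in> S \<Longrightarrow> map (c k) (sorted_list_of_set S) = k # sorted_list_of_set (S - {k})"
    and "\<And>k. k \<in> S \<Longrightarrow> sign (c k) = (-1) ^ below S k"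
    and "S \<noteq> {} \<Longrightarrow> {\<sigma>. \<sigma> permutes S} = (\<Union>k\<in>S. (\<lambda>\<tau>. \<tau> \<circ> c k) ` {\<tau>. \<tau> permutes (S - {k})})"
proof -
  have "\<forall>k\<in>S. \<exists>c. c permutes S \<and> map c (sorted_list_of_set S) = k # sorted_list_of_set (S - {k}) \<and>
      sign c = (-1) ^ below S k"
    using permutes_first_letter[OF S] by metis
  then obtain c where c: "\<And>k. k \<in> S \<Longrightarrow> c k permutes S"
    "\<And>k. k \<in> S \<Longrightarrow> map (c k) (sorted_list_of_set S) = k # sorted_list_of_set (S - {k})"
    "\<And>k. k \<in> S \<Longrightarrow> sign (c k) = (-1) ^ below S k"
    by metis
  have "{\<sigma>. \<sigma> permutes S} = (\<Union>k\<in>S. (\<lambda>\<tau>. \<tau> \<circ> c k) ` {\<tau>. \<tau> permutes (S - {k})})" if ne: "S \<noteq> {}"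
  proof
    show "(\<Union>k\<in>S. (\<lambda>\<tau>. \<tau> \<circ> c k) ` {\<tau>. \<tau> permutes (S - {k})}) \<subseteq> {\<sigma>. \<sigma> permutes S}"
      using c(1) by (auto intro!: permutes_compose intro: permutes_subset)
    show "{\<sigma>. \<sigma> permutes S} \<subseteq> (\<Union>k\<in>S. (\<lambda>\<tau>. \<tau> \<circ> c k) ` {\<tau>. \<tau> permutes (S - {k})})"
    proof
      fix \<sigma> assume "\<sigma> \<in> {\<sigma>. \<sigma> permutes S}"
      then have \<sigma>: "\<sigma> permutes S" by simp
      \<comment> \<open>\<open>z\<close> is the least element of \<open>S\<close>, so
        \<open>\<sigma> z\<close> is the first letter of the word of \<open>\<sigma>\<close>. As
        \<open>c ?k\<close> sends \<open>z\<close> to the same letter, \<open>\<sigma>\<close>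
        composed with the inverse of \<open>c ?k\<close> fixes it.\<close>
      define z where "z = hd (sorted_list_of_set S)"
      have z: "z \<in> S" "sorted_list_of_set S \<noteq> []"
        using ne S hd_in_set[of "sorted_list_of_set S"] by (auto simp: z_def)
      let ?k = "\<sigma> z"
      have k: "?k \<in> S" using \<sigma> z by (simp add: permutes_in_image)
      have ck: "c ?k z = ?k"
        using c(2)[OF k] z(2) unfolding z_def by (metis list.sel(1) list.map_sel(1))
      have bij: "bij (c ?k)" using c(1)[OF k] by (rule permutes_bij)
      have p: "\<sigma> \<circ> inv_into UNIV (c ?k) permutes S" using \<sigma> c(1)[OF k] by (intro permutes_compose permutes_inv)
      have "inv_into UNIV (c ?k) ?k = z" using ck bij by (intro inv_f_eq bij_is_inj)
      then have "\<sigma> \<circ> inv_into UNIV (c ?k) permutes (S - {?k})"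
        by (intro permutes_superset[OF p]) (simp add: o_def)
      moreover have "\<sigma> = (\<sigma> \<circ> inv_into UNIV (c ?k)) \<circ> c ?k"
        using bij by (simp add: fun_eq_iff bij_is_inj)
      ultimately show "\<sigma> \<in> (\<Union>k\<in>S. (\<lambda>\<tau>. \<tau> \<circ> c k) ` {\<tau>. \<tau> permutes (S - {k})})"
        using k by blast
    qed
  qed
  then show thesis using that c by blast
qed

section \<open>Homomorphisms and products of left modules\<close>

lemma mod_hom_closed: "f \<in> mod_hom R M N \<Longrightarrow> x \<in> carrier M \<Longrightarrow> f x \<in> carrier N"
  by (auto simp: mod_hom_def)

lemma mod_hom_add:
  "f \<in> mod_hom R M N \<Longrightarrow> x \<in> carrier M \<Longrightarrow> y \<in> carrier M \<Longrightarrow> f (x \<oplus>\<^bsub>M\<^esub> y) = f x \<oplus>\<^bsub>N\<^esub> f y"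
  by (auto simp: mod_hom_def)

lemma mod_hom_smult:
  "f \<in> mod_hom R M N \<Longrightarrow> r \<in> carrier R \<Longrightarrow> x \<in> carrier M \<Longrightarrow> f (r \<odot>\<^bsub>M\<^esub> x) = r \<odot>\<^bsub>N\<^esub> f x"
  by (auto simp: mod_hom_def)

lemma mod_homI:
  assumes "\<And>x. x \<in> carrier M \<Longrightarrow> f x \<in> carrier N"
    and "\<And>x y. x \<in> carrier M \<Longrightarrow> y \<in> carrier M \<Longrightarrow> f (x \<oplus>\<^bsub>M\<^esub> y) = f x \<oplus>\<^bsub>N\<^esub> f y"
    and "\<And>r x. r \<in> carrier R \<Longrightarrow> x \<in> carrier M \<Longrightarrow> f (r \<odot>\<^bsub>M\<^esub> x) = r \<odot>\<^bsub>N\<^esub> f x"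
  shows "f \<in> mod_hom R M N"
  using assms by (auto simp: mod_hom_def)

text \<open>Zero, negatives and integer multiples concern the additive group alone; passing to
  \<open>add_monoid\<close> makes the library facts on group homomorphisms available for
  them.\<close>

lemma add_group_hom:
  assumes "abelian_group M" "abelian_group N"
    and "\<And>x. x \<in> carrier M \<Longrightarrow> f x \<in> carrier N"
    and "\<And>x y. x \<in> carrier M \<Longrightarrow> y \<in> carrier M \<Longrightarrow> f (x \<oplus>\<^bsub>M\<^esub> y) = f x \<oplus>\<^bsub>N\<^esub> f y"
  shows "group_hom (add_monoid M) (add_monoid N) f"
  using assms by (auto simp: group_hom_def group_hom_axioms_def hom_def abelian_group.a_group)

lemma mod_hom_group_hom:
  assumes "left_module R M" "left_module R N" "f \<in> mod_hom R M N"
  shows "group_hom (add_monoid M) (add_monoid N) f"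
  using assms by (intro add_group_hom) (auto simp: left_module_def mod_hom_def)

lemma mod_hom_zero:
  assumes "left_module R M" "left_module R N" "f \<in> mod_hom R M N"
  shows "f \<zero>\<^bsub>M\<^esub> = \<zero>\<^bsub>N\<^esub>"
  using group_hom.hom_one[OF mod_hom_group_hom[OF assms]] by simp

lemma mod_hom_neg:
  assumes "left_module R M" "left_module R N" "f \<in> mod_hom R M N" "x \<in> carrier M"
  shows "f (\<ominus>\<^bsub>M\<^esub> x) = \<ominus>\<^bsub>N\<^esub> f x"
  using group_hom.hom_inv[OF mod_hom_group_hom[OF assms(1-3)]] assms(4) by (simp add: a_inv_def)

lemma mod_hom_minus:
  assumes "left_module R M" "left_module R N" "f \<in> mod_hom R M N" "x \<in> carrier M" "y \<in> carrier M"
  shows "f (x \<ominus>\<^bsub>M\<^esub> y) = f x \<ominus>\<^bsub>N\<^esub> f y"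
proof -
  interpret M: left_module R M by fact
  show ?thesis using assms by (simp add: a_minus_def mod_hom_add mod_hom_neg)
qed

lemma mod_hom_int_mult:
  assumes "left_module R M" "left_module R N" "f \<in> mod_hom R M N" "x \<in> carrier M"
  shows "f ([(c::int)] \<cdot>\<^bsub>M\<^esub> x) = [c] \<cdot>\<^bsub>N\<^esub> f x"
  using group_hom.hom_int_pow[OF mod_hom_group_hom[OF assms(1-3)]] assms(4)
  by (simp add: add_pow_def)

context left_module
begin

lemma int_mult_assoc: "x \<in> carrier M \<Longrightarrow> [a] \<cdot>\<^bsub>M\<^esub> ([b] \<cdot>\<^bsub>M\<^esub> x) = [((a * b)::int)] \<cdot>\<^bsub>M\<^esub> x"
  using M.add.int_pow_pow[of x a b] M.add.int_pow_pow[of x b a] by (simp add: mult.commute)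

lemma int_mult_neg: "x \<in> carrier M \<Longrightarrow> [(- a :: int)] \<cdot>\<^bsub>M\<^esub> x = \<ominus>\<^bsub>M\<^esub> ([a] \<cdot>\<^bsub>M\<^esub> x)"
  by (rule M.add.int_pow_neg)

lemma int_mult_add:
  "x \<in> carrier M \<Longrightarrow> y \<in> carrier M \<Longrightarrow>
    [(a::int)] \<cdot>\<^bsub>M\<^esub> (x \<oplus>\<^bsub>M\<^esub> y) = [a] \<cdot>\<^bsub>M\<^esub> x \<oplus>\<^bsub>M\<^esub> [a] \<cdot>\<^bsub>M\<^esub> y"
  by (rule M.add.int_pow_distrib)

lemma int_mult_smult:
  assumes "r \<in> carrier R" "x \<in> carrier M"
  shows "r \<odot>\<^bsub>M\<^esub> ([(a::int)] \<cdot>\<^bsub>M\<^esub> x) = [a] \<cdot>\<^bsub>M\<^esub> (r \<odot>\<^bsub>M\<^esub> x)"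
proof -
  have "group_hom (add_monoid M) (add_monoid M) (\<lambda>x. r \<odot>\<^bsub>M\<^esub> x)"
    using assms by (intro add_group_hom M.abelian_group_axioms) (auto simp: smult_r_distr)
  from group_hom.hom_int_pow[OF this] assms show ?thesis by (simp add: add_pow_def)
qed

lemma smult_zero: "r \<in> carrier R \<Longrightarrow> r \<odot>\<^bsub>M\<^esub> \<zero>\<^bsub>M\<^esub> = \<zero>\<^bsub>M\<^esub>"
  using smult_r_distr[of r "\<zero>\<^bsub>M\<^esub>" "\<zero>\<^bsub>M\<^esub>"]
  by (metis M.add.l_cancel_one smult_closed M.zero_closed M.l_zero)

lemma smult_neg:
  assumes "r \<in> carrier R" "x \<in> carrier M"
  shows "r \<odot>\<^bsub>M\<^esub> (\<ominus>\<^bsub>M\<^esub> x) = \<ominus>\<^bsub>M\<^esub> (r \<odot>\<^bsub>M\<^esub> x)"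
  using int_mult_smult[OF assms, of "-1"] assms by (simp add: int_mult_neg)

lemma smult_finsum:
  assumes "finite S" "r \<in> carrier R" "f \<in> S \<rightarrow> carrier M"
  shows "r \<odot>\<^bsub>M\<^esub> (\<Oplus>\<^bsub>M\<^esub>x\<in>S. f x) = (\<Oplus>\<^bsub>M\<^esub>x\<in>S. r \<odot>\<^bsub>M\<^esub> f x)"
  using assms
proof (induction S rule: finite_induct)
  case (insert x S)
  then have f: "f x \<in> carrier M" "f \<in> S \<rightarrow> carrier M"
    and rf: "r \<odot>\<^bsub>M\<^esub> f x \<in> carrier M" "(\<lambda>y. r \<odot>\<^bsub>M\<^esub> f y) \<in> S \<rightarrow> carrier M" by auto
  show ?case
    using insert f rf by (simp add: M.finsum_insert smult_r_distr M.finsum_closed)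
qed (simp add: smult_zero)

lemma int_mult_finsum:
  assumes "finite S" "f \<in> S \<rightarrow> carrier M"
  shows "[(a::int)] \<cdot>\<^bsub>M\<^esub> (\<Oplus>\<^bsub>M\<^esub>x\<in>S. f x) = (\<Oplus>\<^bsub>M\<^esub>x\<in>S. [a] \<cdot>\<^bsub>M\<^esub> f x)"
  using assms
proof (induction S rule: finite_induct)
  case (insert x S)
  then have f: "f x \<in> carrier M" "f \<in> S \<rightarrow> carrier M"
    and rf: "[a] \<cdot>\<^bsub>M\<^esub> f x \<in> carrier M" "(\<lambda>y. [a] \<cdot>\<^bsub>M\<^esub> f y) \<in> S \<rightarrow> carrier M" by auto
  show ?case
    using insert f rf by (simp add: M.finsum_insert int_mult_add M.finsum_closed)
qed simp

lemma finsum_swap: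
  assumes "finite A" "finite B" "\<And>i j. i \<in> A \<Longrightarrow> j \<in> B \<Longrightarrow> t i j \<in> carrier M"
  shows "(\<Oplus>\<^bsub>M\<^esub>i\<in>A. \<Oplus>\<^bsub>M\<^esub>j\<in>B. t i j) = (\<Oplus>\<^bsub>M\<^esub>j\<in>B. \<Oplus>\<^bsub>M\<^esub>i\<in>A. t i j)"
  using assms(1,3)
proof (induction A rule: finite_induct)
  case (insert a A)
  have c: "t a \<in> B \<rightarrow> carrier M" "(\<lambda>j. \<Oplus>\<^bsub>M\<^esub>i\<in>A. t i j) \<in> B \<rightarrow> carrier M"
    "(\<lambda>i. \<Oplus>\<^bsub>M\<^esub>j\<in>B. t i j) \<in> A \<rightarrow> carrier M"
    using insert.prems by (auto intro!: M.finsum_closed)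
  have "(\<Oplus>\<^bsub>M\<^esub>j\<in>B. \<Oplus>\<^bsub>M\<^esub>i\<in>insert a A. t i j) = (\<Oplus>\<^bsub>M\<^esub>j\<in>B. t a j \<oplus>\<^bsub>M\<^esub> (\<Oplus>\<^bsub>M\<^esub>i\<in>A. t i j))"
    using insert c by (intro M.finsum_cong') (auto simp: M.finsum_insert Pi_iff)
  also have "\<dots> = (\<Oplus>\<^bsub>M\<^esub>j\<in>B. t a j) \<oplus>\<^bsub>M\<^esub> (\<Oplus>\<^bsub>M\<^esub>j\<in>B. \<Oplus>\<^bsub>M\<^esub>i\<in>A. t i j)"
    using c by (intro M.finsum_addf) auto
  also have "\<dots> = (\<Oplus>\<^bsub>M\<^esub>i\<in>insert a A. \<Oplus>\<^bsub>M\<^esub>j\<in>B. t i j)"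
    using insert c by (simp add: M.finsum_insert M.finsum_closed)
  finally show ?case ..
qed (simp add: M.add.finprod_one)

text \<open>Induction on the index set: the row and the column of the new index cancel each other.
  No division by 2 is involved, since the diagonal is assumed to vanish.\<close>

lemma finsum_antisym:
  assumes "finite B" "\<And>i j. i \<in> B \<Longrightarrow> j \<in> B \<Longrightarrow> t i j \<in> carrier M"
    and "\<And>i. i \<in> B \<Longrightarrow> t i i = \<zero>\<^bsub>M\<^esub>"
    and "\<And>i j. i \<in> B \<Longrightarrow> j \<in> B \<Longrightarrow> i \<noteq> j \<Longrightarrow> t i j = \<ominus>\<^bsub>M\<^esub> t j i"
  shows "(\<Oplus>\<^bsub>M\<^esub>i\<in>B. \<Oplus>\<^bsub>M\<^esub>j\<in>B. t i j) = \<zero>\<^bsub>M\<^esub>"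
  using assms
proof (induction B rule: finite_induct)
  case empty
  show ?case by simp
next
  case (insert b B)
  have c: "\<And>i. i \<in> B \<Longrightarrow> t i \<in> B \<rightarrow> carrier M" "t b \<in> B \<rightarrow> carrier M" "t b b \<in> carrier M"
    "(\<lambda>i. t i b) \<in> B \<rightarrow> carrier M" using insert.prems(1) by auto
  have "(\<Oplus>\<^bsub>M\<^esub>i\<in>B. \<Oplus>\<^bsub>M\<^esub>j\<in>insert b B. t i j) = (\<Oplus>\<^bsub>M\<^esub>i\<in>B. t i b \<oplus>\<^bsub>M\<^esub> (\<Oplus>\<^bsub>M\<^esub>j\<in>B. t i j))"
    using insert.hyps insert.prems(1) c
    by (intro M.finsum_cong') (auto simp: M.finsum_insert Pi_iff)
  also have "\<dots> = (\<Oplus>\<^bsub>M\<^esub>i\<in>B. t i b) \<oplus>\<^bsub>M\<^esub> (\<Oplus>\<^bsub>M\<^esub>i\<in>B. \<Oplus>\<^bsub>M\<^esub>j\<in>B. t i j)"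
    using c by (intro M.finsum_addf) (auto intro!: M.finsum_closed)
  also have "(\<Oplus>\<^bsub>M\<^esub>i\<in>B. \<Oplus>\<^bsub>M\<^esub>j\<in>B. t i j) = \<zero>\<^bsub>M\<^esub>"
    by (rule insert.IH) (use insert.prems in blast)+
  finally have 1: "(\<Oplus>\<^bsub>M\<^esub>i\<in>B. \<Oplus>\<^bsub>M\<^esub>j\<in>insert b B. t i j) = (\<Oplus>\<^bsub>M\<^esub>i\<in>B. t i b)"
    using c by (simp add: M.finsum_closed)
  have 2: "(\<Oplus>\<^bsub>M\<^esub>j\<in>insert b B. t b j) = (\<Oplus>\<^bsub>M\<^esub>j\<in>B. t b j)"
    using insert.hyps insert.prems(2) c by (simp add: M.finsum_insert M.finsum_closed)
  have "(\<Oplus>\<^bsub>M\<^esub>j\<in>B. t b j) \<oplus>\<^bsub>M\<^esub> (\<Oplus>\<^bsub>M\<^esub>i\<in>B. t i b) = (\<Oplus>\<^bsub>M\<^esub>j\<in>B. t b j \<oplus>\<^bsub>M\<^esub> t j b)"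
    using c by (intro M.finsum_addf[symmetric]) auto
  also have "\<dots> = (\<Oplus>\<^bsub>M\<^esub>j\<in>B. \<zero>\<^bsub>M\<^esub>)"
  proof (intro M.finsum_cong')
    fix j assume j: "j \<in> B"
    then have "b \<noteq> j" using insert.hyps by auto
    then have "t b j = \<ominus>\<^bsub>M\<^esub> t j b" using j by (intro insert.prems(3)) auto
    moreover have "t j b \<in> carrier M" using j by (intro insert.prems(1)) auto
    ultimately show "t b j \<oplus>\<^bsub>M\<^esub> t j b = \<zero>\<^bsub>M\<^esub>" by (simp add: M.l_neg)
  qed auto
  also have "\<dots> = \<zero>\<^bsub>M\<^esub>" by (simp add: M.add.finprod_one)
  finally have 3: "(\<Oplus>\<^bsub>M\<^esub>j\<in>B. t b j) \<oplus>\<^bsub>M\<^esub> (\<Oplus>\<^bsub>M\<^esub>i\<in>B. t i b) = \<zero>\<^bsub>M\<^esub>" .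
  have "(\<Oplus>\<^bsub>M\<^esub>i\<in>insert b B. \<Oplus>\<^bsub>M\<^esub>j\<in>insert b B. t i j) =
    (\<Oplus>\<^bsub>M\<^esub>j\<in>insert b B. t b j) \<oplus>\<^bsub>M\<^esub> (\<Oplus>\<^bsub>M\<^esub>i\<in>B. \<Oplus>\<^bsub>M\<^esub>j\<in>insert b B. t i j)"
    using insert.hyps insert.prems(1) by (subst M.finsum_insert) (auto intro!: M.finsum_closed)
  then show ?case unfolding 1 2 3 .
qed

end

lemma mod_hom_comp:
  "f \<in> mod_hom R M N \<Longrightarrow> g \<in> mod_hom R N P \<Longrightarrow> (\<lambda>x. g (f x)) \<in> mod_hom R M P"
  by (auto simp: mod_hom_def Pi_iff)

lemma mod_hom_id: "(\<lambda>x. x) \<in> mod_hom R M M"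
  by (auto simp: mod_hom_def)

lemma mod_hom_zero_map: "left_module R N \<Longrightarrow> (\<lambda>x. \<zero>\<^bsub>N\<^esub>) \<in> mod_hom R M N"
proof -
  assume "left_module R N"
  then interpret N: left_module R N .
  show ?thesis by (auto simp: mod_hom_def N.smult_zero)
qed

lemma mod_hom_plus:
  assumes "left_module R N" "f \<in> mod_hom R M N" "g \<in> mod_hom R M N"
  shows "(\<lambda>x. f x \<oplus>\<^bsub>N\<^esub> g x) \<in> mod_hom R M N"
proof -
  interpret N: left_module R N by fact
  show ?thesis using assms
    by (intro mod_homI)
      (simp_all add: mod_hom_closed mod_hom_add mod_hom_smult N.smult_r_distr N.M.add.m_ac)
qed

lemma mod_hom_uminus:
  assumes "left_module R N" "f \<in> mod_hom R M N"
  shows "(\<lambda>x. \<ominus>\<^bsub>N\<^esub> f x) \<in> mod_hom R M N"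
proof -
  interpret N: left_module R N by fact
  show ?thesis using assms
    by (intro mod_homI)
      (simp_all add: mod_hom_closed mod_hom_add mod_hom_smult N.smult_neg N.M.minus_add)
qed

lemma mod_hom_diff:
  assumes "left_module R N" "f \<in> mod_hom R M N" "g \<in> mod_hom R M N"
  shows "(\<lambda>x. f x \<ominus>\<^bsub>N\<^esub> g x) \<in> mod_hom R M N"
  unfolding a_minus_def using assms by (intro mod_hom_plus mod_hom_uminus)

lemma mod_hom_int_multiple:
  assumes "left_module R N" "f \<in> mod_hom R M N"
  shows "(\<lambda>x. [(a::int)] \<cdot>\<^bsub>N\<^esub> f x) \<in> mod_hom R M N"
proof -
  interpret N: left_module R N by fact
  show ?thesis using assms
    by (intro mod_homI)
      (simp_all add: mod_hom_closed mod_hom_add mod_hom_smult N.int_mult_smult N.int_mult_add)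
qed

lemma mod_hom_sum:
  assumes "left_module R N" "finite I" "\<And>i. i \<in> I \<Longrightarrow> f i \<in> mod_hom R M N"
  shows "(\<lambda>x. \<Oplus>\<^bsub>N\<^esub>i\<in>I. f i x) \<in> mod_hom R M N"
proof -
  interpret N: left_module R N by fact
  show ?thesis
  proof (rule mod_homI)
    fix x assume "x \<in> carrier M"
    then show "(\<Oplus>\<^bsub>N\<^esub>i\<in>I. f i x) \<in> carrier N"
      using assms by (intro N.M.finsum_closed) (auto intro: mod_hom_closed)
  next
    fix x y assume xy: "x \<in> carrier M" "y \<in> carrier M"
    have "(\<Oplus>\<^bsub>N\<^esub>i\<in>I. f i (x \<oplus>\<^bsub>M\<^esub> y)) = (\<Oplus>\<^bsub>N\<^esub>i\<in>I. f i x \<oplus>\<^bsub>N\<^esub> f i y)"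
      using assms xy by (intro N.M.finsum_cong') (auto intro: mod_hom_closed mod_hom_add)
    also have "\<dots> = (\<Oplus>\<^bsub>N\<^esub>i\<in>I. f i x) \<oplus>\<^bsub>N\<^esub> (\<Oplus>\<^bsub>N\<^esub>i\<in>I. f i y)"
      using assms xy by (intro N.M.finsum_addf) (auto intro: mod_hom_closed)
    finally show "(\<Oplus>\<^bsub>N\<^esub>i\<in>I. f i (x \<oplus>\<^bsub>M\<^esub> y)) = (\<Oplus>\<^bsub>N\<^esub>i\<in>I. f i x) \<oplus>\<^bsub>N\<^esub> (\<Oplus>\<^bsub>N\<^esub>i\<in>I. f i y)" .
  next
    fix r x assume rx: "r \<in> carrier R" "x \<in> carrier M"
    have "(\<Oplus>\<^bsub>N\<^esub>i\<in>I. f i (r \<odot>\<^bsub>M\<^esub> x)) = (\<Oplus>\<^bsub>N\<^esub>i\<in>I. r \<odot>\<^bsub>N\<^esub> f i x)"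
      using assms rx by (intro N.M.finsum_cong') (auto intro: mod_hom_closed mod_hom_smult)
    also have "\<dots> = r \<odot>\<^bsub>N\<^esub> (\<Oplus>\<^bsub>N\<^esub>i\<in>I. f i x)"
      using assms rx by (intro N.smult_finsum[symmetric]) (auto intro: mod_hom_closed)
    finally show "(\<Oplus>\<^bsub>N\<^esub>i\<in>I. f i (r \<odot>\<^bsub>M\<^esub> x)) = r \<odot>\<^bsub>N\<^esub> (\<Oplus>\<^bsub>N\<^esub>i\<in>I. f i x)" .
  qed
qed

section \<open>Finite products of modules\<close>

lemma carrier_prod_module [simp]: "carrier (prod_module I M) = (\<Pi>\<^sub>E i\<in>I. carrier (M i))"
  and zero_prod_module [simp]: "\<zero>\<^bsub>prod_module I M\<^esub> = (\<lambda>i\<in>I. \<zero>\<^bsub>M i\<^esub>)"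
  and add_prod_module [simp]: "x \<oplus>\<^bsub>prod_module I M\<^esub> y = (\<lambda>i\<in>I. x i \<oplus>\<^bsub>M i\<^esub> y i)"
  and smult_prod_module [simp]: "r \<odot>\<^bsub>prod_module I M\<^esub> x = (\<lambda>i\<in>I. r \<odot>\<^bsub>M i\<^esub> x i)"
  by (simp_all add: prod_module_def)

lemma left_module_prod_module:
  assumes "ring R" "\<And>i. i \<in> I \<Longrightarrow> left_module R (M i)"
  shows "left_module R (prod_module I M)"
proof -
  interpret R: ring R by fact
  have M: "abelian_group (M i)" if "i \<in> I" for i using assms(2)[OF that] by (simp add: left_module_def)
  show ?thesis
  proof (intro left_module.intro left_module_axioms.intro assms(1))
    show "abelian_group (prod_module I M)"
    proof (rule abelian_groupI)
      fix x assume x: "x \<in> carrier (prod_module I M)"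
      show "\<exists>y\<in>carrier (prod_module I M). y \<oplus>\<^bsub>prod_module I M\<^esub> x = \<zero>\<^bsub>prod_module I M\<^esub>"
        using x by (intro bexI[of _ "\<lambda>i\<in>I. \<ominus>\<^bsub>M i\<^esub> x i"])
          (auto simp: PiE_mem intro!: restrict_ext abelian_group.l_neg[OF M]
            abelian_group.a_inv_closed[OF M])
    next
      fix x assume x: "x \<in> carrier (prod_module I M)"
      show "\<zero>\<^bsub>prod_module I M\<^esub> \<oplus>\<^bsub>prod_module I M\<^esub> x = x"
        using x by (intro PiE_ext[of _ I "\<lambda>i. carrier (M i)"])
          (auto simp: PiE_mem intro!: abelian_groupE(1,2,5)[OF M])
    qed (auto simp: PiE_mem intro!: restrict_ext abelian_groupE(1-4)[OF M])
  next
    fix x assume x: "x \<in> carrier (prod_module I M)"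
    show "\<one>\<^bsub>R\<^esub> \<odot>\<^bsub>prod_module I M\<^esub> x = x"
      using x by (intro PiE_ext[of _ I "\<lambda>i. carrier (M i)"])
        (auto simp: PiE_mem intro!: left_module.smult_one[OF assms(2)] left_module.smult_closed[OF assms(2)])
  qed (auto simp: PiE_mem intro!: restrict_ext left_module.smult_closed[OF assms(2)]
      left_module.smult_l_distr[OF assms(2)] left_module.smult_r_distr[OF assms(2)]
      left_module.smult_assoc1[OF assms(2)])
qed

lemma mod_hom_proj: "i \<in> I \<Longrightarrow> (\<lambda>x. x i) \<in> mod_hom R (prod_module I M) (M i)"
  by (auto simp: mod_hom_def)

lemma mod_hom_tuple:
  assumes "\<And>i. i \<in> I \<Longrightarrow> f i \<in> mod_hom R M (P i)"
  shows "(\<lambda>x. \<lambda>i\<in>I. f i x) \<in> mod_hom R M (prod_module I P)"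
  by (rule mod_homI) (auto simp: mod_hom_closed[OF assms] mod_hom_add[OF assms]
      mod_hom_smult[OF assms] intro!: restrict_ext)

lemma neg_prod_module:
  assumes "ring R" "\<And>i. i \<in> I \<Longrightarrow> left_module R (M i)" "x \<in> carrier (prod_module I M)" "i \<in> I"
  shows "(\<ominus>\<^bsub>prod_module I M\<^esub> x) i = \<ominus>\<^bsub>M i\<^esub> x i"
  using mod_hom_neg[OF left_module_prod_module[OF assms(1,2)] assms(2)[OF assms(4)]
      mod_hom_proj[OF assms(4)] assms(3)] by simp

lemma minus_prod_module:
  assumes "ring R" "\<And>i. i \<in> I \<Longrightarrow> left_module R (M i)"
    "x \<in> carrier (prod_module I M)" "y \<in> carrier (prod_module I M)" "i \<in> I"
  shows "(x \<ominus>\<^bsub>prod_module I M\<^esub> y) i = x i \<ominus>\<^bsub>M i\<^esub> y i"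
  using mod_hom_minus[OF left_module_prod_module[OF assms(1,2)] assms(2)[OF assms(5)]
      mod_hom_proj[OF assms(5)] assms(3,4)] by simp

section \<open>The words of a derived cube\<close>

text \<open>In each degree the module of a totalisation depends only on the base complex and on
  \<open>N\<close>. With a name of its own, operators on it can be studied before any cube is
  mentioned.\<close>

definition cube_obj :: "nat set \<Rightarrow> ('r, 'm) cochain \<Rightarrow> int \<Rightarrow> ('r, nat set \<Rightarrow> 'm) module" where
  "cube_obj N C l = prod_module (Pow N) (\<lambda>A. obj C (l - int (card A)))"

text \<open>The sign is \<open>tot_sign A A\<close> for finite \<open>A\<close>. With
  \<open>f = diff C\<close> and \<open>p = 1\<close> this is the diagonal part of the totalised
  differential; used for \<open>G\<close> as well, the sign cancels in
  \<open>d G + G d\<close>.\<close>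

definition signed_diag ::
  "nat set \<Rightarrow> ('r, 'm) cochain \<Rightarrow> int \<Rightarrow> (int \<Rightarrow> 'm \<Rightarrow> 'm) \<Rightarrow> int \<Rightarrow> (nat set \<Rightarrow> 'm) \<Rightarrow> nat set \<Rightarrow> 'm" where
  "signed_diag N C p f l x =
     (\<lambda>A\<in>Pow N. [((-1) ^ card A :: int)] \<cdot>\<^bsub>obj C (l + p - int (card A))\<^esub> f (l - int (card A)) (x A))"

definition plain_diag :: "nat set \<Rightarrow> (int \<Rightarrow> 'a \<Rightarrow> 'b) \<Rightarrow> int \<Rightarrow> (nat set \<Rightarrow> 'a) \<Rightarrow> nat set \<Rightarrow> 'b" where
  "plain_diag N f l x = (\<lambda>A\<in>Pow N. f (l - int (card A)) (x A))"

text \<open>The \<open>\<delta>\<close> of the overview. The sign is that of exterior multiplication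
  by \<open>k\<close>; although \<open>h k\<close> has degree 0, the total degree rises by one
  because the vertex gains an element.\<close>

definition edge_sum ::
  "nat set \<Rightarrow> ('r, 'm) cochain \<Rightarrow> (nat \<Rightarrow> int \<Rightarrow> 'm \<Rightarrow> 'm) \<Rightarrow> int \<Rightarrow> (nat set \<Rightarrow> 'm) \<Rightarrow> nat set \<Rightarrow> 'm" where
  "edge_sum N D h l x = (\<lambda>B\<in>Pow N. \<Oplus>\<^bsub>obj D (l + 1 - int (card B))\<^esub>k\<in>B.
     [((-1) ^ below B k :: int)] \<cdot>\<^bsub>obj D (l + 1 - int (card B))\<^esub> h k (l + 1 - int (card B)) (x (B - {k})))"

text \<open>The value zero at the empty set leaves the diagonal of the differential to
  \<open>signed_diag\<close>. A singleton gives \<open>h k\<close>, so edges and higher maps are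
  covered by one formula.\<close>

definition word_sum ::
  "('r, 'm) cochain \<Rightarrow> (nat \<Rightarrow> int \<Rightarrow> 'm \<Rightarrow> 'm) \<Rightarrow> (int \<Rightarrow> 'm \<Rightarrow> 'm) \<Rightarrow> nat set \<Rightarrow> int \<Rightarrow> 'm \<Rightarrow> 'm" where
  "word_sum D h G S k y = (let M = obj D (k + 1 - int (card S)) in
     if S = {} then \<zero>\<^bsub>M\<^esub>
     else \<Oplus>\<^bsub>M\<^esub>\<sigma>\<in>{\<sigma>. \<sigma> permutes S}.
       [sign \<sigma>] \<cdot>\<^bsub>M\<^esub> hG_word h G (map \<sigma> (sorted_list_of_set S)) k y)"

text \<open>In contrast to \<open>word_sum\<close> the empty set gives the identity; this accounts
  for the summand \<open>u\<close> in \<open>u + G \<Delta> u\<close>.\<close>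

definition G_word_sum ::
  "('r, 'm) cochain \<Rightarrow> (nat \<Rightarrow> int \<Rightarrow> 'm \<Rightarrow> 'm) \<Rightarrow> (int \<Rightarrow> 'm \<Rightarrow> 'm) \<Rightarrow> nat set \<Rightarrow> int \<Rightarrow> 'm \<Rightarrow> 'm" where
  "G_word_sum D h G S k y =
     (if S = {} then y else G (k + 1 - int (card S)) (word_sum D h G S k y))"

text \<open>Chosen so that every nonempty word, even one of length one, is its first
  \<open>h\<close> applied after a \<open>G_word\<close>.\<close>

definition G_word ::
  "(nat \<Rightarrow> int \<Rightarrow> 'm \<Rightarrow> 'm) \<Rightarrow> (int \<Rightarrow> 'm \<Rightarrow> 'm) \<Rightarrow> nat list \<Rightarrow> int \<Rightarrow> 'm \<Rightarrow> 'm" where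
  "G_word h G zs k y = (if zs = [] then y else G (k + 1 - int (length zs)) (hG_word h G zs k y))"

text \<open>The \<open>\<Delta>\<close> of the overview. The index \<open>A = B\<close> may stay in
  the sum because \<open>word_sum\<close> vanishes on the empty set.\<close>

definition cube_sum ::
  "nat set \<Rightarrow> ('r, 'm) cochain \<Rightarrow> (nat \<Rightarrow> int \<Rightarrow> 'm \<Rightarrow> 'm) \<Rightarrow> (int \<Rightarrow> 'm \<Rightarrow> 'm) \<Rightarrow>
    int \<Rightarrow> (nat set \<Rightarrow> 'm) \<Rightarrow> nat set \<Rightarrow> 'm" where
  "cube_sum N D h G l x = (\<lambda>B\<in>Pow N. \<Oplus>\<^bsub>obj D (l + 1 - int (card B))\<^esub>A\<in>Pow B.
     [tot_sign B A] \<cdot>\<^bsub>obj D (l + 1 - int (card B))\<^esub> word_sum D h G (B - A) (l - int (card A)) (x A))"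

lemma hG_word_Cons: "hG_word h G (z # zs) k y = h z (k - int (length zs)) (G_word h G zs k y)"
  by (cases zs) (simp_all add: G_word_def Let_def algebra_simps)

locale cube_base =
  fixes R :: "('r, 'k) ring_scheme" and D :: "('r, 'm) cochain" and N :: "nat set"
  assumes ring: "ring R" and cx: "cochain_complex R D" and fin: "finite N"
begin

lemma lm: "left_module R (obj D k)"
  using cx by (simp add: cochain_complex_def)

text \<open>Target degrees are variables bound by an equation, here and in similar facts below, so
  that degrees such as \<open>k + 1 - 1\<close> and \<open>k\<close> can be matched by arithmetic
  instead of rewriting inside \<open>obj\<close>.\<close>

lemma diff_hom: "k' = k + 1 \<Longrightarrow> diff D k \<in> mod_hom R (obj D k) (obj D k')"
  using cx by (simp add: cochain_complex_def graded_map_def)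

lemma diff_diff: "x \<in> carrier (obj D k) \<Longrightarrow> k' = k + 1 \<Longrightarrow> k'' = k + 2 \<Longrightarrow>
    diff D k' (diff D k x) = \<zero>\<^bsub>obj D k''\<^esub>"
  using cx by (simp add: cochain_complex_def)

lemma lm_cube: "left_module R (cube_obj N D l)"
  unfolding cube_obj_def using ring lm by (rule left_module_prod_module)

lemma finite_vertex: "A \<subseteq> N \<Longrightarrow> finite A"
  using fin finite_subset by blast

lemma cube_obj_closed: "x \<in> carrier (cube_obj N D l) \<Longrightarrow> A \<subseteq> N \<Longrightarrow> k = l - int (card A) \<Longrightarrow>
    x A \<in> carrier (obj D k)"
  by (auto simp: cube_obj_def)

lemma cube_obj_add: "A \<subseteq> N \<Longrightarrow> k = l - int (card A) \<Longrightarrow> (x \<oplus>\<^bsub>cube_obj N D l\<^esub> y) A = x A \<oplus>\<^bsub>obj D k\<^esub> y A"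
  by (simp add: cube_obj_def)

lemma cube_obj_zero: "A \<subseteq> N \<Longrightarrow> k = l - int (card A) \<Longrightarrow> \<zero>\<^bsub>cube_obj N D l\<^esub> A = \<zero>\<^bsub>obj D k\<^esub>"
  by (simp add: cube_obj_def)

lemma cube_obj_neg: "x \<in> carrier (cube_obj N D l) \<Longrightarrow> A \<subseteq> N \<Longrightarrow> k = l - int (card A) \<Longrightarrow>
    (\<ominus>\<^bsub>cube_obj N D l\<^esub> x) A = \<ominus>\<^bsub>obj D k\<^esub> x A"
  unfolding cube_obj_def using neg_prod_module[OF ring, of "Pow N" "\<lambda>A. obj D (l - int (card A))" x A] lm
  by simp

lemma cube_obj_minus: "x \<in> carrier (cube_obj N D l) \<Longrightarrow> y \<in> carrier (cube_obj N D l) \<Longrightarrow>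
    A \<subseteq> N \<Longrightarrow> k = l - int (card A) \<Longrightarrow> (x \<ominus>\<^bsub>cube_obj N D l\<^esub> y) A = x A \<ominus>\<^bsub>obj D k\<^esub> y A"
  unfolding cube_obj_def
  using minus_prod_module[OF ring, of "Pow N" "\<lambda>A. obj D (l - int (card A))" x y A] lm by simp

lemma cube_obj_eqI:
  assumes "x \<in> carrier (cube_obj N D l)" "y \<in> carrier (cube_obj N D l)"
    and "\<And>A. A \<subseteq> N \<Longrightarrow> x A = y A"
  shows "x = y"
  using assms unfolding cube_obj_def by (intro PiE_ext[of x "Pow N"]) auto

lemma signed_diag_hom:
  assumes "graded_map R D D p f" "l' = l + p"
  shows "signed_diag N D p f l \<in> mod_hom R (cube_obj N D l) (cube_obj N D l')"
  unfolding signed_diag_def cube_obj_def assms(2)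
proof (rule mod_hom_tuple)
  fix A assume A: "A \<in> Pow N"
  have "f (l - int (card A)) \<in> mod_hom R (obj D (l - int (card A))) (obj D (l + p - int (card A)))"
    using assms(1) unfolding graded_map_def
    by (elim allE[of _ "l - int (card A)"]) (simp add: algebra_simps)
  then show "(\<lambda>x. [((-1) ^ card A :: int)] \<cdot>\<^bsub>obj D (l + p - int (card A))\<^esub> f (l - int (card A)) (x A))
      \<in> mod_hom R (prod_module (Pow N) (\<lambda>A. obj D (l - int (card A)))) (obj D (l + p - int (card A)))"
    using A by (intro mod_hom_int_multiple lm mod_hom_comp[OF mod_hom_proj])
qed

end

lemma plain_diag_hom:
  assumes "graded_map R C D 0 f"
  shows "plain_diag N f l \<in> mod_hom R (cube_obj N C l) (cube_obj N D l)"
  unfolding plain_diag_def cube_obj_def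
proof (rule mod_hom_tuple)
  fix A assume A: "A \<in> Pow N"
  show "(\<lambda>x. f (l - int (card A)) (x A))
      \<in> mod_hom R (prod_module (Pow N) (\<lambda>A. obj C (l - int (card A)))) (obj D (l - int (card A)))"
    using A assms by (intro mod_hom_comp[OF mod_hom_proj]) (auto simp: graded_map_def)
qed

text \<open>\<open>\<rho>\<close> stands for the composite of \<open>\<beta>\<close> and
  \<open>\<alpha>\<close>. Kept abstract, it confines the word calculus to \<open>D\<close>, and the
  same identities then serve both derived cubes of the theorem.\<close>

locale cube_words = cube_base R D N
  for R :: "('r, 'k) ring_scheme" and D :: "('r, 'm) cochain" and N :: "nat set" +
  fixes h :: "nat \<Rightarrow> int \<Rightarrow> 'm \<Rightarrow> 'm" and G :: "int \<Rightarrow> 'm \<Rightarrow> 'm" and \<rho> :: "int \<Rightarrow> 'm \<Rightarrow> 'm"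
  assumes hmap: "\<And>i. i \<in> N \<Longrightarrow> cochain_map R D D (h i)"
    and hcomm: "\<And>i j k x. \<lbrakk>i \<in> N; j \<in> N; x \<in> carrier (obj D k)\<rbrakk> \<Longrightarrow> h i k (h j k x) = h j k (h i k x)"
    and rmap: "cochain_map R D D \<rho>"
    and htpy: "homotopy R D D (\<lambda>k x. x) \<rho> G"
begin

lemma h_hom: "i \<in> N \<Longrightarrow> h i k \<in> mod_hom R (obj D k) (obj D k)"
  using hmap[of i] by (auto simp: cochain_map_def graded_map_def)

lemma h_diff: "i \<in> N \<Longrightarrow> x \<in> carrier (obj D k) \<Longrightarrow> k' = k + 1 \<Longrightarrow>
    h i k' (diff D k x) = diff D k (h i k x)"
  using hmap[of i] by (auto simp: cochain_map_def)

lemma G_graded: "graded_map R D D (-1) G"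
  using htpy by (simp add: homotopy_def)

lemma G_hom: "k' = k - 1 \<Longrightarrow> G k \<in> mod_hom R (obj D k) (obj D k')"
  using G_graded by (simp add: graded_map_def)

lemma hG_word_hom:
  "zs \<noteq> [] \<Longrightarrow> set zs \<subseteq> N \<Longrightarrow> k' = k + 1 - int (length zs) \<Longrightarrow>
    hG_word h G zs k \<in> mod_hom R (obj D k) (obj D k')"
proof (induction zs arbitrary: k')
  case (Cons z zs)
  have "G_word h G zs k \<in> mod_hom R (obj D k) (obj D (k - int (length zs)))"
  proof (cases "zs = []")
    case True
    then show ?thesis by (simp add: G_word_def[abs_def] mod_hom_id)
  next
    case False
    with Cons have "hG_word h G zs k \<in> mod_hom R (obj D k) (obj D (k + 1 - int (length zs)))" by simp
    then show ?thesis using False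
      by (simp add: G_word_def[abs_def]) (erule mod_hom_comp, rule G_hom, simp)
  qed
  from mod_hom_comp[OF this h_hom] show ?case
    using Cons.prems by (simp add: hG_word_Cons[abs_def])
qed simp

lemma G_word_hom:
  assumes "set zs \<subseteq> N" "k' = k - int (length zs)"
  shows "G_word h G zs k \<in> mod_hom R (obj D k) (obj D k')"
proof (cases "zs = []")
  case True
  then show ?thesis using assms by (simp add: G_word_def[abs_def] mod_hom_id)
next
  case False
  with assms have "hG_word h G zs k \<in> mod_hom R (obj D k) (obj D (k + 1 - int (length zs)))"
    by (intro hG_word_hom) auto
  then show ?thesis using False assms(2)
    by (simp add: G_word_def[abs_def]) (erule mod_hom_comp, rule G_hom, simp)
qed

lemma word_sum_hom:
  assumes "S \<subseteq> N" "k' = k + 1 - int (card S)"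
  shows "word_sum D h G S k \<in> mod_hom R (obj D k) (obj D k')"
proof (cases "S = {}")
  case True
  then show ?thesis using assms by (simp add: word_sum_def[abs_def] Let_def mod_hom_zero_map lm)
next
  case False
  have S: "finite S" using assms(1) by (rule finite_vertex)
  have "(\<lambda>y. \<Oplus>\<^bsub>obj D k'\<^esub>\<sigma>\<in>{\<sigma>. \<sigma> permutes S}.
       [sign \<sigma>] \<cdot>\<^bsub>obj D k'\<^esub> hG_word h G (map \<sigma> (sorted_list_of_set S)) k y) \<in> mod_hom R (obj D k) (obj D k')"
    using False S assms permutes_in_image
    by (intro mod_hom_sum mod_hom_int_multiple lm finite_permutations S hG_word_hom) fastforce+
  then show ?thesis using False assms by (simp add: word_sum_def[abs_def] Let_def)
qed

lemma G_word_sum_hom: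
  assumes "S \<subseteq> N" "k' = k - int (card S)"
  shows "G_word_sum D h G S k \<in> mod_hom R (obj D k) (obj D k')"
proof (cases "S = {}")
  case True
  then show ?thesis using assms by (simp add: G_word_sum_def[abs_def] mod_hom_id)
next
  case False
  show ?thesis using False assms
    by (simp add: G_word_sum_def[abs_def])
      (rule mod_hom_comp, rule word_sum_hom, assumption, rule refl, rule G_hom, simp)
qed

text \<open>\<open>G\<close> is additive and passes through the alternating sum. The identity at the
  empty set matches the single empty word, so the recursion has no exceptional first step.\<close>

lemma G_word_sum_eq:
  assumes S: "S \<subseteq> N" and y: "y \<in> carrier (obj D k)" and k': "k' = k - int (card S)"
  shows "G_word_sum D h G S k y = (\<Oplus>\<^bsub>obj D k'\<^esub>\<sigma>\<in>{\<sigma>. \<sigma> permutes S}.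
    [sign \<sigma>] \<cdot>\<^bsub>obj D k'\<^esub> G_word h G (map \<sigma> (sorted_list_of_set S)) k y)"
proof -
  interpret M: left_module R "obj D k'" by (rule lm)
  have fS: "finite S" using S by (rule finite_vertex)
  show ?thesis
  proof (cases "S = {}")
    case True
    have "{\<sigma>. \<sigma> permutes ({} :: nat set)} = {id}" by auto
    moreover have "y \<in> carrier (obj D k')" using True y k' by simp
    ultimately show ?thesis using True
      by (simp add: G_word_sum_def G_word_def M.M.finsum_insert[of "{}" id, simplified])
  next
    case False
    let ?M = "obj D (k + 1 - int (card S))"
    interpret M': left_module R ?M by (rule lm)
    have G: "G (k + 1 - int (card S)) \<in> mod_hom R ?M (obj D k')" using k' by (intro G_hom) simp
    have w: "hG_word h G (map \<sigma> (sorted_list_of_set S)) k y \<in> carrier ?M" if "\<sigma> permutes S" for \<sigma>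
      using False fS S that permutes_in_image
      by (intro mod_hom_closed[OF hG_word_hom y]) fastforce+
    have "G_word_sum D h G S k y = G (k + 1 - int (card S)) (\<Oplus>\<^bsub>?M\<^esub>\<sigma>\<in>{\<sigma>. \<sigma> permutes S}.
        [sign \<sigma>] \<cdot>\<^bsub>?M\<^esub> hG_word h G (map \<sigma> (sorted_list_of_set S)) k y)"
      using False by (simp add: G_word_sum_def word_sum_def Let_def)
    also have "\<dots> = (\<Oplus>\<^bsub>obj D k'\<^esub>\<sigma>\<in>{\<sigma>. \<sigma> permutes S}. G (k + 1 - int (card S))
        ([sign \<sigma>] \<cdot>\<^bsub>?M\<^esub> hG_word h G (map \<sigma> (sorted_list_of_set S)) k y))"
      using w fS by (intro mod_hom_finsum[OF lm lm G] finite_permutations) auto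
    also have "\<dots> = (\<Oplus>\<^bsub>obj D k'\<^esub>\<sigma>\<in>{\<sigma>. \<sigma> permutes S}.
        [sign \<sigma>] \<cdot>\<^bsub>obj D k'\<^esub> G_word h G (map \<sigma> (sorted_list_of_set S)) k y)"
      using w G False fS by (intro M.M.finsum_cong')
        (auto simp: mod_hom_int_mult[OF lm lm G] G_word_def sorted_list_of_set_eq_Nil_iff intro: mod_hom_closed[OF G])
    finally show ?thesis .
  qed
qed

text \<open>Laplace expansion along the first letter.\<close>

lemma word_sum_expand:
  assumes S: "S \<subseteq> N" and y: "y \<in> carrier (obj D k)" and k': "k' = k + 1 - int (card S)"
  shows "word_sum D h G S k y =
    (\<Oplus>\<^bsub>obj D k'\<^esub>j\<in>S. [((-1) ^ below S j :: int)] \<cdot>\<^bsub>obj D k'\<^esub> h j k' (G_word_sum D h G (S - {j}) k y))"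
proof -
  interpret M: left_module R "obj D k'" by (rule lm)
  have fS: "finite S" using S by (rule finite_vertex)
  show ?thesis
  proof (cases "S = {}")
    case True
    have "word_sum D h G S k y = \<zero>\<^bsub>obj D k'\<^esub>" using True k' by (simp add: word_sum_def)
    then show ?thesis by (simp add: True)
  next
    case False
    obtain c where c1: "\<And>j. j \<in> S \<Longrightarrow> c j permutes S"
      and c2: "\<And>j. j \<in> S \<Longrightarrow> map (c j) (sorted_list_of_set S) = j # sorted_list_of_set (S - {j})"
      and c3: "\<And>j. j \<in> S \<Longrightarrow> sign (c j) = (-1) ^ below S j"
      and c4': "S \<noteq> {} \<Longrightarrow> {\<sigma>. \<sigma> permutes S} = (\<Union>j\<in>S. (\<lambda>\<tau>. \<tau> \<circ> c j) ` {\<tau>. \<tau> permutes (S - {j})})"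
      by (rule permutations_by_first_letter[OF fS]) (rule that)
    note c4 = c4'[OF False]
    define T where "T \<sigma> = [sign \<sigma>] \<cdot>\<^bsub>obj D k'\<^esub> hG_word h G (map \<sigma> (sorted_list_of_set S)) k y" for \<sigma>
    have Tc: "T \<sigma> \<in> carrier (obj D k')" if "\<sigma> permutes S" for \<sigma>
      unfolding T_def using False fS S that permutes_in_image k'
      by (intro M.M.add.int_pow_closed mod_hom_closed[OF hG_word_hom y]) fastforce+
    \<comment> \<open>\<open>\<tau>\<close> fixes \<open>j\<close>, so the letter moved to the front
      by \<open>c j\<close> stays there and \<open>\<tau>\<close> acts only on the remaining
      letters.\<close>
    have word: "map (\<tau> \<circ> c j) (sorted_list_of_set S) = j # map \<tau> (sorted_list_of_set (S - {j}))"
      if "j \<in> S" "\<tau> permutes (S - {j})" for j \<tau>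
    proof -
      have "map (\<tau> \<circ> c j) (sorted_list_of_set S) = map \<tau> (map (c j) (sorted_list_of_set S))" by simp
      also have "\<dots> = j # map \<tau> (sorted_list_of_set (S - {j}))"
        unfolding c2[OF that(1)] using that(2) by (simp add: permutes_not_in)
      finally show ?thesis .
    qed
    have inj: "inj_on (\<lambda>\<tau>. \<tau> \<circ> c j) {\<tau>. \<tau> permutes (S - {j})}" if "j \<in> S" for j
    proof (rule inj_onI)
      fix \<tau> \<tau>' assume e: "\<tau> \<circ> c j = \<tau>' \<circ> c j"
      show "\<tau> = \<tau>'" using e permutes_surj[OF c1[OF that]] by (metis fun.map_comp surj_fun_eq surj_iff o_id)
    qed
    have "word_sum D h G S k y = (\<Oplus>\<^bsub>obj D k'\<^esub>\<sigma>\<in>{\<sigma>. \<sigma> permutes S}. T \<sigma>)"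
      using False k' by (simp add: word_sum_def Let_def T_def)
    \<comment> \<open>The cosets for different \<open>j\<close> are disjoint because their words
      begin with different letters.\<close>
    also have "\<dots> = (\<Oplus>\<^bsub>obj D k'\<^esub>j\<in>S. \<Oplus>\<^bsub>obj D k'\<^esub>\<sigma>\<in>(\<lambda>\<tau>. \<tau> \<circ> c j) ` {\<tau>. \<tau> permutes (S - {j})}. T \<sigma>)"
      unfolding c4
    proof (rule M.M.add.finprod_UN_disjoint)
      show "finite S" by fact
      show "\<And>j. j \<in> S \<Longrightarrow> finite ((\<lambda>\<tau>. \<tau> \<circ> c j) ` {\<tau>. \<tau> permutes (S - {j})})"
        using fS by (intro finite_imageI finite_permutations) auto
      show "pairwise (\<lambda>i j. disjnt ((\<lambda>\<tau>. \<tau> \<circ> c i) ` {\<tau>. \<tau> permutes (S - {i})})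
          ((\<lambda>\<tau>. \<tau> \<circ> c j) ` {\<tau>. \<tau> permutes (S - {j})})) S"
      proof (rule pairwiseI)
        fix i j assume ij: "i \<in> S" "j \<in> S" "i \<noteq> j"
        have "\<tau> \<circ> c i \<noteq> \<tau>' \<circ> c j"
          if "\<tau> permutes (S - {i})" "\<tau>' permutes (S - {j})" for \<tau> \<tau>'
        proof
          assume "\<tau> \<circ> c i = \<tau>' \<circ> c j"
          then show False using word[OF ij(1) that(1)] word[OF ij(2) that(2)] ij(3) by simp
        qed
        then show "disjnt ((\<lambda>\<tau>. \<tau> \<circ> c i) ` {\<tau>. \<tau> permutes (S - {i})})
          ((\<lambda>\<tau>. \<tau> \<circ> c j) ` {\<tau>. \<tau> permutes (S - {j})})"
          by (auto simp: disjnt_iff)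
      qed
      fix j \<sigma> assume "j \<in> S" "\<sigma> \<in> (\<lambda>\<tau>. \<tau> \<circ> c j) ` {\<tau>. \<tau> permutes (S - {j})}"
      then have "\<sigma> \<in> {\<sigma>. \<sigma> permutes S}" unfolding c4 by (rule UN_I)
      then show "T \<sigma> \<in> carrier (obj D k')" using Tc by simp
    qed
    also have "\<dots> = (\<Oplus>\<^bsub>obj D k'\<^esub>j\<in>S. [((-1) ^ below S j :: int)] \<cdot>\<^bsub>obj D k'\<^esub>
        h j k' (G_word_sum D h G (S - {j}) k y))"
    proof (rule M.M.finsum_cong')
      show "(\<lambda>j. [((-1) ^ below S j :: int)] \<cdot>\<^bsub>obj D k'\<^esub> h j k' (G_word_sum D h G (S - {j}) k y))
          \<in> S \<rightarrow> carrier (obj D k')"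
      proof
        fix j assume j: "j \<in> S"
        then have "card S = Suc (card (S - {j}))" using fS by (metis card.remove)
        then have "G_word_sum D h G (S - {j}) k y \<in> carrier (obj D k')"
          using S k' by (intro mod_hom_closed[OF G_word_sum_hom y]) auto
        then show "[((-1) ^ below S j :: int)] \<cdot>\<^bsub>obj D k'\<^esub> h j k' (G_word_sum D h G (S - {j}) k y)
          \<in> carrier (obj D k')" using S j by (auto intro: mod_hom_closed[OF h_hom])
      qed
      fix j assume j: "j \<in> S"
      have jN: "j \<in> N" using j S by auto
      have cS: "card S = Suc (card (S - {j}))" using fS j by (metis card.remove)
      let ?P = "{\<tau>. \<tau> permutes (S - {j})}"
      let ?w = "\<lambda>\<tau>. G_word h G (map \<tau> (sorted_list_of_set (S - {j}))) k y"
      have w: "?w \<tau> \<in> carrier (obj D k')" if "\<tau> permutes (S - {j})" for \<tau>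
        using that fS S permutes_in_image[OF that] k' cS
        by (intro mod_hom_closed[OF G_word_hom y]) (auto simp del: length_0_conv)
      have "(\<Oplus>\<^bsub>obj D k'\<^esub>\<sigma>\<in>(\<lambda>\<tau>. \<tau> \<circ> c j) ` ?P. T \<sigma>) = (\<Oplus>\<^bsub>obj D k'\<^esub>\<tau>\<in>?P. T (\<tau> \<circ> c j))"
      proof (rule M.M.finsum_reindex[OF _ inj[OF j]], rule funcsetI)
        fix \<sigma> assume "\<sigma> \<in> (\<lambda>\<tau>. \<tau> \<circ> c j) ` ?P"
        then have "\<sigma> \<in> {\<sigma>. \<sigma> permutes S}" unfolding c4 by (rule UN_I[OF j])
        then show "T \<sigma> \<in> carrier (obj D k')" using Tc by simp
      qed
      also have "\<dots> = (\<Oplus>\<^bsub>obj D k'\<^esub>\<tau>\<in>?P. [((-1) ^ below S j :: int)] \<cdot>\<^bsub>obj D k'\<^esub>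
          h j k' ([sign \<tau>] \<cdot>\<^bsub>obj D k'\<^esub> ?w \<tau>))"
      proof (rule M.M.finsum_cong')
        show "(\<lambda>\<tau>. [((-1) ^ below S j :: int)] \<cdot>\<^bsub>obj D k'\<^esub> h j k' ([sign \<tau>] \<cdot>\<^bsub>obj D k'\<^esub> ?w \<tau>))
            \<in> ?P \<rightarrow> carrier (obj D k')"
          using w by (auto intro!: mod_hom_closed[OF h_hom[OF jN]])
        fix \<tau> assume "\<tau> \<in> ?P"
        then have \<tau>: "\<tau> permutes (S - {j})" by simp
        have "sign (\<tau> \<circ> c j) = sign \<tau> * sign (c j)"
          using permutes_imp_permutation[of "S - {j}" \<tau>] \<tau> permutes_imp_permutation[OF fS c1[OF j]] fS
          by (intro sign_compose) auto
        then have "T (\<tau> \<circ> c j) = [(((-1) ^ below S j) * sign \<tau>)] \<cdot>\<^bsub>obj D k'\<^esub> h j k' (?w \<tau>)"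
          unfolding T_def word[OF j \<tau>] hG_word_Cons using k' cS by (simp add: c3[OF j] mult.commute)
        then show "T (\<tau> \<circ> c j) = [((-1) ^ below S j :: int)] \<cdot>\<^bsub>obj D k'\<^esub> h j k' ([sign \<tau>] \<cdot>\<^bsub>obj D k'\<^esub> ?w \<tau>)"
          using w[OF \<tau>] mod_hom_closed[OF h_hom[OF jN] w[OF \<tau>]]
          by (simp add: mod_hom_int_mult[OF lm lm h_hom[OF jN]] M.int_mult_assoc)
      qed simp
      also have "\<dots> = [((-1) ^ below S j :: int)] \<cdot>\<^bsub>obj D k'\<^esub>
          (\<Oplus>\<^bsub>obj D k'\<^esub>\<tau>\<in>?P. h j k' ([sign \<tau>] \<cdot>\<^bsub>obj D k'\<^esub> ?w \<tau>))"
        using w fS by (intro M.int_mult_finsum[symmetric] finite_permutations)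
          (auto intro!: mod_hom_closed[OF h_hom[OF jN]])
      also have "(\<Oplus>\<^bsub>obj D k'\<^esub>\<tau>\<in>?P. h j k' ([sign \<tau>] \<cdot>\<^bsub>obj D k'\<^esub> ?w \<tau>)) =
          h j k' (\<Oplus>\<^bsub>obj D k'\<^esub>\<tau>\<in>?P. [sign \<tau>] \<cdot>\<^bsub>obj D k'\<^esub> ?w \<tau>)"
        using w fS by (intro mod_hom_finsum[OF lm lm h_hom[OF jN], symmetric] finite_permutations) auto
      also have "(\<Oplus>\<^bsub>obj D k'\<^esub>\<tau>\<in>?P. [sign \<tau>] \<cdot>\<^bsub>obj D k'\<^esub> ?w \<tau>) = G_word_sum D h G (S - {j}) k y"
        using S y k' cS by (intro G_word_sum_eq[symmetric]) auto
      finally show "(\<Oplus>\<^bsub>obj D k'\<^esub>\<sigma>\<in>(\<lambda>\<tau>. \<tau> \<circ> c j) ` ?P. T \<sigma>) =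
        [((-1) ^ below S j :: int)] \<cdot>\<^bsub>obj D k'\<^esub> h j k' (G_word_sum D h G (S - {j}) k y)" .
    qed simp
    finally show ?thesis .
  qed
qed

end

section \<open>The recursion for the off-diagonal part of the differential\<close>

context cube_words
begin

lemma edge_sum_hom:
  assumes "l' = l + 1"
  shows "edge_sum N D h l \<in> mod_hom R (cube_obj N D l) (cube_obj N D l')"
  unfolding edge_sum_def cube_obj_def assms
proof (rule mod_hom_tuple, rule mod_hom_sum[OF lm])
  fix B assume B: "B \<in> Pow N"
  then show fB: "finite B" using finite_vertex by blast
  fix k assume k: "k \<in> B"
  have "B - {k} \<in> Pow N" "k \<in> N" using B k by auto
  moreover have e: "l - int (card (B - {k})) = l + 1 - int (card B)"
    using card.remove[OF fB k] by simp
  ultimately have "(\<lambda>x. x (B - {k})) \<in> mod_hom R (prod_module (Pow N) (\<lambda>A. obj D (l - int (card A))))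
      (obj D (l + 1 - int (card B)))" and kN: "k \<in> N"
    using mod_hom_proj[of "B - {k}" "Pow N" R "\<lambda>A. obj D (l - int (card A))"] unfolding e by blast+
  from mod_hom_int_multiple[OF lm mod_hom_comp[OF this(1) h_hom[OF kN]]]
  show "(\<lambda>x. [((-1) ^ below B k :: int)] \<cdot>\<^bsub>obj D (l + 1 - int (card B))\<^esub>
      h k (l + 1 - int (card B)) (x (B - {k})))
    \<in> mod_hom R (prod_module (Pow N) (\<lambda>A. obj D (l - int (card A)))) (obj D (l + 1 - int (card B)))"
    .
qed

lemma cube_sum_hom:
  assumes "l' = l + 1"
  shows "cube_sum N D h G l \<in> mod_hom R (cube_obj N D l) (cube_obj N D l')"
  unfolding cube_sum_def cube_obj_def assms
proof (rule mod_hom_tuple, rule mod_hom_sum[OF lm])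
  fix B assume B: "B \<in> Pow N"
  then have fB: "finite B" using finite_vertex by blast
  then show "finite (Pow B)" by simp
  fix A assume A: "A \<in> Pow B"
  have "card (B - A) = card B - card A" "card A \<le> card B"
    using A fB by (auto simp: card_Diff_subset finite_subset card_mono)
  then have "l + 1 - int (card B) = l - int (card A) + 1 - int (card (B - A))" by simp
  then show "(\<lambda>x. [tot_sign B A] \<cdot>\<^bsub>obj D (l + 1 - int (card B))\<^esub>
      word_sum D h G (B - A) (l - int (card A)) (x A))
    \<in> mod_hom R (prod_module (Pow N) (\<lambda>A. obj D (l - int (card A)))) (obj D (l + 1 - int (card B)))"
    using A B by (intro mod_hom_int_multiple lm mod_hom_comp[OF mod_hom_proj[where M = "\<lambda>A. obj D (l - int (card A))"]] word_sum_hom) auto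
qed

text \<open>\<open>G\<close> at the vertex \<open>B\<close> contributes the sign
  \<open>(-1) ^ card B\<close>. Since \<open>(-1) ^ card B * tot_sign B B = 1\<close> and
  \<open>G_word_sum\<close> is the identity on the empty set, the summand \<open>x B\<close> becomes
  the term \<open>A = B\<close> of a single uniform sum.\<close>

lemma G_cube_sum:
  assumes x: "x \<in> carrier (cube_obj N D l)" and B: "B \<subseteq> N" and k: "k = l - int (card B)"
  shows "(x \<oplus>\<^bsub>cube_obj N D l\<^esub> signed_diag N D (-1) G (l + 1) (cube_sum N D h G l x)) B =
    (\<Oplus>\<^bsub>obj D k\<^esub>A\<in>Pow B. [((-1) ^ card B * tot_sign B A)] \<cdot>\<^bsub>obj D k\<^esub>
       G_word_sum D h G (B - A) (l - int (card A)) (x A))"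
proof -
  interpret M: left_module R "obj D k" by (rule lm)
  let ?M' = "obj D (l + 1 - int (card B))"
  interpret M': left_module R ?M' by (rule lm)
  have fB: "finite B" using B by (rule finite_vertex)
  have G: "G (l + 1 - int (card B)) \<in> mod_hom R ?M' (obj D k)" using k by (intro G_hom) simp
  have cA: "int (card (B - A)) = int (card B) - int (card A)" if "A \<subseteq> B" for A
    using that fB by (simp add: card_Diff_subset finite_subset card_mono of_nat_diff)
  have xA: "x A \<in> carrier (obj D (l - int (card A)))" if "A \<subseteq> B" for A
    using x that B by (intro cube_obj_closed) auto
  have w: "word_sum D h G (B - A) (l - int (card A)) (x A) \<in> carrier ?M'" if "A \<subseteq> B" for A
    using that B cA[OF that] by (intro mod_hom_closed[OF word_sum_hom xA]) auto
  have gw: "G_word_sum D h G (B - A) (l - int (card A)) (x A) \<in> carrier (obj D k)" if "A \<subseteq> B" for A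
    using that B cA[OF that] k by (intro mod_hom_closed[OF G_word_sum_hom xA]) auto
  have xB: "x B \<in> carrier (obj D k)" using xA[of B] k by simp
  have "signed_diag N D (-1) G (l + 1) (cube_sum N D h G l x) B =
     [((-1) ^ card B :: int)] \<cdot>\<^bsub>obj D k\<^esub> G (l + 1 - int (card B)) (\<Oplus>\<^bsub>?M'\<^esub>A\<in>Pow B.
       [tot_sign B A] \<cdot>\<^bsub>?M'\<^esub> word_sum D h G (B - A) (l - int (card A)) (x A))"
    using B k by (simp add: signed_diag_def cube_sum_def)
  also have "\<dots> = [((-1) ^ card B :: int)] \<cdot>\<^bsub>obj D k\<^esub> (\<Oplus>\<^bsub>obj D k\<^esub>A\<in>Pow B.
       G (l + 1 - int (card B)) ([tot_sign B A] \<cdot>\<^bsub>?M'\<^esub> word_sum D h G (B - A) (l - int (card A)) (x A)))"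
    using fB w by (subst mod_hom_finsum[OF lm lm G]) auto
  also have "\<dots> = (\<Oplus>\<^bsub>obj D k\<^esub>A\<in>Pow B. [((-1) ^ card B :: int)] \<cdot>\<^bsub>obj D k\<^esub>
       G (l + 1 - int (card B)) ([tot_sign B A] \<cdot>\<^bsub>?M'\<^esub> word_sum D h G (B - A) (l - int (card A)) (x A)))"
    using fB w by (intro M.int_mult_finsum) (auto intro!: mod_hom_closed[OF G])
  also have "\<dots> = (\<Oplus>\<^bsub>obj D k\<^esub>A\<in>Pow B. [((-1) ^ card B * tot_sign B A)] \<cdot>\<^bsub>obj D k\<^esub>
       G (l + 1 - int (card B)) (word_sum D h G (B - A) (l - int (card A)) (x A)))"
    using w by (intro M.M.finsum_cong')
      (auto simp: mod_hom_int_mult[OF lm lm G] M.int_mult_assoc mod_hom_closed[OF G])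
  finally have 1: "signed_diag N D (-1) G (l + 1) (cube_sum N D h G l x) B = \<dots>" .
  have 2: "x B = (\<Oplus>\<^bsub>obj D k\<^esub>A\<in>Pow B. if B = A then x B else \<zero>\<^bsub>obj D k\<^esub>)"
    using fB xB xA k by (intro M.M.add.finprod_singleton[symmetric, of B "Pow B" "\<lambda>_. x B"]) auto
  have "(x \<oplus>\<^bsub>cube_obj N D l\<^esub> signed_diag N D (-1) G (l + 1) (cube_sum N D h G l x)) B =
    x B \<oplus>\<^bsub>obj D k\<^esub> signed_diag N D (-1) G (l + 1) (cube_sum N D h G l x) B"
    using B k by (rule cube_obj_add)
  also have "\<dots> = (\<Oplus>\<^bsub>obj D k\<^esub>A\<in>Pow B. (if B = A then x B else \<zero>\<^bsub>obj D k\<^esub>) \<oplus>\<^bsub>obj D k\<^esub>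
      [((-1) ^ card B * tot_sign B A)] \<cdot>\<^bsub>obj D k\<^esub>
       G (l + 1 - int (card B)) (word_sum D h G (B - A) (l - int (card A)) (x A)))"
    unfolding 1 by (subst 2, rule M.M.finsum_addf[symmetric])
      (use xB w in \<open>auto simp: mod_hom_closed[OF G]\<close>)
  also have "\<dots> = (\<Oplus>\<^bsub>obj D k\<^esub>A\<in>Pow B. [((-1) ^ card B * tot_sign B A)] \<cdot>\<^bsub>obj D k\<^esub>
       G_word_sum D h G (B - A) (l - int (card A)) (x A))"
  proof (rule M.M.finsum_cong')
    fix A assume A: "A \<in> Pow B"
    show "(if B = A then x B else \<zero>\<^bsub>obj D k\<^esub>) \<oplus>\<^bsub>obj D k\<^esub>
      [((-1) ^ card B * tot_sign B A)] \<cdot>\<^bsub>obj D k\<^esub>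
       G (l + 1 - int (card B)) (word_sum D h G (B - A) (l - int (card A)) (x A)) =
      [((-1) ^ card B * tot_sign B A)] \<cdot>\<^bsub>obj D k\<^esub> G_word_sum D h G (B - A) (l - int (card A)) (x A)"
    proof (cases "A = B")
      case True
      have "word_sum D h G (B - B) (l - int (card B)) (x B) = \<zero>\<^bsub>?M'\<^esub>"
        by (simp add: word_sum_def algebra_simps)
      moreover have "G (l + 1 - int (card B)) \<zero>\<^bsub>?M'\<^esub> = \<zero>\<^bsub>obj D k\<^esub>" using mod_hom_zero[OF lm lm G] .
      moreover have "(-1) ^ card B * tot_sign B B = 1"
        using fB by (simp add: tot_sign_self flip: power_add)
      moreover have "[(1::int)] \<cdot>\<^bsub>obj D k\<^esub> x B = x B" using xB by (rule M.M.add.int_pow_1)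
      ultimately show ?thesis using True xB by (simp add: G_word_sum_def)
    next
      case False
      then have "B - A \<noteq> {}" using A by auto
      moreover have e: "l - int (card A) + 1 - int (card (B - A)) = l + 1 - int (card B)"
        using cA A by simp
      ultimately have "G_word_sum D h G (B - A) (l - int (card A)) (x A) =
        G (l + 1 - int (card B)) (word_sum D h G (B - A) (l - int (card A)) (x A))"
        by (simp only: G_word_sum_def e if_False)
      then show ?thesis using False A w mod_hom_closed[OF G] by auto
    qed
  qed (use gw in auto)
  finally show ?thesis .
qed

text \<open>At each vertex \<open>B\<close>, every entry of \<open>\<Delta>\<close> is expanded
  along the first letter \<open>j\<close> of its words, and the sums over \<open>A\<close> and
  \<open>j\<close> are exchanged. The inner sum over \<open>A\<close> is then the value of the
  argument of \<open>\<delta>\<close> at \<open>B - {j}\<close>, with signs as in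
  \<open>tot_sign_step\<close>.\<close>

lemma cube_sum_eq_edge_sum:
  assumes x: "x \<in> carrier (cube_obj N D l)"
  shows "cube_sum N D h G l x =
    edge_sum N D h l (x \<oplus>\<^bsub>cube_obj N D l\<^esub> signed_diag N D (-1) G (l + 1) (cube_sum N D h G l x))"
proof (rule cube_obj_eqI[of _ "l + 1"])
  let ?y = "x \<oplus>\<^bsub>cube_obj N D l\<^esub> signed_diag N D (-1) G (l + 1) (cube_sum N D h G l x)"
  interpret P: left_module R "cube_obj N D l" by (rule lm_cube)
  have v: "cube_sum N D h G l x \<in> carrier (cube_obj N D (l + 1))"
    by (rule mod_hom_closed[OF cube_sum_hom x]) simp
  then have y: "?y \<in> carrier (cube_obj N D l)"
    using x by (intro P.M.a_closed mod_hom_closed[OF signed_diag_hom[OF G_graded]]) auto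
  show "cube_sum N D h G l x \<in> carrier (cube_obj N D (l + 1))" by fact
  show "edge_sum N D h l ?y \<in> carrier (cube_obj N D (l + 1))"
    by (rule mod_hom_closed[OF edge_sum_hom y]) simp
  fix B assume B: "B \<subseteq> N"
  define k where "k = l + 1 - int (card B)"
  interpret M: left_module R "obj D k" by (rule lm)
  have fB: "finite B" using B by (rule finite_vertex)
  have cA: "int (card (B - A)) = int (card B) - int (card A)" if "A \<subseteq> B" for A
    using that fB by (simp add: card_Diff_subset finite_subset card_mono of_nat_diff)
  have xA: "x A \<in> carrier (obj D (l - int (card A)))" if "A \<subseteq> B" for A
    using x that B by (intro cube_obj_closed) auto
  define g where "g A j = h j k (G_word_sum D h G (B - A - {j}) (l - int (card A)) (x A))" for A j
  have gw: "G_word_sum D h G (B - A - {j}) (l - int (card A)) (x A) \<in> carrier (obj D k)"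
    if "A \<subseteq> B" "j \<in> B - A" for A j
  proof -
    have "int (card (B - A)) = int (card (B - A - {j})) + 1"
      using card.remove[of "B - A" j] that fB by simp
    then have "k = l - int (card A) - int (card (B - A - {j}))"
      using cA[OF that(1)] unfolding k_def by linarith
    then show ?thesis using that B by (intro mod_hom_closed[OF G_word_sum_hom xA]) auto
  qed
  have gc: "g A j \<in> carrier (obj D k)" if "A \<subseteq> B" "j \<in> B - A" for A j
    unfolding g_def using gw[OF that] that B by (intro mod_hom_closed[OF h_hom]) auto
  \<comment> \<open>Extension by zero to \<open>j \<in> A\<close> turns the index range into all
    pairs from \<open>Pow B\<close> and \<open>B\<close>, over which the two summations can be
    exchanged.\<close>
  define T where "T A j = (if j \<in> A then \<zero>\<^bsub>obj D k\<^esub> else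
    [(tot_sign B A * (-1) ^ below (B - A) j)] \<cdot>\<^bsub>obj D k\<^esub> g A j)" for A j
  have Tc: "T A j \<in> carrier (obj D k)" if "A \<subseteq> B" "j \<in> B" for A j
    unfolding T_def using gc[OF that(1)] that by auto
  have "cube_sum N D h G l x B =
    (\<Oplus>\<^bsub>obj D k\<^esub>A\<in>Pow B. [tot_sign B A] \<cdot>\<^bsub>obj D k\<^esub> word_sum D h G (B - A) (l - int (card A)) (x A))"
    using B by (simp add: cube_sum_def k_def)
  also have "\<dots> = (\<Oplus>\<^bsub>obj D k\<^esub>A\<in>Pow B. \<Oplus>\<^bsub>obj D k\<^esub>j\<in>B. T A j)"
  proof (rule M.M.finsum_cong')
    fix A assume "A \<in> Pow B"
    then have A: "A \<subseteq> B" by simp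
    have "word_sum D h G (B - A) (l - int (card A)) (x A) =
      (\<Oplus>\<^bsub>obj D k\<^esub>j\<in>B - A. [((-1) ^ below (B - A) j :: int)] \<cdot>\<^bsub>obj D k\<^esub> g A j)"
      unfolding g_def using A B cA[OF A] by (intro word_sum_expand xA) (auto simp: k_def)
    then have "[tot_sign B A] \<cdot>\<^bsub>obj D k\<^esub> word_sum D h G (B - A) (l - int (card A)) (x A) =
      (\<Oplus>\<^bsub>obj D k\<^esub>j\<in>B - A. [tot_sign B A] \<cdot>\<^bsub>obj D k\<^esub> ([((-1) ^ below (B - A) j :: int)] \<cdot>\<^bsub>obj D k\<^esub> g A j))"
      using gc[OF A] fB by (simp only:) (intro M.int_mult_finsum, auto)
    also have "\<dots> = (\<Oplus>\<^bsub>obj D k\<^esub>j\<in>B. T A j)"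
      using gc[OF A] fB Tc[OF A] by (intro M.M.add.finprod_mono_neutral_cong_left)
        (auto simp: T_def M.int_mult_assoc)
    finally show "[tot_sign B A] \<cdot>\<^bsub>obj D k\<^esub> word_sum D h G (B - A) (l - int (card A)) (x A) =
      (\<Oplus>\<^bsub>obj D k\<^esub>j\<in>B. T A j)" .
  qed (auto intro!: M.M.finsum_closed Tc)
  also have "\<dots> = (\<Oplus>\<^bsub>obj D k\<^esub>j\<in>B. \<Oplus>\<^bsub>obj D k\<^esub>A\<in>Pow B. T A j)"
    using fB Tc by (intro M.finsum_swap) auto
  also have "\<dots> = (\<Oplus>\<^bsub>obj D k\<^esub>j\<in>B. [((-1) ^ below B j :: int)] \<cdot>\<^bsub>obj D k\<^esub> h j k (?y (B - {j})))"
  proof (rule M.M.finsum_cong')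
    have kj: "k = l - int (card (B - {j}))" if "j \<in> B" for j
      using card.remove[OF fB that] by (simp add: k_def)
    show "(\<lambda>j. [((-1) ^ below B j :: int)] \<cdot>\<^bsub>obj D k\<^esub> h j k (?y (B - {j}))) \<in> B \<rightarrow> carrier (obj D k)"
      using y B kj by (intro funcsetI M.M.add.int_pow_closed mod_hom_closed[OF h_hom] cube_obj_closed) auto
    fix j assume j: "j \<in> B"
    then have jN: "j \<in> N" using B by auto
    have BA: "B - {j} - A = B - A - {j}" for A by auto
    have "?y (B - {j}) = (\<Oplus>\<^bsub>obj D k\<^esub>A\<in>Pow (B - {j}).
        [((-1) ^ card (B - {j}) * tot_sign (B - {j}) A)] \<cdot>\<^bsub>obj D k\<^esub>
        G_word_sum D h G (B - A - {j}) (l - int (card A)) (x A))"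
      using B kj[OF j] by (subst G_cube_sum[OF x, of _ k]) (auto simp: BA)
    then have "h j k (?y (B - {j})) = h j k \<dots>" by simp
    also have "\<dots> = (\<Oplus>\<^bsub>obj D k\<^esub>A\<in>Pow (B - {j}).
        h j k ([((-1) ^ card (B - {j}) * tot_sign (B - {j}) A)] \<cdot>\<^bsub>obj D k\<^esub>
        G_word_sum D h G (B - A - {j}) (l - int (card A)) (x A)))"
      using fB j gw by (intro mod_hom_finsum[OF lm lm h_hom[OF jN]]) auto
    also have "\<dots> = (\<Oplus>\<^bsub>obj D k\<^esub>A\<in>Pow (B - {j}).
        [((-1) ^ card (B - {j}) * tot_sign (B - {j}) A)] \<cdot>\<^bsub>obj D k\<^esub> g A j)"
    proof (rule M.M.finsum_cong')
      fix A assume "A \<in> Pow (B - {j})"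
      then have A: "A \<subseteq> B" "j \<in> B - A" using j by auto
      show "h j k ([((-1) ^ card (B - {j}) * tot_sign (B - {j}) A)] \<cdot>\<^bsub>obj D k\<^esub>
          G_word_sum D h G (B - A - {j}) (l - int (card A)) (x A)) =
        [((-1) ^ card (B - {j}) * tot_sign (B - {j}) A)] \<cdot>\<^bsub>obj D k\<^esub> g A j"
        unfolding g_def by (rule mod_hom_int_mult[OF lm lm h_hom[OF jN] gw[OF A]])
    qed (use j gc in auto)
    finally have "[((-1) ^ below B j :: int)] \<cdot>\<^bsub>obj D k\<^esub> h j k (?y (B - {j})) =
      [((-1) ^ below B j :: int)] \<cdot>\<^bsub>obj D k\<^esub> (\<Oplus>\<^bsub>obj D k\<^esub>A\<in>Pow (B - {j}).
        [((-1) ^ card (B - {j}) * tot_sign (B - {j}) A)] \<cdot>\<^bsub>obj D k\<^esub> g A j)" by simp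
    also have "\<dots> = (\<Oplus>\<^bsub>obj D k\<^esub>A\<in>Pow (B - {j}). [((-1) ^ below B j :: int)] \<cdot>\<^bsub>obj D k\<^esub>
        ([((-1) ^ card (B - {j}) * tot_sign (B - {j}) A)] \<cdot>\<^bsub>obj D k\<^esub> g A j))"
      using fB j gc by (intro M.int_mult_finsum) auto
    also have "\<dots> = (\<Oplus>\<^bsub>obj D k\<^esub>A\<in>Pow B. T A j)"
    proof (rule M.M.add.finprod_mono_neutral_cong_left)
      fix A assume A': "A \<in> Pow (B - {j})"
      then have A: "A \<subseteq> B" "j \<in> B - A" using j by auto
      show "[((-1) ^ below B j :: int)] \<cdot>\<^bsub>obj D k\<^esub>
        ([((-1) ^ card (B - {j}) * tot_sign (B - {j}) A)] \<cdot>\<^bsub>obj D k\<^esub> g A j) = T A j"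
        using A gc[OF A] tot_sign_step[OF fB j, of A] A' by (simp add: T_def M.int_mult_assoc)
    next
      fix A assume "A \<in> Pow B - Pow (B - {j})"
      then show "T A j = \<zero>\<^bsub>obj D k\<^esub>" by (auto simp: T_def)
    qed (use fB j Tc in auto)
    finally show "(\<Oplus>\<^bsub>obj D k\<^esub>A\<in>Pow B. T A j) =
      [((-1) ^ below B j :: int)] \<cdot>\<^bsub>obj D k\<^esub> h j k (?y (B - {j}))" ..
  qed simp
  also have "\<dots> = edge_sum N D h l ?y B"
    using B by (simp add: edge_sum_def k_def)
  finally show "cube_sum N D h G l x B = edge_sum N D h l ?y B" .
qed

end

section \<open>Relations between the differential, the edges and the homotopy\<close>

context cube_words
begin

lemma edge_sum_at:
  "B \<subseteq> N \<Longrightarrow> k = l + 1 - int (card B) \<Longrightarrow> edge_sum N D h l x B =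
    (\<Oplus>\<^bsub>obj D k\<^esub>j\<in>B. [((-1) ^ below B j :: int)] \<cdot>\<^bsub>obj D k\<^esub> h j k (x (B - {j})))"
  by (simp add: edge_sum_def)

lemma signed_diag_at:
  "B \<subseteq> N \<Longrightarrow> k = l - int (card B) \<Longrightarrow> k' = k + p \<Longrightarrow> signed_diag N D p f l x B =
    [((-1) ^ card B :: int)] \<cdot>\<^bsub>obj D k'\<^esub> f k (x B)"
  by (simp add: signed_diag_def diff_add_eq)

lemma diff_graded: "graded_map R D D 1 (diff D)"
  using cx by (simp add: cochain_complex_def)

text \<open>Each \<open>h k\<close> commutes with \<open>diff D\<close>. The minus sign comes from
  the signs of \<open>signed_diag\<close> at \<open>B\<close> and \<open>B - {k}\<close>, whose
  cardinalities differ by one.\<close>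

lemma diff_edge_sum:
  assumes x: "x \<in> carrier (cube_obj N D l)" and l': "l' = l + 1" "l'' = l + 2"
  shows "signed_diag N D 1 (diff D) l' (edge_sum N D h l x) =
    \<ominus>\<^bsub>cube_obj N D l''\<^esub> edge_sum N D h l' (signed_diag N D 1 (diff D) l x)"
proof (rule cube_obj_eqI[of _ l''])
  interpret P: left_module R "cube_obj N D l''" by (rule lm_cube)
  have es: "edge_sum N D h l x \<in> carrier (cube_obj N D l')"
    using l' by (intro mod_hom_closed[OF edge_sum_hom x])
  then show "signed_diag N D 1 (diff D) l' (edge_sum N D h l x) \<in> carrier (cube_obj N D l'')"
    using l' by (intro mod_hom_closed[OF signed_diag_hom[OF diff_graded]]) auto
  have sx: "signed_diag N D 1 (diff D) l x \<in> carrier (cube_obj N D l')"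
    using l' x by (intro mod_hom_closed[OF signed_diag_hom[OF diff_graded]]) auto
  then have esx: "edge_sum N D h l' (signed_diag N D 1 (diff D) l x) \<in> carrier (cube_obj N D l'')"
    using l' by (intro mod_hom_closed[OF edge_sum_hom]) auto
  then show "\<ominus>\<^bsub>cube_obj N D l''\<^esub> edge_sum N D h l' (signed_diag N D 1 (diff D) l x) \<in> carrier (cube_obj N D l'')"
    by simp
  fix B assume B: "B \<subseteq> N"
  then have fB: "finite B" by (rule finite_vertex)
  define m where "m = l + 1 - int (card B)"
  let ?M = "obj D m" and ?M' = "obj D (m + 1)"
  interpret M: left_module R ?M by (rule lm)
  interpret M': left_module R ?M' by (rule lm)
  have mk: "m = l - int (card (B - {k}))" if "k \<in> B" for k
    using card.remove[OF fB that] by (simp add: m_def)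
  have d: "diff D m \<in> mod_hom R ?M ?M'" by (rule diff_hom) simp
  have xk: "x (B - {k}) \<in> carrier ?M" if "k \<in> B" for k
    using B that mk[OF that] by (intro cube_obj_closed[OF x]) auto
  have hx: "h k m (x (B - {k})) \<in> carrier ?M" if "k \<in> B" for k
    using xk[OF that] that B by (intro mod_hom_closed[OF h_hom]) auto
  have dhx: "diff D m (h k m (x (B - {k}))) \<in> carrier ?M'" if "k \<in> B" for k
    using mod_hom_closed[OF d hx[OF that]] .
  have "signed_diag N D 1 (diff D) l' (edge_sum N D h l x) B =
     [((-1) ^ card B :: int)] \<cdot>\<^bsub>?M'\<^esub> diff D m (edge_sum N D h l x B)"
    using B l' by (intro signed_diag_at) (auto simp: m_def)
  also have "edge_sum N D h l x B =
      (\<Oplus>\<^bsub>?M\<^esub>k\<in>B. [((-1) ^ below B k :: int)] \<cdot>\<^bsub>?M\<^esub> h k m (x (B - {k})))"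
    using B by (intro edge_sum_at) (auto simp: m_def)
  also have "diff D m (\<Oplus>\<^bsub>?M\<^esub>k\<in>B. [((-1) ^ below B k :: int)] \<cdot>\<^bsub>?M\<^esub> h k m (x (B - {k}))) =
      (\<Oplus>\<^bsub>?M'\<^esub>k\<in>B. diff D m ([((-1) ^ below B k :: int)] \<cdot>\<^bsub>?M\<^esub> h k m (x (B - {k}))))"
    using fB hx by (intro mod_hom_finsum[OF lm lm d]) auto
  also have "[((-1) ^ card B :: int)] \<cdot>\<^bsub>?M'\<^esub> \<dots> = (\<Oplus>\<^bsub>?M'\<^esub>k\<in>B. [((-1) ^ card B :: int)] \<cdot>\<^bsub>?M'\<^esub>
      diff D m ([((-1) ^ below B k :: int)] \<cdot>\<^bsub>?M\<^esub> h k m (x (B - {k}))))"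
    using fB hx by (intro M'.int_mult_finsum) (auto intro!: mod_hom_closed[OF d])
  also have "\<dots> = (\<Oplus>\<^bsub>?M'\<^esub>k\<in>B. [(-1 :: int)] \<cdot>\<^bsub>?M'\<^esub> ([((-1) ^ below B k :: int)] \<cdot>\<^bsub>?M'\<^esub>
      h k (m + 1) (signed_diag N D 1 (diff D) l x (B - {k}))))"
  proof (rule M'.M.finsum_cong')
    have s: "signed_diag N D 1 (diff D) l x (B - {k}) =
      [((-1) ^ card (B - {k}) :: int)] \<cdot>\<^bsub>?M'\<^esub> diff D m (x (B - {k}))" if "k \<in> B" for k
      using B mk[OF that] by (intro signed_diag_at) auto
    have dx: "diff D m (x (B - {k})) \<in> carrier ?M'" if "k \<in> B" for k
      using mod_hom_closed[OF d xk[OF that]] .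
    have hdx: "h k (m + 1) (diff D m (x (B - {k}))) = diff D m (h k m (x (B - {k})))" if "k \<in> B" for k
      using that B by (intro h_diff xk) auto
    have hs: "h k (m + 1) (signed_diag N D 1 (diff D) l x (B - {k})) =
      [((-1) ^ card (B - {k}) :: int)] \<cdot>\<^bsub>?M'\<^esub> diff D m (h k m (x (B - {k})))" if "k \<in> B" for k
      unfolding s[OF that] hdx[OF that, symmetric]
      using that B by (intro mod_hom_int_mult[OF lm lm h_hom dx]) auto
    show "(\<lambda>k. [(-1 :: int)] \<cdot>\<^bsub>?M'\<^esub> ([((-1) ^ below B k :: int)] \<cdot>\<^bsub>?M'\<^esub>
      h k (m + 1) (signed_diag N D 1 (diff D) l x (B - {k})))) \<in> B \<rightarrow> carrier ?M'"
      using dhx by (auto simp: hs)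
    fix k assume k: "k \<in> B"
    have cB: "card B = Suc (card (B - {k}))" using fB k by (metis card.remove)
    show "[((-1) ^ card B :: int)] \<cdot>\<^bsub>?M'\<^esub> diff D m ([((-1) ^ below B k :: int)] \<cdot>\<^bsub>?M\<^esub> h k m (x (B - {k}))) =
      [(-1 :: int)] \<cdot>\<^bsub>?M'\<^esub> ([((-1) ^ below B k :: int)] \<cdot>\<^bsub>?M'\<^esub>
      h k (m + 1) (signed_diag N D 1 (diff D) l x (B - {k})))"
      unfolding hs[OF k] mod_hom_int_mult[OF lm lm d hx[OF k]]
      using dhx[OF k] by (simp only: M'.int_mult_assoc M'.M.add.int_pow_closed cB power_Suc mult_ac)
  qed simp
  also have "\<dots> = [(-1 :: int)] \<cdot>\<^bsub>?M'\<^esub> (\<Oplus>\<^bsub>?M'\<^esub>k\<in>B. [((-1) ^ below B k :: int)] \<cdot>\<^bsub>?M'\<^esub>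
      h k (m + 1) (signed_diag N D 1 (diff D) l x (B - {k})))"
  proof (rule M'.int_mult_finsum[symmetric, OF fB], rule funcsetI)
    fix k assume k: "k \<in> B"
    have "signed_diag N D 1 (diff D) l x (B - {k}) \<in> carrier ?M'"
      using B mk[OF k] l' by (intro cube_obj_closed[OF sx]) auto
    then show "[((-1) ^ below B k :: int)] \<cdot>\<^bsub>?M'\<^esub>
      h k (m + 1) (signed_diag N D 1 (diff D) l x (B - {k})) \<in> carrier ?M'"
      using B k by (auto intro: mod_hom_closed[OF h_hom])
  qed
  also have "(\<Oplus>\<^bsub>?M'\<^esub>k\<in>B. [((-1) ^ below B k :: int)] \<cdot>\<^bsub>?M'\<^esub>
      h k (m + 1) (signed_diag N D 1 (diff D) l x (B - {k}))) =
      edge_sum N D h l' (signed_diag N D 1 (diff D) l x) B"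
    using B l' by (intro edge_sum_at[symmetric]) (auto simp: m_def)
  also have "[(-1 :: int)] \<cdot>\<^bsub>?M'\<^esub> \<dots> = \<ominus>\<^bsub>?M'\<^esub> edge_sum N D h l' (signed_diag N D 1 (diff D) l x) B"
  proof -
    have c: "edge_sum N D h l' (signed_diag N D 1 (diff D) l x) B \<in> carrier ?M'"
      using B l' by (intro cube_obj_closed[OF esx]) (auto simp: m_def)
    show ?thesis unfolding M'.int_mult_neg[OF c] M'.M.add.int_pow_1[OF c] ..
  qed
  also have "\<dots> = (\<ominus>\<^bsub>cube_obj N D l''\<^esub> edge_sum N D h l' (signed_diag N D 1 (diff D) l x)) B"
    using B l' by (intro cube_obj_neg[symmetric] esx) (auto simp: m_def)
  finally show "signed_diag N D 1 (diff D) l' (edge_sum N D h l x) B =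
    (\<ominus>\<^bsub>cube_obj N D l''\<^esub> edge_sum N D h l' (signed_diag N D 1 (diff D) l x)) B" .
qed

text \<open>Deleting the smaller of the two elements lowers the position of the larger by one,
  whereas deleting the larger does not affect the smaller.\<close>

lemma edge_sign_antisym:
  assumes "finite B" "j \<in> B" "k \<in> B" "j \<noteq> k"
  shows "(-1 :: int) ^ below B k * (-1) ^ below (B - {k}) j =
    - ((-1) ^ below B j * (-1) ^ below (B - {j}) k)"
proof -
  have *: "(-1 :: int) ^ below B k * (-1) ^ below (B - {k}) j =
    - ((-1) ^ below B j * (-1) ^ below (B - {j}) k)" if "j \<in> B" "k \<in> B" "j < k" for j k
  proof -
    have "{y \<in> B - {k}. y < j} = {y \<in> B. y < j}" using that by auto
    moreover have "{y \<in> B. y < k} = insert j {y \<in> B - {j}. y < k}" using that by auto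
    ultimately show ?thesis using assms(1) by (simp add: below_def)
  qed
  show ?thesis using *[of j k] *[of k j] assms by (cases "j < k") auto
qed

text \<open>Because the \<open>h k\<close> commute, the two orders of adding a pair of elements give
  the same map, with opposite signs by \<open>edge_sign_antisym\<close>.\<close>

lemma edge_sum_edge_sum:
  assumes x: "x \<in> carrier (cube_obj N D l)" and l': "l' = l + 1" "l'' = l + 2"
  shows "edge_sum N D h l' (edge_sum N D h l x) = \<zero>\<^bsub>cube_obj N D l''\<^esub>"
proof (rule cube_obj_eqI[of _ l''])
  interpret P: left_module R "cube_obj N D l''" by (rule lm_cube)
  have es: "edge_sum N D h l x \<in> carrier (cube_obj N D l')"
    using l' by (intro mod_hom_closed[OF edge_sum_hom x])
  show "edge_sum N D h l' (edge_sum N D h l x) \<in> carrier (cube_obj N D l'')"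
    using l' by (intro mod_hom_closed[OF edge_sum_hom es]) auto
  show "\<zero>\<^bsub>cube_obj N D l''\<^esub> \<in> carrier (cube_obj N D l'')" by simp
  fix B assume B: "B \<subseteq> N"
  then have fB: "finite B" by (rule finite_vertex)
  define m where "m = l' + 1 - int (card B)"
  let ?M = "obj D m"
  interpret M: left_module R ?M by (rule lm)
  \<comment> \<open>The same element cannot be added twice; filling the diagonal with zero gives the
    square index range of \<open>finsum_antisym\<close>.\<close>
  define t where "t k j = (if k = j then \<zero>\<^bsub>?M\<^esub> else
    [((-1) ^ below B k * (-1) ^ below (B - {k}) j :: int)] \<cdot>\<^bsub>?M\<^esub> h k m (h j m (x (B - {k} - {j}))))" for k j
  have xkj: "x (B - {k} - {j}) \<in> carrier ?M" if "k \<in> B" "j \<in> B - {k}" for k j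
  proof -
    have "card B = Suc (card (B - {k}))" "card (B - {k}) = Suc (card (B - {k} - {j}))"
      using fB that by (metis card.remove finite_Diff)+
    then show ?thesis using B l' by (intro cube_obj_closed[OF x]) (auto simp: m_def)
  qed
  have hx: "h j m (x (B - {k} - {j})) \<in> carrier ?M" if "k \<in> B" "j \<in> B - {k}" for k j
    using B that by (intro mod_hom_closed[OF h_hom xkj]) auto
  have hhx: "h k m (h j m (x (B - {k} - {j}))) \<in> carrier ?M" if "k \<in> B" "j \<in> B - {k}" for k j
    using B that by (intro mod_hom_closed[OF h_hom hx]) auto
  have tc: "t k j \<in> carrier ?M" if "k \<in> B" "j \<in> B" for k j
    unfolding t_def using hhx[of k j] that by auto
  have "edge_sum N D h l' (edge_sum N D h l x) B =
    (\<Oplus>\<^bsub>?M\<^esub>k\<in>B. [((-1) ^ below B k :: int)] \<cdot>\<^bsub>?M\<^esub> h k m (edge_sum N D h l x (B - {k})))"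
    using B by (intro edge_sum_at) (auto simp: m_def)
  also have "\<dots> = (\<Oplus>\<^bsub>?M\<^esub>k\<in>B. \<Oplus>\<^bsub>?M\<^esub>j\<in>B. t k j)"
  proof (rule M.M.finsum_cong')
    fix k assume k: "k \<in> B"
    then have kN: "k \<in> N" using B by auto
    have "card B = Suc (card (B - {k}))" using fB k by (metis card.remove)
    then have "edge_sum N D h l x (B - {k}) =
      (\<Oplus>\<^bsub>?M\<^esub>j\<in>B - {k}. [((-1) ^ below (B - {k}) j :: int)] \<cdot>\<^bsub>?M\<^esub> h j m (x (B - {k} - {j})))"
      using B l' by (intro edge_sum_at) (auto simp: m_def)
    then have "h k m (edge_sum N D h l x (B - {k})) = h k m \<dots>" by simp
    also have "\<dots> = (\<Oplus>\<^bsub>?M\<^esub>j\<in>B - {k}. h k m ([((-1) ^ below (B - {k}) j :: int)] \<cdot>\<^bsub>?M\<^esub> h j m (x (B - {k} - {j}))))"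
      using fB hx[OF k] by (intro mod_hom_finsum[OF lm lm h_hom[OF kN]]) auto
    finally have "[((-1) ^ below B k :: int)] \<cdot>\<^bsub>?M\<^esub> h k m (edge_sum N D h l x (B - {k})) =
      [((-1) ^ below B k :: int)] \<cdot>\<^bsub>?M\<^esub> \<dots>" by simp
    also have "\<dots> = (\<Oplus>\<^bsub>?M\<^esub>j\<in>B - {k}. [((-1) ^ below B k :: int)] \<cdot>\<^bsub>?M\<^esub>
       h k m ([((-1) ^ below (B - {k}) j :: int)] \<cdot>\<^bsub>?M\<^esub> h j m (x (B - {k} - {j}))))"
      using fB hx[OF k] by (intro M.int_mult_finsum) (auto intro!: mod_hom_closed[OF h_hom[OF kN]])
    also have "\<dots> = (\<Oplus>\<^bsub>?M\<^esub>j\<in>B. t k j)"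
    proof (rule M.M.add.finprod_mono_neutral_cong_left)
      fix j assume j: "j \<in> B - {k}"
      show "[((-1) ^ below B k :: int)] \<cdot>\<^bsub>?M\<^esub>
       h k m ([((-1) ^ below (B - {k}) j :: int)] \<cdot>\<^bsub>?M\<^esub> h j m (x (B - {k} - {j}))) = t k j"
        unfolding mod_hom_int_mult[OF lm lm h_hom[OF kN] hx[OF k j]] M.int_mult_assoc[OF hhx[OF k j]]
        using j by (auto simp: t_def)
    qed (use fB k tc in \<open>auto simp: t_def\<close>)
    finally show "[((-1) ^ below B k :: int)] \<cdot>\<^bsub>?M\<^esub> h k m (edge_sum N D h l x (B - {k})) =
      (\<Oplus>\<^bsub>?M\<^esub>j\<in>B. t k j)" .
  qed (auto intro!: M.M.finsum_closed tc)
  also have "\<dots> = \<zero>\<^bsub>?M\<^esub>"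
  proof (rule M.finsum_antisym[OF fB tc])
    fix j k assume jk: "k \<in> B" "j \<in> B" "k \<noteq> j"
    have "B - {j} - {k} = B - {k} - {j}" by auto
    then have "h j m (h k m (x (B - {j} - {k}))) = h k m (h j m (x (B - {k} - {j})))"
      using jk B by (simp only:) (intro hcomm xkj, auto)
    moreover have "[(- a :: int)] \<cdot>\<^bsub>?M\<^esub> y = \<ominus>\<^bsub>?M\<^esub> ([a] \<cdot>\<^bsub>?M\<^esub> y)" if "y \<in> carrier ?M" for a y
      using that by (rule M.int_mult_neg)
    ultimately show "t k j = \<ominus>\<^bsub>?M\<^esub> t j k"
      using jk hhx[of k j] edge_sign_antisym[OF fB jk(2,1)] by (simp add: t_def)
  qed (auto simp: t_def)
  also have "\<dots> = \<zero>\<^bsub>cube_obj N D l''\<^esub> B"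
    using B l' by (intro cube_obj_zero[symmetric]) (auto simp: m_def)
  finally show "edge_sum N D h l' (edge_sum N D h l x) B = \<zero>\<^bsub>cube_obj N D l''\<^esub> B" .
qed

text \<open>Both operators preserve the vertex, so at each \<open>B\<close> the sign
  \<open>(-1) ^ card B\<close> occurs twice and disappears, which leaves the homotopy formula in
  \<open>D\<close>.\<close>

lemma diff_G_signed:
  assumes x: "x \<in> carrier (cube_obj N D l)" and l': "l' = l - 1" "l'' = l + 1"
  shows "signed_diag N D 1 (diff D) l' (signed_diag N D (-1) G l x) \<oplus>\<^bsub>cube_obj N D l\<^esub>
    signed_diag N D (-1) G l'' (signed_diag N D 1 (diff D) l x) =
    plain_diag N \<rho> l x \<ominus>\<^bsub>cube_obj N D l\<^esub> x"
proof (rule cube_obj_eqI[of _ l])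
  interpret P: left_module R "cube_obj N D l" by (rule lm_cube)
  have gx: "signed_diag N D (-1) G l x \<in> carrier (cube_obj N D l')"
    using l' x by (intro mod_hom_closed[OF signed_diag_hom[OF G_graded]]) auto
  have dx: "signed_diag N D 1 (diff D) l x \<in> carrier (cube_obj N D l'')"
    using l' x by (intro mod_hom_closed[OF signed_diag_hom[OF diff_graded]]) auto
  have dgx: "signed_diag N D 1 (diff D) l' (signed_diag N D (-1) G l x) \<in> carrier (cube_obj N D l)"
    using l' gx by (intro mod_hom_closed[OF signed_diag_hom[OF diff_graded]]) auto
  have gdx: "signed_diag N D (-1) G l'' (signed_diag N D 1 (diff D) l x) \<in> carrier (cube_obj N D l)"
    using l' dx by (intro mod_hom_closed[OF signed_diag_hom[OF G_graded]]) auto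
  show "signed_diag N D 1 (diff D) l' (signed_diag N D (-1) G l x) \<oplus>\<^bsub>cube_obj N D l\<^esub>
    signed_diag N D (-1) G l'' (signed_diag N D 1 (diff D) l x) \<in> carrier (cube_obj N D l)"
    using dgx gdx by (rule P.M.a_closed)
  have rx: "plain_diag N \<rho> l x \<in> carrier (cube_obj N D l)"
    using x rmap by (intro mod_hom_closed[OF plain_diag_hom]) (auto simp: cochain_map_def)
  then show "plain_diag N \<rho> l x \<ominus>\<^bsub>cube_obj N D l\<^esub> x \<in> carrier (cube_obj N D l)"
    using x by (rule P.M.minus_closed)
  fix B assume B: "B \<subseteq> N"
  define m where "m = l - int (card B)"
  let ?M = "obj D m"
  interpret M: left_module R ?M by (rule lm)
  have xB: "x B \<in> carrier ?M" using B by (intro cube_obj_closed[OF x]) (auto simp: m_def)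
  have G: "G m \<in> mod_hom R ?M (obj D (m - 1))" by (rule G_hom) simp
  have d: "diff D m \<in> mod_hom R ?M (obj D (m + 1))" by (rule diff_hom) simp
  have d': "diff D (m - 1) \<in> mod_hom R (obj D (m - 1)) ?M" by (rule diff_hom) simp
  have G': "G (m + 1) \<in> mod_hom R (obj D (m + 1)) ?M" by (rule G_hom) simp
  have sq: "(-1 :: int) ^ card B * (-1) ^ card B = 1" by (simp flip: power_add)
  have one: "[(1 :: int)] \<cdot>\<^bsub>?M\<^esub> y = y" if "y \<in> carrier ?M" for y
    using that by (rule M.M.add.int_pow_1)
  have "signed_diag N D 1 (diff D) l' (signed_diag N D (-1) G l x) B =
    [((-1) ^ card B :: int)] \<cdot>\<^bsub>?M\<^esub> diff D (m - 1) (signed_diag N D (-1) G l x B)"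
    using B l' by (intro signed_diag_at) (auto simp: m_def)
  also have "signed_diag N D (-1) G l x B = [((-1) ^ card B :: int)] \<cdot>\<^bsub>obj D (m - 1)\<^esub> G m (x B)"
    using B by (intro signed_diag_at) (auto simp: m_def)
  finally have 1: "signed_diag N D 1 (diff D) l' (signed_diag N D (-1) G l x) B = diff D (m - 1) (G m (x B))"
    using mod_hom_closed[OF d' mod_hom_closed[OF G xB]]
    by (simp add: mod_hom_int_mult[OF lm lm d' mod_hom_closed[OF G xB]] M.int_mult_assoc sq one)
  have "signed_diag N D (-1) G l'' (signed_diag N D 1 (diff D) l x) B =
    [((-1) ^ card B :: int)] \<cdot>\<^bsub>?M\<^esub> G (m + 1) (signed_diag N D 1 (diff D) l x B)"
    using B l' by (intro signed_diag_at) (auto simp: m_def)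
  also have "signed_diag N D 1 (diff D) l x B = [((-1) ^ card B :: int)] \<cdot>\<^bsub>obj D (m + 1)\<^esub> diff D m (x B)"
    using B by (intro signed_diag_at) (auto simp: m_def)
  finally have 2: "signed_diag N D (-1) G l'' (signed_diag N D 1 (diff D) l x) B = G (m + 1) (diff D m (x B))"
    using mod_hom_closed[OF G' mod_hom_closed[OF d xB]]
    by (simp add: mod_hom_int_mult[OF lm lm G' mod_hom_closed[OF d xB]] M.int_mult_assoc sq one)
  have "(signed_diag N D 1 (diff D) l' (signed_diag N D (-1) G l x) \<oplus>\<^bsub>cube_obj N D l\<^esub>
    signed_diag N D (-1) G l'' (signed_diag N D 1 (diff D) l x)) B =
    diff D (m - 1) (G m (x B)) \<oplus>\<^bsub>?M\<^esub> G (m + 1) (diff D m (x B))"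
    unfolding 1[symmetric] 2[symmetric] using B by (intro cube_obj_add) (auto simp: m_def)
  also have "\<dots> = \<rho> m (x B) \<ominus>\<^bsub>?M\<^esub> x B"
    using htpy xB by (simp add: homotopy_def)
  also have "\<rho> m (x B) = plain_diag N \<rho> l x B" using B by (simp add: plain_diag_def m_def)
  also have "\<dots> \<ominus>\<^bsub>?M\<^esub> x B = (plain_diag N \<rho> l x \<ominus>\<^bsub>cube_obj N D l\<^esub> x) B"
    using B by (intro cube_obj_minus[symmetric] rx x) (auto simp: m_def)
  finally show "(signed_diag N D 1 (diff D) l' (signed_diag N D (-1) G l x) \<oplus>\<^bsub>cube_obj N D l\<^esub>
    signed_diag N D (-1) G l'' (signed_diag N D 1 (diff D) l x)) B =
    (plain_diag N \<rho> l x \<ominus>\<^bsub>cube_obj N D l\<^esub> x) B" .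
qed

text \<open>The value at \<open>B\<close> is expressed through values at the sets
  \<open>B - {k}\<close> only; induction on the cardinality starts at the empty vertex, where the
  sum is empty.\<close>

lemma edge_sum_G_fixpoint:
  assumes e: "e \<in> carrier (cube_obj N D l)" and l': "l' = l - 1"
    and eq: "e = edge_sum N D h l' (signed_diag N D (-1) G l e)"
  shows "e = \<zero>\<^bsub>cube_obj N D l\<^esub>"
proof -
  interpret P: left_module R "cube_obj N D l" by (rule lm_cube)
  have "B \<subseteq> N \<Longrightarrow> e B = \<zero>\<^bsub>obj D (l - int (card B))\<^esub>" for B
  proof (induction "card B" arbitrary: B rule: less_induct)
    case less
    then have fB: "finite B" by (intro finite_vertex)
    define m where "m = l - int (card B)"
    interpret M: left_module R "obj D m" by (rule lm)
    have z: "[((-1) ^ below B k :: int)] \<cdot>\<^bsub>obj D m\<^esub> h k m (signed_diag N D (-1) G l e (B - {k})) =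
        \<zero>\<^bsub>obj D m\<^esub>" if k: "k \<in> B" for k
    proof -
      have c: "card B = Suc (card (B - {k}))" using fB k by (metis card.remove)
      have kN: "k \<in> N" using k less.prems by auto
      have "e (B - {k}) = \<zero>\<^bsub>obj D (l - int (card (B - {k})))\<^esub>"
        using c less.prems by (intro less.hyps) auto
      moreover have lc: "l - int (card (B - {k})) = m + 1" using c by (simp add: m_def)
      ultimately have ez: "e (B - {k}) = \<zero>\<^bsub>obj D (m + 1)\<^esub>" by (simp only:)
      have G: "G (m + 1) \<in> mod_hom R (obj D (m + 1)) (obj D m)" by (rule G_hom) simp
      have "signed_diag N D (-1) G l e (B - {k}) =
        [((-1) ^ card (B - {k}) :: int)] \<cdot>\<^bsub>obj D m\<^esub> G (m + 1) (e (B - {k}))"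
        using less.prems lc by (intro signed_diag_at) auto
      also have "\<dots> = \<zero>\<^bsub>obj D m\<^esub>" unfolding ez mod_hom_zero[OF lm lm G] by simp
      finally show ?thesis using mod_hom_zero[OF lm lm h_hom[OF kN]] by simp
    qed
    have "e B = edge_sum N D h l' (signed_diag N D (-1) G l e) B" using eq by simp
    also have "\<dots> = (\<Oplus>\<^bsub>obj D m\<^esub>k\<in>B. [((-1) ^ below B k :: int)] \<cdot>\<^bsub>obj D m\<^esub>
        h k m (signed_diag N D (-1) G l e (B - {k})))"
      using less.prems l' by (intro edge_sum_at) (auto simp: m_def)
    also have "\<dots> = \<zero>\<^bsub>obj D m\<^esub>" using z by (rule M.M.add.finprod_one_eqI)
    finally show ?case by (simp add: m_def)
  qed
  then show ?thesis by (intro cube_obj_eqI[OF e P.M.zero_closed]) (simp add: cube_obj_zero)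
qed

text \<open>The left-hand side \<open>e\<close> satisfies \<open>e = \<delta> G e\<close> and
  therefore vanishes by \<open>edge_sum_G_fixpoint\<close>. Besides the recursion, the derivation
  uses that \<open>\<delta>\<close> squares to zero, that it anticommutes with \<open>d\<close>, and
  the homotopy formula at \<open>v\<close>.\<close>

lemma diff_cube_sum:
  assumes u: "u \<in> carrier (cube_obj N D l)" and l': "l' = l + 1" "l'' = l + 2"
  defines "v \<equiv> cube_sum N D h G l u"
  shows "signed_diag N D 1 (diff D) l' v \<oplus>\<^bsub>cube_obj N D l''\<^esub>
    (cube_sum N D h G l' (signed_diag N D 1 (diff D) l u) \<oplus>\<^bsub>cube_obj N D l''\<^esub>
     cube_sum N D h G l' (plain_diag N \<rho> l' v)) = \<zero>\<^bsub>cube_obj N D l''\<^esub>"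
proof -
  interpret P0: left_module R "cube_obj N D l" by (rule lm_cube)
  interpret P1: left_module R "cube_obj N D l'" by (rule lm_cube)
  interpret P2: left_module R "cube_obj N D l''" by (rule lm_cube)
  let ?d = "signed_diag N D 1 (diff D)" and ?G = "signed_diag N D (-1) G"
    and ?\<delta> = "edge_sum N D h" and ?\<Delta> = "cube_sum N D h G"
  have d0: "?d l \<in> mod_hom R (cube_obj N D l) (cube_obj N D l')"
    and d1: "?d l' \<in> mod_hom R (cube_obj N D l') (cube_obj N D l'')"
    using l' by (auto intro!: signed_diag_hom[OF diff_graded])
  have G1: "?G l' \<in> mod_hom R (cube_obj N D l') (cube_obj N D l)"
    and G2: "?G l'' \<in> mod_hom R (cube_obj N D l'') (cube_obj N D l')"
    using l' by (auto intro!: signed_diag_hom[OF G_graded])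
  have e0: "?\<delta> l \<in> mod_hom R (cube_obj N D l) (cube_obj N D l')"
    and e1: "?\<delta> l' \<in> mod_hom R (cube_obj N D l') (cube_obj N D l'')"
    using l' by (auto intro!: edge_sum_hom)
  have D0: "?\<Delta> l \<in> mod_hom R (cube_obj N D l) (cube_obj N D l')"
    and D1: "?\<Delta> l' \<in> mod_hom R (cube_obj N D l') (cube_obj N D l'')"
    using l' by (auto intro!: cube_sum_hom)
  have r: "plain_diag N \<rho> l' \<in> mod_hom R (cube_obj N D l') (cube_obj N D l')"
    using rmap by (intro plain_diag_hom) (auto simp: cochain_map_def)
  have v: "v \<in> carrier (cube_obj N D l')" unfolding v_def by (rule mod_hom_closed[OF D0 u])
  define dv where "dv = ?d l' v"
  define w1 where "w1 = ?\<Delta> l' (?d l u)"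
  define w2 where "w2 = ?\<Delta> l' (plain_diag N \<rho> l' v)"
  have du: "?d l u \<in> carrier (cube_obj N D l')" by (rule mod_hom_closed[OF d0 u])
  have rv: "plain_diag N \<rho> l' v \<in> carrier (cube_obj N D l')" by (rule mod_hom_closed[OF r v])
  have Gv: "?G l' v \<in> carrier (cube_obj N D l)" by (rule mod_hom_closed[OF G1 v])
  have dv: "dv \<in> carrier (cube_obj N D l'')" unfolding dv_def by (rule mod_hom_closed[OF d1 v])
  have w1: "w1 \<in> carrier (cube_obj N D l'')" unfolding w1_def by (rule mod_hom_closed[OF D1 du])
  have w2: "w2 \<in> carrier (cube_obj N D l'')" unfolding w2_def by (rule mod_hom_closed[OF D1 rv])
  have uGv: "u \<oplus>\<^bsub>cube_obj N D l\<^esub> ?G l' v \<in> carrier (cube_obj N D l)" using u Gv by simp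
  have v_eq: "v = ?\<delta> l (u \<oplus>\<^bsub>cube_obj N D l\<^esub> ?G l' v)"
    unfolding v_def l'(1) by (rule cube_sum_eq_edge_sum[OF u])
  have ll: "l'' = l' + 1" using l' by simp
  define a where "a = ?\<delta> l' (?d l u)"
  define r' where "r' = ?\<delta> l' (plain_diag N \<rho> l' v)"
  define p where "p = ?\<delta> l' (?G l'' dv)"
  define q1 where "q1 = ?\<delta> l' (?G l'' w1)"
  define q2 where "q2 = ?\<delta> l' (?G l'' w2)"
  have c: "a \<in> carrier (cube_obj N D l'')" "r' \<in> carrier (cube_obj N D l'')"
    "p \<in> carrier (cube_obj N D l'')" "q1 \<in> carrier (cube_obj N D l'')" "q2 \<in> carrier (cube_obj N D l'')"
    unfolding a_def r'_def p_def q1_def q2_def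
    using mod_hom_closed[OF e1] mod_hom_closed[OF G2] du rv dv w1 w2 by blast+
  have "w1 = ?\<delta> l' (?d l u \<oplus>\<^bsub>cube_obj N D l'\<^esub> ?G l'' w1)"
    unfolding w1_def ll by (rule cube_sum_eq_edge_sum[OF du])
  then have W1: "w1 = a \<oplus>\<^bsub>cube_obj N D l''\<^esub> q1"
    using mod_hom_add[OF e1 du mod_hom_closed[OF G2 w1]] unfolding a_def q1_def by (rule trans)
  have "w2 = ?\<delta> l' (plain_diag N \<rho> l' v \<oplus>\<^bsub>cube_obj N D l'\<^esub> ?G l'' w2)"
    unfolding w2_def ll by (rule cube_sum_eq_edge_sum[OF rv])
  then have W2: "w2 = r' \<oplus>\<^bsub>cube_obj N D l''\<^esub> q2"
    using mod_hom_add[OF e1 rv mod_hom_closed[OF G2 w2]] unfolding r'_def q2_def by (rule trans)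
  \<comment> \<open>By the recursion \<open>v\<close> lies in the image of \<open>\<delta>\<close>.
    This removes the identity term of the homotopy formula once \<open>\<delta>\<close> is applied
    to it.\<close>
  have dv0: "?\<delta> l' v = \<zero>\<^bsub>cube_obj N D l''\<^esub>"
    using edge_sum_edge_sum[OF uGv l'] v_eq by simp
  have dGv: "?d l (?G l' v) \<in> carrier (cube_obj N D l')" by (rule mod_hom_closed[OF d0 Gv])
  have Gdv: "?G l'' dv \<in> carrier (cube_obj N D l')" by (rule mod_hom_closed[OF G2 dv])
  have "?d l (?G l' v) \<oplus>\<^bsub>cube_obj N D l'\<^esub> ?G l'' dv = plain_diag N \<rho> l' v \<ominus>\<^bsub>cube_obj N D l'\<^esub> v"
    unfolding dv_def using l' by (intro diff_G_signed[OF v]) auto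
  then have "?\<delta> l' (?d l (?G l' v) \<oplus>\<^bsub>cube_obj N D l'\<^esub> ?G l'' dv) =
    ?\<delta> l' (plain_diag N \<rho> l' v \<ominus>\<^bsub>cube_obj N D l'\<^esub> v)" by (rule arg_cong)
  then have "?\<delta> l' (?d l (?G l' v)) \<oplus>\<^bsub>cube_obj N D l''\<^esub> p = r'"
    unfolding mod_hom_add[OF e1 dGv Gdv] mod_hom_minus[OF lm_cube lm_cube e1 rv v] dv0
    using c by (simp add: p_def r'_def a_minus_def)
  moreover define b where "b = ?\<delta> l' (?d l (?G l' v))"
  moreover have bc: "b \<in> carrier (cube_obj N D l'')" unfolding b_def by (rule mod_hom_closed[OF e1 dGv])
  ultimately have bp: "b \<oplus>\<^bsub>cube_obj N D l''\<^esub> p = r'" by simp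
  have "dv = ?d l' (?\<delta> l (u \<oplus>\<^bsub>cube_obj N D l\<^esub> ?G l' v))"
    unfolding dv_def using v_eq by (rule arg_cong)
  also have "\<dots> = \<ominus>\<^bsub>cube_obj N D l''\<^esub> ?\<delta> l' (?d l (u \<oplus>\<^bsub>cube_obj N D l\<^esub> ?G l' v))"
    using uGv l' by (rule diff_edge_sum)
  also have "\<dots> = \<ominus>\<^bsub>cube_obj N D l''\<^esub> (a \<oplus>\<^bsub>cube_obj N D l''\<^esub> b)"
    unfolding mod_hom_add[OF d0 u Gv] mod_hom_add[OF e1 du dGv] a_def b_def ..
  finally have DV: "dv = \<ominus>\<^bsub>cube_obj N D l''\<^esub> (a \<oplus>\<^bsub>cube_obj N D l''\<^esub> b)" .
  define e where "e = dv \<oplus>\<^bsub>cube_obj N D l''\<^esub> (w1 \<oplus>\<^bsub>cube_obj N D l''\<^esub> w2)"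
  have ec: "e \<in> carrier (cube_obj N D l'')" unfolding e_def using dv w1 w2 by simp
  \<comment> \<open>With \<open>r' = b + p\<close> the sum \<open>w1 + w2\<close> contains
    \<open>a + b\<close>, which is minus \<open>dv\<close>; what remains are the three parts of
    \<open>\<delta> G e\<close>.\<close>
  have "e = p \<oplus>\<^bsub>cube_obj N D l''\<^esub> (q1 \<oplus>\<^bsub>cube_obj N D l''\<^esub> q2)"
  proof -
    have "w1 \<oplus>\<^bsub>cube_obj N D l''\<^esub> w2 = (a \<oplus>\<^bsub>cube_obj N D l''\<^esub> b) \<oplus>\<^bsub>cube_obj N D l''\<^esub>
        (p \<oplus>\<^bsub>cube_obj N D l''\<^esub> (q1 \<oplus>\<^bsub>cube_obj N D l''\<^esub> q2))"
      unfolding W1 W2 bp[symmetric] using c bc by (simp add: P2.M.a_ac)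
    then show ?thesis unfolding e_def DV using c bc by (simp add: P2.M.r_neg1)
  qed
  also have "\<dots> = ?\<delta> l' (?G l'' e)"
    unfolding p_def q1_def q2_def e_def using dv w1 w2
    by (simp add: mod_hom_add[OF G2] mod_hom_add[OF e1] mod_hom_closed[OF G2])
  finally have "e = \<zero>\<^bsub>cube_obj N D l''\<^esub>"
    using l' by (intro edge_sum_G_fixpoint[OF ec, of l']) auto
  then show ?thesis by (simp add: e_def dv_def w1_def w2_def)
qed

end

section \<open>The totalisation of a derived cube\<close>

text \<open>Homomorphisms are constrained only on carriers. The maps of \<open>Tot\<close> and
  \<open>diag_map\<close> agree with their simplified forms only there, and inherit the homomorphism
  property in this way.\<close>

lemma mod_hom_cong:
  assumes M: "left_module R M" and f: "f \<in> mod_hom R M N" and eq: "\<And>x. x \<in> carrier M \<Longrightarrow> g x = f x"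
  shows "g \<in> mod_hom R M N"
proof -
  interpret M: left_module R M by fact
  show ?thesis
    using f eq by (intro mod_homI) (auto simp: mod_hom_closed mod_hom_add mod_hom_smult)
qed

lemma plain_diag_signed_diag:
  assumes C: "cube_base R C N" and D: "cube_base R D N" and f: "cochain_map R C D f"
    and x: "x \<in> carrier (cube_obj N C l)"
  shows "signed_diag N D 1 (diff D) l (plain_diag N f l x) =
    plain_diag N f (l + 1) (signed_diag N C 1 (diff C) l x)"
proof -
  interpret C: cube_base R C N by fact
  interpret D: cube_base R D N by fact
  show ?thesis
    unfolding signed_diag_def plain_diag_def
  proof (rule restrict_ext)
    fix A assume A: "A \<in> Pow N"
    define k where "k = l - int (card A)"
    have k': "l + 1 - int (card A) = k + 1" by (simp add: k_def)
    have xA: "x A \<in> carrier (obj C k)" using A by (intro C.cube_obj_closed[OF x]) (auto simp: k_def)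
    have d: "diff C k (x A) \<in> carrier (obj C (k + 1))"
      by (rule mod_hom_closed[OF C.diff_hom xA]) simp
    have h: "f (k + 1) \<in> mod_hom R (obj C (k + 1)) (obj D (k + 1))"
      using f by (simp add: cochain_map_def graded_map_def)
    have "f (k + 1) (diff C k (x A)) = diff D k (f k (x A))" using f xA by (simp add: cochain_map_def)
    then show "[((-1) ^ card A :: int)] \<cdot>\<^bsub>obj D (l + 1 - int (card A))\<^esub> diff D (l - int (card A))
        ((\<lambda>A\<in>Pow N. f (l - int (card A)) (x A)) A) =
      f (l + 1 - int (card A)) ((\<lambda>A\<in>Pow N. [((-1) ^ card A :: int)] \<cdot>\<^bsub>obj C (l + 1 - int (card A))\<^esub>
        diff C (l - int (card A)) (x A)) A)"
      using A mod_hom_int_mult[OF C.lm D.lm h d] by (simp add: k_def[symmetric] k')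
  qed
qed

lemma (in cube_base) signed_diff_diff:
  assumes x: "x \<in> carrier (cube_obj N D l)" and l': "l' = l + 1" "l'' = l + 2"
  shows "signed_diag N D 1 (diff D) l' (signed_diag N D 1 (diff D) l x) = \<zero>\<^bsub>cube_obj N D l''\<^esub>"
proof -
  show ?thesis
    unfolding signed_diag_def cube_obj_def zero_prod_module
  proof (rule restrict_ext)
    fix A assume A: "A \<in> Pow N"
    define k where "k = l - int (card A)"
    have k': "l' - int (card A) = k + 1" "l + 1 - int (card A) = k + 1"
      "l' + 1 - int (card A) = k + 2" "l'' - int (card A) = k + 2" using l' by (simp_all add: k_def)
    interpret M: left_module R "obj D (k + 2)" by (rule lm)
    have xA: "x A \<in> carrier (obj D k)" using A by (intro cube_obj_closed[OF x]) (auto simp: k_def)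
    have d: "diff D k (x A) \<in> carrier (obj D (k + 1))" by (rule mod_hom_closed[OF diff_hom xA]) simp
    have h: "diff D (k + 1) \<in> mod_hom R (obj D (k + 1)) (obj D (k + 2))" by (rule diff_hom) simp
    have "diff D (k + 1) (diff D k (x A)) = \<zero>\<^bsub>obj D (k + 2)\<^esub>" by (rule diff_diff[OF xA]) auto
    then show "[((-1) ^ card A :: int)] \<cdot>\<^bsub>obj D (l' + 1 - int (card A))\<^esub> diff D (l' - int (card A))
        ((\<lambda>A\<in>Pow N. [((-1) ^ card A :: int)] \<cdot>\<^bsub>obj D (l + 1 - int (card A))\<^esub>
          diff D (l - int (card A)) (x A)) A) = \<zero>\<^bsub>obj D (l'' - int (card A))\<^esub>"
      using A mod_hom_int_mult[OF lm lm h d] by (simp add: k_def[symmetric] k')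
  qed
qed

locale derived_cube = cube_words R D N h G "\<lambda>k x. \<alpha> k (\<beta> k x)" + C: cube_base R C N
  for R :: "('r, 'k) ring_scheme" and C :: "('r, 'c) cochain" and D :: "('r, 'm) cochain"
    and N :: "nat set" and h :: "nat \<Rightarrow> int \<Rightarrow> 'm \<Rightarrow> 'm" and G :: "int \<Rightarrow> 'm \<Rightarrow> 'm"
    and \<alpha> :: "int \<Rightarrow> 'c \<Rightarrow> 'm" and \<beta> :: "int \<Rightarrow> 'm \<Rightarrow> 'c" +
  assumes amap: "cochain_map R C D \<alpha>" and bmap: "cochain_map R D C \<beta>"
begin

lemma a_hom: "\<alpha> k \<in> mod_hom R (obj C k) (obj D k)"
  using amap by (simp add: cochain_map_def graded_map_def)

lemma b_hom: "\<beta> k \<in> mod_hom R (obj D k) (obj C k)"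
  using bmap by (simp add: cochain_map_def graded_map_def)

lemma a_diag_hom: "plain_diag N \<alpha> l \<in> mod_hom R (cube_obj N C l) (cube_obj N D l)"
  using amap by (intro plain_diag_hom) (simp add: cochain_map_def)

lemma b_diag_hom: "plain_diag N \<beta> l \<in> mod_hom R (cube_obj N D l) (cube_obj N C l)"
  using bmap by (intro plain_diag_hom) (simp add: cochain_map_def)

lemma C_diff_graded: "graded_map R C C 1 (diff C)"
  using C.cx by (simp add: cochain_complex_def)

text \<open>The form \<open>d + \<beta> \<Delta> \<alpha>\<close> of the totalised differential,
  free of matrix entries and of the cases in \<open>cube_map\<close>; \<open>Tot_diff\<close>
  identifies the two.\<close>

definition tot_diff :: "int \<Rightarrow> (nat set \<Rightarrow> 'c) \<Rightarrow> nat set \<Rightarrow> 'c" where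
  "tot_diff l x = signed_diag N C 1 (diff C) l x \<oplus>\<^bsub>cube_obj N C (l + 1)\<^esub>
     plain_diag N \<beta> (l + 1) (cube_sum N D h G l (plain_diag N \<alpha> l x))"

lemma tot_diff_hom: "tot_diff l \<in> mod_hom R (cube_obj N C l) (cube_obj N C (l + 1))"
  unfolding tot_diff_def[abs_def]
  by (intro mod_hom_plus C.lm_cube C.signed_diag_hom[OF C_diff_graded] refl
      mod_hom_comp[OF mod_hom_comp[OF a_diag_hom cube_sum_hom[OF refl]] b_diag_hom])

text \<open>The diagonal maps \<open>\<alpha>\<close> and \<open>\<beta>\<close> commute with the
  signed differential, so the square of \<open>d + \<beta> \<Delta> \<alpha>\<close> at
  \<open>x\<close> is \<open>\<beta>\<close> applied to \<open>d \<Delta> u + \<Delta> d u +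
  \<Delta> \<alpha> \<beta> \<Delta> u\<close> with \<open>u = \<alpha> x\<close>, the sum treated
  in \<open>diff_cube_sum\<close>.\<close>

lemma tot_diff_tot_diff:
  assumes x: "x \<in> carrier (cube_obj N C l)"
  shows "tot_diff (l + 1) (tot_diff l x) = \<zero>\<^bsub>cube_obj N C (l + 2)\<^esub>"
proof -
  interpret P: left_module R "cube_obj N C (l + 2)" by (rule C.lm_cube)
  interpret PD: left_module R "cube_obj N D (l + 2)" by (rule lm_cube)
  have l: "l + 1 + 1 = l + 2" by simp
  let ?dC = "signed_diag N C 1 (diff C)" and ?d = "signed_diag N D 1 (diff D)"
  define u where "u = plain_diag N \<alpha> l x"
  define v where "v = cube_sum N D h G l u"
  have u: "u \<in> carrier (cube_obj N D l)" unfolding u_def by (rule mod_hom_closed[OF a_diag_hom x])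
  have v: "v \<in> carrier (cube_obj N D (l + 1))" unfolding v_def by (rule mod_hom_closed[OF cube_sum_hom[OF refl] u])
  have dx: "?dC l x \<in> carrier (cube_obj N C (l + 1))"
    by (rule mod_hom_closed[OF C.signed_diag_hom[OF C_diff_graded refl] x])
  have bv: "plain_diag N \<beta> (l + 1) v \<in> carrier (cube_obj N C (l + 1))"
    by (rule mod_hom_closed[OF b_diag_hom v])
  have d1: "?dC (l + 1) \<in> mod_hom R (cube_obj N C (l + 1)) (cube_obj N C (l + 2))"
    by (rule C.signed_diag_hom[OF C_diff_graded]) simp
  have D1: "cube_sum N D h G (l + 1) \<in> mod_hom R (cube_obj N D (l + 1)) (cube_obj N D (l + 2))"
    by (rule cube_sum_hom) simp
  have du: "?d l u \<in> carrier (cube_obj N D (l + 1))"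
    by (rule mod_hom_closed[OF signed_diag_hom[OF diff_graded refl] u])
  define rv where "rv = plain_diag N (\<lambda>k x. \<alpha> k (\<beta> k x)) (l + 1) v"
  have rv_eq: "plain_diag N \<alpha> (l + 1) (plain_diag N \<beta> (l + 1) v) = rv"
    unfolding rv_def plain_diag_def by (rule restrict_ext) simp
  have rv: "rv \<in> carrier (cube_obj N D (l + 1))"
    unfolding rv_eq[symmetric] by (rule mod_hom_closed[OF a_diag_hom bv])
  have y: "tot_diff l x = ?dC l x \<oplus>\<^bsub>cube_obj N C (l + 1)\<^esub> plain_diag N \<beta> (l + 1) v"
    by (simp add: tot_diff_def v_def u_def)
  have dv: "?d (l + 1) v \<in> carrier (cube_obj N D (l + 2))"
    by (rule mod_hom_closed[OF signed_diag_hom[OF diff_graded] v]) simp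
  have w1: "cube_sum N D h G (l + 1) (?d l u) \<in> carrier (cube_obj N D (l + 2))"
    by (rule mod_hom_closed[OF D1 du])
  have w2: "cube_sum N D h G (l + 1) rv \<in> carrier (cube_obj N D (l + 2))"
    by (rule mod_hom_closed[OF D1 rv])
  have "?dC (l + 1) (tot_diff l x) = \<zero>\<^bsub>cube_obj N C (l + 2)\<^esub> \<oplus>\<^bsub>cube_obj N C (l + 2)\<^esub>
      plain_diag N \<beta> (l + 2) (?d (l + 1) v)"
    unfolding y mod_hom_add[OF d1 dx bv] C.signed_diff_diff[OF x refl refl]
      plain_diag_signed_diag[OF cube_base_axioms C.cube_base_axioms bmap v] l ..
  then have 1: "?dC (l + 1) (tot_diff l x) = plain_diag N \<beta> (l + 2) (?d (l + 1) v)"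
    using mod_hom_closed[OF b_diag_hom dv] by simp
  have "plain_diag N \<alpha> (l + 1) (tot_diff l x) = ?d l u \<oplus>\<^bsub>cube_obj N D (l + 1)\<^esub> rv"
    unfolding y mod_hom_add[OF a_diag_hom dx bv] rv_eq
      plain_diag_signed_diag[OF C.cube_base_axioms cube_base_axioms amap x, symmetric] u_def[symmetric] ..
  then have 2: "cube_sum N D h G (l + 1) (plain_diag N \<alpha> (l + 1) (tot_diff l x)) =
     cube_sum N D h G (l + 1) (?d l u) \<oplus>\<^bsub>cube_obj N D (l + 2)\<^esub> cube_sum N D h G (l + 1) rv"
    using mod_hom_add[OF D1 du rv] by simp
  have "tot_diff (l + 1) (tot_diff l x) = plain_diag N \<beta> (l + 2) (?d (l + 1) v) \<oplus>\<^bsub>cube_obj N C (l + 2)\<^esub>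
     plain_diag N \<beta> (l + 2) (cube_sum N D h G (l + 1) (?d l u) \<oplus>\<^bsub>cube_obj N D (l + 2)\<^esub> cube_sum N D h G (l + 1) rv)"
    unfolding tot_diff_def[of "l + 1"] 1 2 l ..
  also have "\<dots> = plain_diag N \<beta> (l + 2) (?d (l + 1) v \<oplus>\<^bsub>cube_obj N D (l + 2)\<^esub>
     (cube_sum N D h G (l + 1) (?d l u) \<oplus>\<^bsub>cube_obj N D (l + 2)\<^esub> cube_sum N D h G (l + 1) rv))"
    using dv w1 w2 by (intro mod_hom_add[OF b_diag_hom, symmetric]) auto
  also have "\<dots> = \<zero>\<^bsub>cube_obj N C (l + 2)\<^esub>"
    unfolding v_def rv_def diff_cube_sum[OF u refl refl] by (rule mod_hom_zero[OF lm_cube C.lm_cube b_diag_hom])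
  finally show ?thesis .
qed

text \<open>A singleton has only the identity permutation and its word is a single
  \<open>h j\<close>, so the edge maps are instances of the alternating sum.\<close>

lemma cube_map_Der:
  assumes S: "S \<subseteq> N" "S \<noteq> {}" and y: "y \<in> carrier (obj C k)" and k': "k' = k + 1 - int (card S)"
  shows "cube_map (Der C D \<alpha> \<beta> G h) S k y = \<beta> k' (word_sum D h G S k (\<alpha> k y))"
proof -
  have fS: "finite S" using S by (intro finite_vertex)
  then have c0: "card S \<noteq> 0" using S by simp
  show ?thesis
  proof (cases "card S = 1")
    case True
    then obtain j where j: "S = {j}" by (metis card_1_singletonE)
    interpret M: left_module R "obj D k" by (rule lm)
    have "{\<sigma>. \<sigma> permutes {j}} = {id}" by auto
    moreover have "h j k (\<alpha> k y) \<in> carrier (obj D k)"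
      using S j by (intro mod_hom_closed[OF h_hom] mod_hom_closed[OF a_hom y]) auto
    ultimately have "word_sum D h G {j} k (\<alpha> k y) = h j k (\<alpha> k y)"
      by (simp add: word_sum_def Let_def M.M.finsum_insert[of "{}" id, simplified])
    then show ?thesis using j k' by (simp add: cube_map_def Der_def)
  next
    case False
    then show ?thesis using c0 S k' by (simp add: cube_map_def Der_def word_sum_def Let_def)
  qed
qed

lemma Tot_obj: "obj (Tot N (Der C D \<alpha> \<beta> G h)) l = cube_obj N C l"
  by (simp add: Tot_def cube_obj_def Der_def)

text \<open>In each row the diagonal entry gives the signed differential, the entries with
  \<open>A\<close> strictly inside \<open>B\<close> give \<open>\<beta> \<Delta> \<alpha>\<close>
  after \<open>\<beta>\<close> is pulled out of the sum, and the others are zero.\<close>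

lemma Tot_diff:
  assumes x: "x \<in> carrier (cube_obj N C l)"
  shows "diff (Tot N (Der C D \<alpha> \<beta> G h)) l x = tot_diff l x"
proof (rule C.cube_obj_eqI[of _ "l + 1"])
  let ?Q = "Der C D \<alpha> \<beta> G h"
  have Q: "diff (Tot N ?Q) l x = (\<lambda>B\<in>Pow N. \<Oplus>\<^bsub>obj C (l + 1 - int (card B))\<^esub>A\<in>Pow N. Tot_entry ?Q l B A (x A))"
    by (simp add: Tot_def Der_def matrix_map_def)
  show tc: "tot_diff l x \<in> carrier (cube_obj N C (l + 1))" by (rule mod_hom_closed[OF tot_diff_hom x])
  have main: "diff (Tot N ?Q) l x B = tot_diff l x B" if B: "B \<subseteq> N" for B
  proof -
    define k where "k = l + 1 - int (card B)"
    interpret M: left_module R "obj C k" by (rule C.lm)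
    interpret M': left_module R "obj D k" by (rule lm)
    have fB: "finite B" using B by (rule finite_vertex)
    have cA: "int (card (B - A)) = int (card B) - int (card A)" if "A \<subseteq> B" for A
      using that fB by (simp add: card_Diff_subset finite_subset card_mono of_nat_diff)
    have xA: "x A \<in> carrier (obj C (l - int (card A)))" if "A \<subseteq> N" for A
      using that by (intro C.cube_obj_closed[OF x]) auto
    define w where "w A = word_sum D h G (B - A) (l - int (card A)) (\<alpha> (l - int (card A)) (x A))" for A
    have w: "w A \<in> carrier (obj D k)" if "A \<subseteq> B" for A
    proof -
      have "k = l - int (card A) + 1 - int (card (B - A))" using cA[OF that] by (simp add: k_def)
      then show ?thesis unfolding w_def using that B
        by (intro mod_hom_closed[OF word_sum_hom] mod_hom_closed[OF a_hom xA]) auto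
    qed
    define a where "a = [((-1) ^ card B :: int)] \<cdot>\<^bsub>obj C k\<^esub> diff C (l - int (card B)) (x B)"
    have a: "a \<in> carrier (obj C k)" unfolding a_def using B
      by (intro M.M.add.int_pow_closed mod_hom_closed[OF C.diff_hom xA]) (auto simp: k_def)
    define b where "b A = (if A \<subseteq> B then [tot_sign B A] \<cdot>\<^bsub>obj C k\<^esub> \<beta> k (w A) else \<zero>\<^bsub>obj C k\<^esub>)" for A
    have bc: "b A \<in> carrier (obj C k)" for A
      unfolding b_def using w[of A] by (auto intro!: mod_hom_closed[OF b_hom])
    have "diff (Tot N ?Q) l x B = (\<Oplus>\<^bsub>obj C k\<^esub>A\<in>Pow N. Tot_entry ?Q l B A (x A))"
      unfolding Q using B by (simp add: k_def)
    \<comment> \<open>The two summands never overlap: \<open>b B\<close> is zero because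
      \<open>word_sum\<close> vanishes on the empty set.\<close>
    also have "\<dots> = (\<Oplus>\<^bsub>obj C k\<^esub>A\<in>Pow N. (if B = A then a else \<zero>\<^bsub>obj C k\<^esub>) \<oplus>\<^bsub>obj C k\<^esub> b A)"
    proof (rule M.M.finsum_cong')
      fix A assume A: "A \<in> Pow N"
      have base: "base ?Q = C" by (simp add: Der_def)
      show "Tot_entry ?Q l B A (x A) = (if B = A then a else \<zero>\<^bsub>obj C k\<^esub>) \<oplus>\<^bsub>obj C k\<^esub> b A"
      proof (cases "A \<subseteq> B")
        case False
        then have "Tot_entry ?Q l B A (x A) = \<zero>\<^bsub>obj C k\<^esub>"
          by (simp add: Tot_entry_def Let_def base k_def)
        then show ?thesis using False by (auto simp: b_def)
      next
        case True
        have T: "Tot_entry ?Q l B A (x A) =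
          [tot_sign B A] \<cdot>\<^bsub>obj C k\<^esub> cube_map ?Q (B - A) (l - int (card A)) (x A)"
          using True by (simp add: Tot_entry_def Let_def base k_def tot_sign_def)
        show ?thesis
        proof (cases "A = B")
          case True
          have "w B = \<zero>\<^bsub>obj D k\<^esub>" by (simp add: w_def word_sum_def k_def algebra_simps)
          then have "b B = \<zero>\<^bsub>obj C k\<^esub>"
            unfolding b_def using mod_hom_zero[OF lm C.lm b_hom] by simp
          moreover have "Tot_entry ?Q l B B (x B) = a"
            using T fB unfolding True by (simp add: a_def tot_sign_self cube_map_def base)
          ultimately show ?thesis using True a by simp
        next
          case False
          have "k = l - int (card A) + 1 - int (card (B - A))" using cA[OF True] by (simp add: k_def)
          then have "cube_map ?Q (B - A) (l - int (card A)) (x A) = \<beta> k (w A)"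
            unfolding w_def using False True A B by (intro cube_map_Der xA) auto
          then show ?thesis using T False True bc[of A] by (auto simp: b_def)
        qed
      qed
    qed (use a bc in auto)
    also have "\<dots> = (\<Oplus>\<^bsub>obj C k\<^esub>A\<in>Pow N. if B = A then a else \<zero>\<^bsub>obj C k\<^esub>) \<oplus>\<^bsub>obj C k\<^esub>
        (\<Oplus>\<^bsub>obj C k\<^esub>A\<in>Pow N. b A)"
      using a bc by (intro M.M.finsum_addf) auto
    also have "(\<Oplus>\<^bsub>obj C k\<^esub>A\<in>Pow N. if B = A then a else \<zero>\<^bsub>obj C k\<^esub>) = a"
      using B fin a by (intro M.M.add.finprod_singleton[of B "Pow N" "\<lambda>_. a"]) auto
    also have "(\<Oplus>\<^bsub>obj C k\<^esub>A\<in>Pow N. b A) = (\<Oplus>\<^bsub>obj C k\<^esub>A\<in>Pow B. \<beta> k ([tot_sign B A] \<cdot>\<^bsub>obj D k\<^esub> w A))"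
    proof (rule M.M.add.finprod_mono_neutral_cong_right)
      fix A assume "A \<in> Pow B"
      then show "b A = \<beta> k ([tot_sign B A] \<cdot>\<^bsub>obj D k\<^esub> w A)"
        using w by (simp add: b_def mod_hom_int_mult[OF lm C.lm b_hom])
    qed (use fin B bc in \<open>auto simp: b_def\<close>)
    also have "\<dots> = \<beta> k (\<Oplus>\<^bsub>obj D k\<^esub>A\<in>Pow B. [tot_sign B A] \<cdot>\<^bsub>obj D k\<^esub> w A)"
      using fB w by (intro mod_hom_finsum[OF lm C.lm b_hom, symmetric]) auto
    also have "(\<Oplus>\<^bsub>obj D k\<^esub>A\<in>Pow B. [tot_sign B A] \<cdot>\<^bsub>obj D k\<^esub> w A) =
        cube_sum N D h G l (plain_diag N \<alpha> l x) B"
    proof -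
      have "cube_sum N D h G l (plain_diag N \<alpha> l x) B = (\<Oplus>\<^bsub>obj D k\<^esub>A\<in>Pow B. [tot_sign B A] \<cdot>\<^bsub>obj D k\<^esub>
         word_sum D h G (B - A) (l - int (card A)) (plain_diag N \<alpha> l x A))"
        using B by (simp add: cube_sum_def k_def)
      also have "\<dots> = (\<Oplus>\<^bsub>obj D k\<^esub>A\<in>Pow B. [tot_sign B A] \<cdot>\<^bsub>obj D k\<^esub> w A)"
      proof (rule M'.M.finsum_cong')
        fix A assume "A \<in> Pow B"
        then have "plain_diag N \<alpha> l x A = \<alpha> (l - int (card A)) (x A)"
          using B by (auto simp: plain_diag_def)
        then show "[tot_sign B A] \<cdot>\<^bsub>obj D k\<^esub>
            word_sum D h G (B - A) (l - int (card A)) (plain_diag N \<alpha> l x A) = [tot_sign B A] \<cdot>\<^bsub>obj D k\<^esub> w A"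
          by (simp add: w_def)
      qed (use w in auto)
      finally show ?thesis ..
    qed
    also have "a \<oplus>\<^bsub>obj C k\<^esub> \<beta> k (cube_sum N D h G l (plain_diag N \<alpha> l x) B) = tot_diff l x B"
    proof -
      have "tot_diff l x B = signed_diag N C 1 (diff C) l x B \<oplus>\<^bsub>obj C k\<^esub>
        plain_diag N \<beta> (l + 1) (cube_sum N D h G l (plain_diag N \<alpha> l x)) B"
        unfolding tot_diff_def using B by (intro C.cube_obj_add) (auto simp: k_def)
      then show ?thesis using B by (simp add: signed_diag_def plain_diag_def a_def k_def)
    qed
    finally show ?thesis .
  qed
  then show "\<And>B. B \<subseteq> N \<Longrightarrow> diff (Tot N ?Q) l x B = tot_diff l x B" .
  have "diff (Tot N ?Q) l x B \<in> carrier (obj C (l + 1 - int (card B)))" if "B \<subseteq> N" for B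
    unfolding main[OF that] using that by (intro C.cube_obj_closed[OF tc]) auto
  then show "diff (Tot N ?Q) l x \<in> carrier (cube_obj N C (l + 1))"
    by (auto simp: cube_obj_def Q)
qed

lemma Tot_cochain_complex: "cochain_complex R (Tot N (Der C D \<alpha> \<beta> G h))"
proof -
  have hom: "diff (Tot N (Der C D \<alpha> \<beta> G h)) l \<in> mod_hom R (cube_obj N C l) (cube_obj N C (l + 1))" for l
    by (rule mod_hom_cong[OF C.lm_cube tot_diff_hom Tot_diff])
  show ?thesis
    unfolding cochain_complex_def graded_map_def Tot_obj
    using C.lm_cube hom tot_diff_tot_diff mod_hom_closed[OF tot_diff_hom] by (simp add: Tot_diff)
qed

lemma diag_map_eq:
  assumes x: "x \<in> carrier (cube_obj N D l)"
  shows "diag_map N (Der C D \<alpha> \<beta> G h) \<beta> l x = plain_diag N \<beta> l x"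
  unfolding diag_map_def matrix_map_def plain_diag_def
proof (rule restrict_ext)
  fix B assume B: "B \<in> Pow N"
  define k where "k = l - int (card B)"
  interpret M: left_module R "obj C k" by (rule C.lm)
  have b: "\<beta> k (x B) \<in> carrier (obj C k)"
    using B by (intro mod_hom_closed[OF b_hom] cube_obj_closed[OF x]) (auto simp: k_def)
  have "(\<Oplus>\<^bsub>obj C k\<^esub>A\<in>Pow N. if A = B then \<beta> (l - int (card A)) (x A) else \<zero>\<^bsub>obj C k\<^esub>) =
    (\<Oplus>\<^bsub>obj C k\<^esub>A\<in>Pow N. if B = A then \<beta> k (x B) else \<zero>\<^bsub>obj C k\<^esub>)"
    using b by (intro M.M.finsum_cong') (auto simp: k_def[symmetric])
  also have "\<dots> = \<beta> k (x B)"
    using B fin b by (intro M.M.add.finprod_singleton[of B "Pow N" "\<lambda>_. \<beta> k (x B)"]) auto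
  finally have eq: "(\<Oplus>\<^bsub>obj C k\<^esub>A\<in>Pow N. if A = B then \<beta> (l - int (card A)) (x A) else \<zero>\<^bsub>obj C k\<^esub>) =
    \<beta> k (x B)" .
  have base: "base (Der C D \<alpha> \<beta> G h) = C" by (simp add: Der_def)
  show "(\<Oplus>\<^bsub>obj (base (Der C D \<alpha> \<beta> G h)) (l - int (card B))\<^esub>A\<in>Pow N.
      if A = B then \<beta> (l - int (card A)) (x A) else \<zero>\<^bsub>obj (base (Der C D \<alpha> \<beta> G h)) (l - int (card B))\<^esub>) =
     \<beta> (l - int (card B)) (x B)"
    unfolding base using eq unfolding k_def .
qed

end

section \<open>Mapping cones and cohomology\<close>

text \<open>\<open>prod_module\<close> needs one element type for all factors, while a cone joins
  modules on two different types.\<close>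

definition pair_module :: "('r, 'a) module \<Rightarrow> ('r, 'b) module \<Rightarrow> ('r, 'a \<times> 'b) module" where
  "pair_module M N = \<lparr>carrier = carrier M \<times> carrier N, monoid.mult = undefined, one = undefined,
     zero = (\<zero>\<^bsub>M\<^esub>, \<zero>\<^bsub>N\<^esub>),
     add = (\<lambda>x y. (fst x \<oplus>\<^bsub>M\<^esub> fst y, snd x \<oplus>\<^bsub>N\<^esub> snd y)),
     smult = (\<lambda>r x. (r \<odot>\<^bsub>M\<^esub> fst x, r \<odot>\<^bsub>N\<^esub> snd x))\<rparr>"

lemma carrier_pair_module [simp]: "carrier (pair_module M N) = carrier M \<times> carrier N"
  and zero_pair_module [simp]: "\<zero>\<^bsub>pair_module M N\<^esub> = (\<zero>\<^bsub>M\<^esub>, \<zero>\<^bsub>N\<^esub>)"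
  and add_pair_module [simp]:
    "x \<oplus>\<^bsub>pair_module M N\<^esub> y = (fst x \<oplus>\<^bsub>M\<^esub> fst y, snd x \<oplus>\<^bsub>N\<^esub> snd y)"
  and smult_pair_module [simp]:
    "r \<odot>\<^bsub>pair_module M N\<^esub> x = (r \<odot>\<^bsub>M\<^esub> fst x, r \<odot>\<^bsub>N\<^esub> snd x)"
  by (simp_all add: pair_module_def)

lemma left_module_pair_module:
  assumes "left_module R M" "left_module R N"
  shows "left_module R (pair_module M N)"
proof -
  interpret M: left_module R M by fact
  interpret N: left_module R N by fact
  show ?thesis
  proof (intro left_module.intro left_module_axioms.intro M.R.ring_axioms)
    show "abelian_group (pair_module M N)"
    proof (rule abelian_groupI)
      fix x assume x: "x \<in> carrier (pair_module M N)"
      show "\<exists>y\<in>carrier (pair_module M N). y \<oplus>\<^bsub>pair_module M N\<^esub> x = \<zero>\<^bsub>pair_module M N\<^esub>"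
        using x by (intro bexI[of _ "(\<ominus>\<^bsub>M\<^esub> fst x, \<ominus>\<^bsub>N\<^esub> snd x)"]) (auto simp: M.M.l_neg N.M.l_neg)
    qed (auto simp: M.M.a_ac N.M.a_ac)
  qed (auto simp: M.smult_l_distr N.smult_l_distr M.smult_r_distr N.smult_r_distr
      M.smult_assoc1 N.smult_assoc1)
qed

lemma mod_hom_fst: "fst \<in> mod_hom R (pair_module M N) M"
  and mod_hom_snd: "snd \<in> mod_hom R (pair_module M N) N"
  by (auto simp: mod_hom_def)

lemma mod_hom_pair:
  "f \<in> mod_hom R M N \<Longrightarrow> g \<in> mod_hom R M P \<Longrightarrow> (\<lambda>x. (f x, g x)) \<in> mod_hom R M (pair_module N P)"
  by (auto simp: mod_hom_def)

lemma mod_hom_inl: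
  assumes "left_module R M" "left_module R N"
  shows "(\<lambda>x. (x, \<zero>\<^bsub>N\<^esub>)) \<in> mod_hom R M (pair_module M N)"
  using assms by (intro mod_hom_pair mod_hom_id mod_hom_zero_map)

lemma mod_hom_inr:
  assumes "left_module R M" "left_module R N"
  shows "(\<lambda>x. (\<zero>\<^bsub>M\<^esub>, x)) \<in> mod_hom R N (pair_module M N)"
  using assms by (intro mod_hom_pair mod_hom_id mod_hom_zero_map)

lemma minus_pair_module:
  assumes "left_module R M" "left_module R N"
    "x \<in> carrier (pair_module M N)" "y \<in> carrier (pair_module M N)"
  shows "x \<ominus>\<^bsub>pair_module M N\<^esub> y = (fst x \<ominus>\<^bsub>M\<^esub> fst y, snd x \<ominus>\<^bsub>N\<^esub> snd y)"
  using mod_hom_minus[OF left_module_pair_module[OF assms(1,2)] assms(1) mod_hom_fst assms(3,4)]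
    mod_hom_minus[OF left_module_pair_module[OF assms(1,2)] assms(2) mod_hom_snd assms(3,4)]
  by (simp add: prod_eq_iff)

lemma cochain_complexD:
  assumes "cochain_complex R C"
  shows "left_module R (obj C k)" "k' = k + 1 \<Longrightarrow> diff C k \<in> mod_hom R (obj C k) (obj C k')"
    "\<lbrakk>x \<in> carrier (obj C k); k' = k + 1; k'' = k + 2\<rbrakk> \<Longrightarrow> diff C k' (diff C k x) = \<zero>\<^bsub>obj C k''\<^esub>"
  using assms by (auto simp: cochain_complex_def graded_map_def)

lemma cochain_mapD:
  assumes "cochain_map R C D f"
  shows "cochain_complex R C" "cochain_complex R D" "f k \<in> mod_hom R (obj C k) (obj D k)"
    "\<lbrakk>x \<in> carrier (obj C k); k' = k + 1\<rbrakk> \<Longrightarrow> f k' (diff C k x) = diff D k (f k x)"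
  using assms by (auto simp: cochain_map_def graded_map_def)

lemma cochain_map_comp:
  assumes f: "cochain_map R C D f" and g: "cochain_map R D E g"
  shows "cochain_map R C E (\<lambda>k x. g k (f k x))"
  unfolding cochain_map_def graded_map_def
proof (intro conjI allI ballI cochain_mapD(1)[OF f] cochain_mapD(2)[OF g])
  fix k
  show "(\<lambda>x. g k (f k x)) \<in> mod_hom R (obj C k) (obj E (k + 0))"
    using mod_hom_comp[OF cochain_mapD(3)[OF f] cochain_mapD(3)[OF g]] by simp
  fix x assume x: "x \<in> carrier (obj C k)"
  show "g (k + 1) (f (k + 1) (diff C k x)) = diff E k (g k (f k x))"
    unfolding cochain_mapD(4)[OF f x refl]
    by (rule cochain_mapD(4)[OF g mod_hom_closed[OF cochain_mapD(3)[OF f] x] refl])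
qed

section \<open>The mapping cone of a cochain map\<close>

text \<open>A shifted mapping cone: \<open>C\<close> keeps its degrees and \<open>D\<close> is moved
  up by one. A cocycle is a cocycle \<open>x\<close> of \<open>C\<close> together with an element
  \<open>y\<close> of \<open>D\<close> that bounds its image.\<close>

definition cone ::
  "('r, 'a) cochain \<Rightarrow> ('r, 'b) cochain \<Rightarrow> (int \<Rightarrow> 'a \<Rightarrow> 'b) \<Rightarrow> ('r, 'a \<times> 'b) cochain" where
  "cone C D f = \<lparr>obj = (\<lambda>k. pair_module (obj C k) (obj D (k - 1))),
     diff = (\<lambda>k z. (diff C k (fst z), f k (fst z) \<ominus>\<^bsub>obj D k\<^esub> diff D (k - 1) (snd z)))\<rparr>"

definition acyclic_complex :: "('r, 'm) cochain \<Rightarrow> bool" where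
  "acyclic_complex C \<longleftrightarrow> (\<forall>k. cocycles C k \<subseteq> coboundaries C k)"

lemma obj_cone [simp]: "obj (cone C D f) k = pair_module (obj C k) (obj D (k - 1))"
  and diff_cone [simp]: "diff (cone C D f) k z =
    (diff C k (fst z), f k (fst z) \<ominus>\<^bsub>obj D k\<^esub> diff D (k - 1) (snd z))"
  by (simp_all add: cone_def)

lemma cochain_complex_cone:
  assumes f: "cochain_map R C D f"
  shows "cochain_complex R (cone C D f)"
proof -
  note C = cochain_complexD[OF cochain_mapD(1)[OF f]] and D = cochain_complexD[OF cochain_mapD(2)[OF f]]
  have hom: "diff (cone C D f) k \<in> mod_hom R (obj (cone C D f) k) (obj (cone C D f) (k + 1))" for k
  proof -
    have "(\<lambda>z. (diff C k (fst z), f k (fst z) \<ominus>\<^bsub>obj D k\<^esub> diff D (k - 1) (snd z)))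
      \<in> mod_hom R (pair_module (obj C k) (obj D (k - 1))) (pair_module (obj C (k + 1)) (obj D k))"
      by (intro mod_hom_pair mod_hom_diff D(1) mod_hom_comp[OF mod_hom_fst] mod_hom_comp[OF mod_hom_snd]
          C(2) D(2) cochain_mapD(3)[OF f]) auto
    then show ?thesis by (simp add: cone_def)
  qed
  have "diff (cone C D f) (k + 1) (diff (cone C D f) k z) = \<zero>\<^bsub>obj (cone C D f) (k + 2)\<^esub>"
    if z: "z \<in> carrier (obj (cone C D f) k)" for k z
  proof -
    obtain x y where xy: "z = (x, y)" "x \<in> carrier (obj C k)" "y \<in> carrier (obj D (k - 1))"
      using z by auto
    interpret Dk: left_module R "obj D (k + 1)" by (rule D(1))
    have d: "diff D k \<in> mod_hom R (obj D k) (obj D (k + 1))" by (rule D(2)) simp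
    have fx: "f k x \<in> carrier (obj D k)" by (rule mod_hom_closed[OF cochain_mapD(3)[OF f] xy(2)])
    have dy: "diff D (k - 1) y \<in> carrier (obj D k)" by (rule mod_hom_closed[OF D(2) xy(3)]) simp
    have dfx: "diff D k (f k x) \<in> carrier (obj D (k + 1))" by (rule mod_hom_closed[OF d fx])
    have "diff D k (diff D (k - 1) y) = \<zero>\<^bsub>obj D (k + 1)\<^esub>" by (rule D(3)[OF xy(3)]) auto
    then have "diff D k (f k x \<ominus>\<^bsub>obj D k\<^esub> diff D (k - 1) y) = diff D k (f k x)"
      using mod_hom_minus[OF D(1) D(1) d fx dy] dfx by (simp add: a_minus_def)
    moreover have "diff C (k + 1) (diff C k x) = \<zero>\<^bsub>obj C (k + 2)\<^esub>" by (rule C(3)[OF xy(2)]) auto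
    moreover have "f (k + 1) (diff C k x) = diff D k (f k x)" by (rule cochain_mapD(4)[OF f xy(2)]) simp
    moreover have "diff D k (f k x) \<ominus>\<^bsub>obj D (k + 1)\<^esub> diff D k (f k x) = \<zero>\<^bsub>obj D (k + 1)\<^esub>"
      using dfx by (simp add: a_minus_def Dk.M.r_neg)
    ultimately show ?thesis by (simp add: xy add.commute[of 1 k])
  qed
  moreover have "left_module R (obj (cone C D f) k)" for k
    by (simp add: left_module_pair_module C(1) D(1))
  ultimately show ?thesis
    using hom unfolding cochain_complex_def graded_map_def by blast
qed

section \<open>Cohomology as cosets of coboundaries\<close>

definition submodule_of :: "('r, 'k) ring_scheme \<Rightarrow> ('r, 'm) module \<Rightarrow> 'm set \<Rightarrow> bool" where
  "submodule_of R M B \<longleftrightarrow> B \<subseteq> carrier M \<and> \<zero>\<^bsub>M\<^esub> \<in> B \<and>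
     (\<forall>x\<in>B. \<forall>y\<in>B. x \<oplus>\<^bsub>M\<^esub> y \<in> B) \<and> (\<forall>x\<in>B. \<ominus>\<^bsub>M\<^esub> x \<in> B) \<and>
     (\<forall>r\<in>carrier R. \<forall>x\<in>B. r \<odot>\<^bsub>M\<^esub> x \<in> B)"

lemma submodule_coboundaries:
  assumes C: "cochain_complex R C"
  shows "submodule_of R (obj C k) (coboundaries C k)"
proof -
  have d: "diff C (k - 1) \<in> mod_hom R (obj C (k - 1)) (obj C k)" by (rule cochain_complexD(2)[OF C]) simp
  interpret M: left_module R "obj C (k - 1)" by (rule cochain_complexD(1)[OF C])
  show ?thesis
    unfolding submodule_of_def coboundaries_def
  proof (intro conjI ballI)
    show "diff C (k - 1) ` carrier (obj C (k - 1)) \<subseteq> carrier (obj C k)"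
      using mod_hom_closed[OF d] by auto
    show "\<zero>\<^bsub>obj C k\<^esub> \<in> diff C (k - 1) ` carrier (obj C (k - 1))"
      using mod_hom_zero[OF cochain_complexD(1)[OF C] cochain_complexD(1)[OF C] d]
      by (metis M.M.zero_closed image_eqI)
  next
    fix x y assume "x \<in> diff C (k - 1) ` carrier (obj C (k - 1))" "y \<in> diff C (k - 1) ` carrier (obj C (k - 1))"
    then obtain a b where "a \<in> carrier (obj C (k - 1))" "b \<in> carrier (obj C (k - 1))"
      "x = diff C (k - 1) a" "y = diff C (k - 1) b" by auto
    then show "x \<oplus>\<^bsub>obj C k\<^esub> y \<in> diff C (k - 1) ` carrier (obj C (k - 1))"
      by (intro image_eqI[of _ _ "a \<oplus>\<^bsub>obj C (k - 1)\<^esub> b"]) (auto simp: mod_hom_add[OF d])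
  next
    fix x assume "x \<in> diff C (k - 1) ` carrier (obj C (k - 1))"
    then obtain a where "a \<in> carrier (obj C (k - 1))" "x = diff C (k - 1) a" by auto
    then show "\<ominus>\<^bsub>obj C k\<^esub> x \<in> diff C (k - 1) ` carrier (obj C (k - 1))"
      using mod_hom_neg[OF cochain_complexD(1)[OF C] cochain_complexD(1)[OF C] d]
      by (intro image_eqI[of _ _ "\<ominus>\<^bsub>obj C (k - 1)\<^esub> a"]) auto
  next
    fix r x assume r: "r \<in> carrier R" "x \<in> diff C (k - 1) ` carrier (obj C (k - 1))"
    then obtain a where "a \<in> carrier (obj C (k - 1))" "x = diff C (k - 1) a" by auto
    then show "r \<odot>\<^bsub>obj C k\<^esub> x \<in> diff C (k - 1) ` carrier (obj C (k - 1))"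
      using r mod_hom_smult[OF d]
      by (intro image_eqI[of _ _ "r \<odot>\<^bsub>obj C (k - 1)\<^esub> a"]) auto
  qed
qed

lemma submodule_cocycles:
  assumes C: "cochain_complex R C"
  shows "submodule_of R (obj C k) (cocycles C k)"
proof -
  note lm = cochain_complexD(1)[OF C]
  have d: "diff C k \<in> mod_hom R (obj C k) (obj C (k + 1))" by (rule cochain_complexD(2)[OF C]) simp
  interpret M: left_module R "obj C k" by (rule lm)
  interpret M': left_module R "obj C (k + 1)" by (rule lm)
  show ?thesis
    unfolding submodule_of_def cocycles_def
    using mod_hom_zero[OF lm lm d] mod_hom_neg[OF lm lm d] mod_hom_add[OF d] mod_hom_smult[OF d]
    by (auto simp: M'.smult_zero)
qed

lemma coboundaries_subset_cocycles:
  assumes C: "cochain_complex R C"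
  shows "coboundaries C k \<subseteq> cocycles C k"
proof
  fix x assume "x \<in> coboundaries C k"
  then obtain a where a: "a \<in> carrier (obj C (k - 1))" "x = diff C (k - 1) a"
    by (auto simp: coboundaries_def)
  have "diff C k (diff C (k - 1) a) = \<zero>\<^bsub>obj C (k + 1)\<^esub>" by (rule cochain_complexD(3)[OF C a(1)]) auto
  moreover have "x \<in> carrier (obj C k)"
    unfolding a(2) by (rule mod_hom_closed[OF cochain_complexD(2)[OF C] a(1)]) simp
  ultimately show "x \<in> cocycles C k" using a(2) by (simp add: cocycles_def)
qed

lemma a_r_coset_image: "B +>\<^bsub>M\<^esub> x = (\<lambda>b. b \<oplus>\<^bsub>M\<^esub> x) ` B"
  by (auto simp: a_r_coset_def r_coset_def)

context left_module
begin

lemma coset_eq_iff: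
  assumes B: "submodule_of R M B" and xy: "x \<in> carrier M" "y \<in> carrier M"
  shows "B +>\<^bsub>M\<^esub> x = B +>\<^bsub>M\<^esub> y \<longleftrightarrow> x \<ominus>\<^bsub>M\<^esub> y \<in> B"
proof
  have c: "b \<in> carrier M" if "b \<in> B" for b using B that by (auto simp: submodule_of_def)
  {
    assume "B +>\<^bsub>M\<^esub> x = B +>\<^bsub>M\<^esub> y"
    moreover have "\<zero>\<^bsub>M\<^esub> \<oplus>\<^bsub>M\<^esub> x \<in> B +>\<^bsub>M\<^esub> x"
      unfolding a_r_coset_image using B by (auto simp: submodule_of_def)
    ultimately obtain b where b: "b \<in> B" "x = b \<oplus>\<^bsub>M\<^esub> y"
      using xy by (auto simp: a_r_coset_image)
    then have "x \<ominus>\<^bsub>M\<^esub> y = b" using xy c by (simp add: a_minus_def M.a_assoc M.r_neg)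
    then show "x \<ominus>\<^bsub>M\<^esub> y \<in> B" using b by simp
  }
  assume d: "x \<ominus>\<^bsub>M\<^esub> y \<in> B"
  define e where "e = x \<ominus>\<^bsub>M\<^esub> y"
  have e: "e \<in> B" "e \<in> carrier M" "\<ominus>\<^bsub>M\<^esub> e \<in> B"
    using d B xy by (auto simp: e_def submodule_of_def)
  have x: "x = e \<oplus>\<^bsub>M\<^esub> y" using xy by (simp add: e_def a_minus_def M.a_assoc M.l_neg)
  show "B +>\<^bsub>M\<^esub> x = B +>\<^bsub>M\<^esub> y"
  proof
    show "B +>\<^bsub>M\<^esub> x \<subseteq> B +>\<^bsub>M\<^esub> y"
    proof
      fix z assume "z \<in> B +>\<^bsub>M\<^esub> x"
      then obtain b where b: "b \<in> B" "z = b \<oplus>\<^bsub>M\<^esub> x" by (auto simp: a_r_coset_image)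
      have "z = (b \<oplus>\<^bsub>M\<^esub> e) \<oplus>\<^bsub>M\<^esub> y" using b e c xy unfolding x by (simp add: M.a_assoc)
      moreover have "b \<oplus>\<^bsub>M\<^esub> e \<in> B" using b e B by (auto simp: submodule_of_def)
      ultimately show "z \<in> B +>\<^bsub>M\<^esub> y" by (auto simp: a_r_coset_image)
    qed
    show "B +>\<^bsub>M\<^esub> y \<subseteq> B +>\<^bsub>M\<^esub> x"
    proof
      fix z assume "z \<in> B +>\<^bsub>M\<^esub> y"
      then obtain b where b: "b \<in> B" "z = b \<oplus>\<^bsub>M\<^esub> y" by (auto simp: a_r_coset_image)
      have "z = (b \<oplus>\<^bsub>M\<^esub> \<ominus>\<^bsub>M\<^esub> e) \<oplus>\<^bsub>M\<^esub> x" using b e c xy unfolding x by (simp add: M.a_assoc M.r_neg1)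
      moreover have "b \<oplus>\<^bsub>M\<^esub> \<ominus>\<^bsub>M\<^esub> e \<in> B" using b e B by (auto simp: submodule_of_def)
      ultimately show "z \<in> B +>\<^bsub>M\<^esub> x" by (auto simp: a_r_coset_image)
    qed
  qed
qed

lemma coset_shift:
  assumes B: "submodule_of R M B" and "b \<in> B" "x \<in> carrier M"
  shows "B +>\<^bsub>M\<^esub> (b \<oplus>\<^bsub>M\<^esub> x) = B +>\<^bsub>M\<^esub> x"
proof -
  have "b \<in> carrier M" using assms by (auto simp: submodule_of_def)
  then show ?thesis using assms
    by (subst coset_eq_iff[OF B]) (auto simp: a_minus_def M.a_assoc M.r_neg)
qed

lemma coset_add:
  assumes B: "submodule_of R M B" and "x \<in> carrier M" "y \<in> carrier M"
  shows "(B +>\<^bsub>M\<^esub> x) <+>\<^bsub>M\<^esub> (B +>\<^bsub>M\<^esub> y) = B +>\<^bsub>M\<^esub> (x \<oplus>\<^bsub>M\<^esub> y)"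
proof -
  have c: "b \<in> carrier M" if "b \<in> B" for b using B that by (auto simp: submodule_of_def)
  have re: "(b \<oplus>\<^bsub>M\<^esub> x) \<oplus>\<^bsub>M\<^esub> (b' \<oplus>\<^bsub>M\<^esub> y) = (b \<oplus>\<^bsub>M\<^esub> b') \<oplus>\<^bsub>M\<^esub> (x \<oplus>\<^bsub>M\<^esub> y)"
    if "b \<in> B" "b' \<in> B" for b b' using c that assms by (simp add: M.a_ac)
  show ?thesis
  proof
    show "(B +>\<^bsub>M\<^esub> x) <+>\<^bsub>M\<^esub> (B +>\<^bsub>M\<^esub> y) \<subseteq> B +>\<^bsub>M\<^esub> (x \<oplus>\<^bsub>M\<^esub> y)"
      using B re by (auto simp: set_add_def set_mult_def a_r_coset_image submodule_of_def)
    show "B +>\<^bsub>M\<^esub> (x \<oplus>\<^bsub>M\<^esub> y) \<subseteq> (B +>\<^bsub>M\<^esub> x) <+>\<^bsub>M\<^esub> (B +>\<^bsub>M\<^esub> y)"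
    proof
      fix z assume "z \<in> B +>\<^bsub>M\<^esub> (x \<oplus>\<^bsub>M\<^esub> y)"
      then obtain b where b: "b \<in> B" "z = b \<oplus>\<^bsub>M\<^esub> (x \<oplus>\<^bsub>M\<^esub> y)" by (auto simp: a_r_coset_image)
      have "\<zero>\<^bsub>M\<^esub> \<in> B" using B by (simp add: submodule_of_def)
      moreover have "z = (b \<oplus>\<^bsub>M\<^esub> x) \<oplus>\<^bsub>M\<^esub> (\<zero>\<^bsub>M\<^esub> \<oplus>\<^bsub>M\<^esub> y)" using b c assms by (simp add: M.a_assoc)
      ultimately show "z \<in> (B +>\<^bsub>M\<^esub> x) <+>\<^bsub>M\<^esub> (B +>\<^bsub>M\<^esub> y)"
        using b(1) unfolding set_add_def set_mult_def a_r_coset_image by auto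
    qed
  qed
qed

end

lemma cohomology_carrier: "carrier (cohomology C k) = (\<lambda>x. coboundaries C k +>\<^bsub>obj C k\<^esub> x) ` cocycles C k"
  by (auto simp: cohomology_def quot_module_def A_RCOSETS_def RCOSETS_def a_r_coset_def r_coset_def)

lemma cohomology_add:
  assumes C: "cochain_complex R C" and "x \<in> cocycles C k" "y \<in> cocycles C k"
  shows "(coboundaries C k +>\<^bsub>obj C k\<^esub> x) \<oplus>\<^bsub>cohomology C k\<^esub> (coboundaries C k +>\<^bsub>obj C k\<^esub> y) =
    coboundaries C k +>\<^bsub>obj C k\<^esub> (x \<oplus>\<^bsub>obj C k\<^esub> y)"
proof -
  interpret M: left_module R "obj C k" by (rule cochain_complexD(1)[OF C])
  \<comment> \<open>Addition of sets does not refer to the carrier, so restricting the carrier to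
    the cocycles leaves it unchanged.\<close>
  have "add (cohomology C k) = set_add (obj C k)"
    by (auto simp: cohomology_def quot_module_def set_add_def set_mult_def fun_eq_iff)
  then show ?thesis
    using M.coset_add[OF submodule_coboundaries[OF C]] assms by (simp add: cocycles_def)
qed

text \<open>The union over representatives in \<open>quot_module\<close> is a union of copies of one
  coset, since coboundaries are stable under scalars.\<close>

lemma cohomology_smult:
  assumes C: "cochain_complex R C" and "x \<in> cocycles C k" and r: "r \<in> carrier R"
  shows "r \<odot>\<^bsub>cohomology C k\<^esub> (coboundaries C k +>\<^bsub>obj C k\<^esub> x) =
    coboundaries C k +>\<^bsub>obj C k\<^esub> (r \<odot>\<^bsub>obj C k\<^esub> x)"
proof -
  interpret M: left_module R "obj C k" by (rule cochain_complexD(1)[OF C])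
  let ?B = "coboundaries C k"
  have B: "submodule_of R (obj C k) ?B" by (rule submodule_coboundaries[OF C])
  have x: "x \<in> carrier (obj C k)" using assms by (simp add: cocycles_def)
  have 1: "?B +>\<^bsub>obj C k\<^esub> (r \<odot>\<^bsub>obj C k\<^esub> (b \<oplus>\<^bsub>obj C k\<^esub> x)) = ?B +>\<^bsub>obj C k\<^esub> (r \<odot>\<^bsub>obj C k\<^esub> x)"
    if "b \<in> ?B" for b
  proof -
    have "b \<in> carrier (obj C k)" "r \<odot>\<^bsub>obj C k\<^esub> b \<in> ?B" using B that r by (auto simp: submodule_of_def)
    then show ?thesis using x r M.coset_shift[OF B] by (simp add: M.smult_r_distr)
  qed
  have "r \<odot>\<^bsub>cohomology C k\<^esub> (?B +>\<^bsub>obj C k\<^esub> x) =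
    (\<Union>y\<in>?B +>\<^bsub>obj C k\<^esub> x. ?B +>\<^bsub>obj C k\<^esub> (r \<odot>\<^bsub>obj C k\<^esub> y))"
    by (simp add: cohomology_def quot_module_def a_r_coset_image)
  also have "\<dots> = (\<Union>b\<in>?B. ?B +>\<^bsub>obj C k\<^esub> (r \<odot>\<^bsub>obj C k\<^esub> (b \<oplus>\<^bsub>obj C k\<^esub> x)))"
    by (auto simp: a_r_coset_image[where B = ?B and x = x])
  also have "\<dots> = ?B +>\<^bsub>obj C k\<^esub> (r \<odot>\<^bsub>obj C k\<^esub> x)"
    using 1 B by (auto simp: submodule_of_def)
  finally show ?thesis .
qed

lemma cochain_map_cocycles:
  assumes f: "cochain_map R C D f" and x: "x \<in> cocycles C k"
  shows "f k x \<in> cocycles D k"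
proof -
  note lm = cochain_complexD(1)[OF cochain_mapD(1)[OF f]] cochain_complexD(1)[OF cochain_mapD(2)[OF f]]
  have x': "x \<in> carrier (obj C k)" "diff C k x = \<zero>\<^bsub>obj C (k + 1)\<^esub>" using x by (auto simp: cocycles_def)
  have "diff D k (f k x) = f (k + 1) (diff C k x)" by (rule cochain_mapD(4)[OF f x'(1), symmetric]) simp
  also have "\<dots> = \<zero>\<^bsub>obj D (k + 1)\<^esub>" unfolding x'(2) by (rule mod_hom_zero[OF lm cochain_mapD(3)[OF f]])
  finally show ?thesis using mod_hom_closed[OF cochain_mapD(3)[OF f] x'(1)] by (simp add: cocycles_def)
qed

lemma cochain_map_coboundaries:
  assumes f: "cochain_map R C D f" and x: "x \<in> coboundaries C k"
  shows "f k x \<in> coboundaries D k"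
proof -
  obtain a where a: "a \<in> carrier (obj C (k - 1))" "x = diff C (k - 1) a"
    using x by (auto simp: coboundaries_def)
  have "f k (diff C (k - 1) a) = diff D (k - 1) (f (k - 1) a)" by (rule cochain_mapD(4)[OF f a(1)]) simp
  then show ?thesis using a mod_hom_closed[OF cochain_mapD(3)[OF f] a(1)] by (auto simp: coboundaries_def)
qed

text \<open>The union over all representatives collapses to one coset because \<open>f\<close> sends
  coboundaries to coboundaries.\<close>

lemma cohomology_map_coset:
  assumes f: "cochain_map R C D f" and x: "x \<in> cocycles C k"
  shows "cohomology_map D f k (coboundaries C k +>\<^bsub>obj C k\<^esub> x) = coboundaries D k +>\<^bsub>obj D k\<^esub> f k x"
proof -
  note C = cochain_mapD(1)[OF f] and D = cochain_mapD(2)[OF f]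
  interpret M: left_module R "obj D k" by (rule cochain_complexD(1)[OF D])
  have x': "x \<in> carrier (obj C k)" using x by (auto simp: cocycles_def)
  have B: "submodule_of R (obj D k) (coboundaries D k)" by (rule submodule_coboundaries[OF D])
  have BC: "submodule_of R (obj C k) (coboundaries C k)" by (rule submodule_coboundaries[OF C])
  have 1: "coboundaries D k +>\<^bsub>obj D k\<^esub> f k (b \<oplus>\<^bsub>obj C k\<^esub> x) = coboundaries D k +>\<^bsub>obj D k\<^esub> f k x"
    if b: "b \<in> coboundaries C k" for b
  proof -
    have "b \<in> carrier (obj C k)" using BC b by (auto simp: submodule_of_def)
    then show ?thesis
      using M.coset_shift[OF B cochain_map_coboundaries[OF f b] mod_hom_closed[OF cochain_mapD(3)[OF f] x']]
      by (simp add: mod_hom_add[OF cochain_mapD(3)[OF f] _ x'])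
  qed
  have "cohomology_map D f k (coboundaries C k +>\<^bsub>obj C k\<^esub> x) =
    (\<Union>b\<in>coboundaries C k. coboundaries D k +>\<^bsub>obj D k\<^esub> f k (b \<oplus>\<^bsub>obj C k\<^esub> x))"
    by (auto simp: cohomology_map_def a_r_coset_image[where B = "coboundaries C k"])
  also have "\<dots> = coboundaries D k +>\<^bsub>obj D k\<^esub> f k x"
    using 1 BC by (auto simp: submodule_of_def)
  finally show ?thesis .
qed

lemma cohomology_map_hom:
  assumes f: "cochain_map R C D f"
  shows "cohomology_map D f k \<in> mod_hom R (cohomology C k) (cohomology D k)"
proof -
  note C = cochain_mapD(1)[OF f] and D = cochain_mapD(2)[OF f]
  have ZC: "submodule_of R (obj C k) (cocycles C k)" by (rule submodule_cocycles[OF C])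
  note fh = cochain_mapD(3)[OF f, of k]
  show ?thesis
  proof (rule mod_homI)
    fix X assume "X \<in> carrier (cohomology C k)"
    then show "cohomology_map D f k X \<in> carrier (cohomology D k)"
      unfolding cohomology_carrier using cochain_map_cocycles[OF f] by (auto simp: cohomology_map_coset[OF f])
  next
    fix X Y assume "X \<in> carrier (cohomology C k)" "Y \<in> carrier (cohomology C k)"
    then obtain x y where xy: "x \<in> cocycles C k" "y \<in> cocycles C k"
      "X = coboundaries C k +>\<^bsub>obj C k\<^esub> x" "Y = coboundaries C k +>\<^bsub>obj C k\<^esub> y"
      by (auto simp: cohomology_carrier)
    have "x \<oplus>\<^bsub>obj C k\<^esub> y \<in> cocycles C k" using ZC xy by (auto simp: submodule_of_def)
    moreover have "f k (x \<oplus>\<^bsub>obj C k\<^esub> y) = f k x \<oplus>\<^bsub>obj D k\<^esub> f k y"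
      using xy by (intro mod_hom_add[OF fh]) (auto simp: cocycles_def)
    ultimately show "cohomology_map D f k (X \<oplus>\<^bsub>cohomology C k\<^esub> Y) =
      cohomology_map D f k X \<oplus>\<^bsub>cohomology D k\<^esub> cohomology_map D f k Y"
      using xy by (simp add: cohomology_add[OF C] cohomology_add[OF D] cohomology_map_coset[OF f]
          cochain_map_cocycles[OF f])
  next
    fix r X assume r: "r \<in> carrier R" and "X \<in> carrier (cohomology C k)"
    then obtain x where x: "x \<in> cocycles C k" "X = coboundaries C k +>\<^bsub>obj C k\<^esub> x"
      by (auto simp: cohomology_carrier)
    have "r \<odot>\<^bsub>obj C k\<^esub> x \<in> cocycles C k" using ZC x r by (auto simp: submodule_of_def)
    moreover have "f k (r \<odot>\<^bsub>obj C k\<^esub> x) = r \<odot>\<^bsub>obj D k\<^esub> f k x"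
      using x r by (intro mod_hom_smult[OF fh]) (auto simp: cocycles_def)
    ultimately show "cohomology_map D f k (r \<odot>\<^bsub>cohomology C k\<^esub> X) = r \<odot>\<^bsub>cohomology D k\<^esub> cohomology_map D f k X"
      using x r by (simp add: cohomology_smult[OF C] cohomology_smult[OF D] cohomology_map_coset[OF f]
          cochain_map_cocycles[OF f])
  qed
qed

context left_module
begin

lemma minus_zero_right: "x \<in> carrier M \<Longrightarrow> x \<ominus>\<^bsub>M\<^esub> \<zero>\<^bsub>M\<^esub> = x"
  by (simp add: a_minus_def)

lemma minus_eq_zero_iff:
  assumes "x \<in> carrier M" "y \<in> carrier M"
  shows "x \<ominus>\<^bsub>M\<^esub> y = \<zero>\<^bsub>M\<^esub> \<longleftrightarrow> x = y"
proof
  assume "x \<ominus>\<^bsub>M\<^esub> y = \<zero>\<^bsub>M\<^esub>"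
  then have "x \<ominus>\<^bsub>M\<^esub> y \<oplus>\<^bsub>M\<^esub> y = y" using assms by simp
  then show "x = y" using assms by (simp add: a_minus_def M.a_assoc M.l_neg)
qed (use assms in \<open>simp add: a_minus_def M.r_neg\<close>)

lemma add_minus_cancel:
  "x \<in> carrier M \<Longrightarrow> y \<in> carrier M \<Longrightarrow> x \<oplus>\<^bsub>M\<^esub> (y \<ominus>\<^bsub>M\<^esub> x) = y"
  using M.a_lcomm[of x y "\<ominus>\<^bsub>M\<^esub> x"] by (simp add: a_minus_def M.r_neg)

lemma minus_add_cancel:
  "x \<in> carrier M \<Longrightarrow> y \<in> carrier M \<Longrightarrow> (y \<ominus>\<^bsub>M\<^esub> x) \<oplus>\<^bsub>M\<^esub> x = y"
  by (simp add: a_minus_def M.a_assoc M.l_neg)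

end

section \<open>Quasi-isomorphisms and acyclic cones\<close>

text \<open>Equality of cosets is membership of a difference in the coboundaries, and by additivity
  injectivity can be tested at zero. The homomorphism part of \<open>mod_iso\<close> is supplied by
  \<open>cohomology_map_hom\<close>. Cosets do not appear after this point.\<close>

lemma quasi_iso_iff_elements:
  assumes f: "cochain_map R C D f"
  shows "quasi_iso R C D f \<longleftrightarrow>
    (\<forall>k. (\<forall>x\<in>cocycles C k. f k x \<in> coboundaries D k \<longrightarrow> x \<in> coboundaries C k) \<and>
         (\<forall>y\<in>cocycles D k. \<exists>x\<in>cocycles C k. y \<ominus>\<^bsub>obj D k\<^esub> f k x \<in> coboundaries D k))"
proof -
  note C = cochain_mapD(1)[OF f] and D = cochain_mapD(2)[OF f]
  have "bij_betw (cohomology_map D f k) (carrier (cohomology C k)) (carrier (cohomology D k)) \<longleftrightarrow>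
     (\<forall>x\<in>cocycles C k. f k x \<in> coboundaries D k \<longrightarrow> x \<in> coboundaries C k) \<and>
     (\<forall>y\<in>cocycles D k. \<exists>x\<in>cocycles C k. y \<ominus>\<^bsub>obj D k\<^esub> f k x \<in> coboundaries D k)"
    (is "?bij \<longleftrightarrow> ?inj \<and> ?surj") for k
  proof -
    interpret M: left_module R "obj C k" by (rule cochain_complexD(1)[OF C])
    interpret M': left_module R "obj D k" by (rule cochain_complexD(1)[OF D])
    note fh = cochain_mapD(3)[OF f, of k]
    have BC: "submodule_of R (obj C k) (coboundaries C k)" by (rule submodule_coboundaries[OF C])
    have BD: "submodule_of R (obj D k) (coboundaries D k)" by (rule submodule_coboundaries[OF D])
    have ZC: "submodule_of R (obj C k) (cocycles C k)" by (rule submodule_cocycles[OF C])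
    have z: "x \<in> carrier (obj C k)" if "x \<in> cocycles C k" for x using that by (simp add: cocycles_def)
    have z': "x \<in> carrier (obj D k)" if "x \<in> cocycles D k" for x using that by (simp add: cocycles_def)
    have fz: "f k x \<in> carrier (obj D k)" if "x \<in> cocycles C k" for x using mod_hom_closed[OF fh z[OF that]] .
    have eqC: "coboundaries C k +>\<^bsub>obj C k\<^esub> x = coboundaries C k +>\<^bsub>obj C k\<^esub> y \<longleftrightarrow>
      x \<ominus>\<^bsub>obj C k\<^esub> y \<in> coboundaries C k" if "x \<in> cocycles C k" "y \<in> cocycles C k" for x y
      using that z by (intro M.coset_eq_iff[OF BC])
    have eqD: "coboundaries D k +>\<^bsub>obj D k\<^esub> x = coboundaries D k +>\<^bsub>obj D k\<^esub> y \<longleftrightarrow>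
      x \<ominus>\<^bsub>obj D k\<^esub> y \<in> coboundaries D k" if "x \<in> cocycles D k" "y \<in> cocycles D k" for x y
      using that z' by (intro M'.coset_eq_iff[OF BD])
    note fZ = cochain_map_cocycles[OF f]
    have zero: "\<zero>\<^bsub>obj C k\<^esub> \<in> cocycles C k" using ZC by (simp add: submodule_of_def)
    have f0: "f k \<zero>\<^bsub>obj C k\<^esub> = \<zero>\<^bsub>obj D k\<^esub>"
      by (rule mod_hom_zero[OF M.left_module_axioms M'.left_module_axioms fh])
    have sub: "x \<ominus>\<^bsub>obj C k\<^esub> y \<in> cocycles C k" if "x \<in> cocycles C k" "y \<in> cocycles C k" for x y
      using ZC that by (auto simp: submodule_of_def a_minus_def)
    have "inj_on (cohomology_map D f k) (carrier (cohomology C k)) \<longleftrightarrow>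
      (\<forall>x\<in>cocycles C k. \<forall>y\<in>cocycles C k. f k x \<ominus>\<^bsub>obj D k\<^esub> f k y \<in> coboundaries D k \<longrightarrow>
         x \<ominus>\<^bsub>obj C k\<^esub> y \<in> coboundaries C k)"
      unfolding cohomology_carrier inj_on_def by (simp add: cohomology_map_coset[OF f] eqC eqD fZ)
    also have "\<dots> \<longleftrightarrow> ?inj"
    proof (intro iffI ballI impI)
      fix x assume H: "\<forall>x\<in>cocycles C k. \<forall>y\<in>cocycles C k. f k x \<ominus>\<^bsub>obj D k\<^esub> f k y \<in> coboundaries D k \<longrightarrow>
         x \<ominus>\<^bsub>obj C k\<^esub> y \<in> coboundaries C k" and x: "x \<in> cocycles C k" "f k x \<in> coboundaries D k"
      show "x \<in> coboundaries C k"
        using H[rule_format, OF x(1) zero] x(2)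
        unfolding f0 M.minus_zero_right[OF z[OF x(1)]] M'.minus_zero_right[OF fz[OF x(1)]] .
    next
      fix x y assume H: ?inj and xy: "x \<in> cocycles C k" "y \<in> cocycles C k"
        "f k x \<ominus>\<^bsub>obj D k\<^esub> f k y \<in> coboundaries D k"
      have "f k (x \<ominus>\<^bsub>obj C k\<^esub> y) = f k x \<ominus>\<^bsub>obj D k\<^esub> f k y"
        by (rule mod_hom_minus[OF M.left_module_axioms M'.left_module_axioms fh z[OF xy(1)] z[OF xy(2)]])
      then show "x \<ominus>\<^bsub>obj C k\<^esub> y \<in> coboundaries C k" using H sub[OF xy(1,2)] xy(3) by auto
    qed
    finally have 1: "inj_on (cohomology_map D f k) (carrier (cohomology C k)) \<longleftrightarrow> ?inj" .
    have im: "cohomology_map D f k ` carrier (cohomology C k) =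
      (\<lambda>x. coboundaries D k +>\<^bsub>obj D k\<^esub> f k x) ` cocycles C k"
      unfolding cohomology_carrier image_image by (rule image_cong) (simp_all add: cohomology_map_coset[OF f])
    have "cohomology_map D f k ` carrier (cohomology C k) = carrier (cohomology D k) \<longleftrightarrow>
      carrier (cohomology D k) \<subseteq> cohomology_map D f k ` carrier (cohomology C k)"
      unfolding im cohomology_carrier[of D] using fZ by auto
    also have "\<dots> \<longleftrightarrow> (\<forall>y\<in>cocycles D k. \<exists>x\<in>cocycles C k.
        coboundaries D k +>\<^bsub>obj D k\<^esub> y = coboundaries D k +>\<^bsub>obj D k\<^esub> f k x)"
      unfolding im cohomology_carrier[of D] by (auto simp: image_subset_iff image_iff)
    also have "\<dots> \<longleftrightarrow> ?surj" using eqD fZ by (meson bex_cong ball_cong)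
    finally show ?thesis unfolding bij_betw_def 1 by (rule arg_cong)
  qed
  then show ?thesis
    using f cohomology_map_hom[OF f] by (simp add: quasi_iso_def mod_iso_def)
qed

text \<open>Acyclicity in components: the assumptions say that \<open>(x, y)\<close> is a cocycle of
  the cone, and \<open>(x', y')\<close> is an element bounding it.\<close>

lemma acyclic_coneD:
  assumes "acyclic_complex (cone C D f)" and f: "cochain_map R C D f"
    and "x \<in> carrier (obj C k)" "y \<in> carrier (obj D k')" "diff C k x = \<zero>\<^bsub>obj C (k + 1)\<^esub>"
    and "f k x = diff D k' y" and k: "k' = k - 1" "k'' = k - 2"
  obtains x' y' where "x' \<in> carrier (obj C k')" "y' \<in> carrier (obj D k'')"
    "diff C k' x' = x" "f k' x' \<ominus>\<^bsub>obj D k'\<^esub> diff D k'' y' = y"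
proof -
  interpret M: left_module R "obj D k"
    by (rule cochain_complexD(1)[OF cochain_mapD(2)[OF f]])
  have "f k x \<in> carrier (obj D k)" by (rule mod_hom_closed[OF cochain_mapD(3)[OF f] assms(3)])
  then have "(x, y) \<in> cocycles (cone C D f) k"
    using assms by (simp add: cocycles_def a_minus_def M.M.r_neg)
  then have "(x, y) \<in> coboundaries (cone C D f) k"
    using assms(1) by (auto simp: acyclic_complex_def)
  then obtain z where z: "z \<in> carrier (obj (cone C D f) (k - 1))" "(x, y) = diff (cone C D f) (k - 1) z"
    by (auto simp: coboundaries_def)
  have e: "k - 1 - 1 = k''" using k by simp
  show thesis
    using that[of "fst z" "snd z"] z k(1) unfolding obj_cone diff_cone e by auto
qed

lemma acyclic_coneI:
  assumes "\<And>k x y. \<lbrakk>x \<in> carrier (obj C k); y \<in> carrier (obj D (k - 1)); diff C k x = \<zero>\<^bsub>obj C (k + 1)\<^esub>;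
      f k x = diff D (k - 1) y\<rbrakk> \<Longrightarrow> \<exists>x'\<in>carrier (obj C (k - 1)). \<exists>y'\<in>carrier (obj D (k - 2)).
      diff C (k - 1) x' = x \<and> f (k - 1) x' \<ominus>\<^bsub>obj D (k - 1)\<^esub> diff D (k - 2) y' = y"
    and f: "cochain_map R C D f"
  shows "acyclic_complex (cone C D f)"
  unfolding acyclic_complex_def
proof (intro allI subsetI)
  fix k z assume z: "z \<in> cocycles (cone C D f) k"
  obtain x y where xy: "z = (x, y)" by (cases z)
  interpret M: left_module R "obj D k"
    by (rule cochain_complexD(1)[OF cochain_mapD(2)[OF f]])
  have c: "x \<in> carrier (obj C k)" "y \<in> carrier (obj D (k - 1))" "diff C k x = \<zero>\<^bsub>obj C (k + 1)\<^esub>"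
    "f k x \<ominus>\<^bsub>obj D k\<^esub> diff D (k - 1) y = \<zero>\<^bsub>obj D k\<^esub>"
    using z by (auto simp: cocycles_def xy)
  have fx: "f k x \<in> carrier (obj D k)" by (rule mod_hom_closed[OF cochain_mapD(3)[OF f] c(1)])
  have dy: "diff D (k - 1) y \<in> carrier (obj D k)"
    by (rule mod_hom_closed[OF cochain_complexD(2)[OF cochain_mapD(2)[OF f]] c(2)]) simp
  have "f k x = diff D (k - 1) y" using c(4) fx dy by (simp add: M.minus_eq_zero_iff)
  from assms(1)[OF c(1-3) this] obtain x' y' where "x' \<in> carrier (obj C (k - 1))"
    "y' \<in> carrier (obj D (k - 2))" "diff C (k - 1) x' = x"
    "f (k - 1) x' \<ominus>\<^bsub>obj D (k - 1)\<^esub> diff D (k - 2) y' = y" by blast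
  moreover have "k - 1 - 1 = k - 2" by simp
  ultimately show "z \<in> coboundaries (cone C D f) k"
    unfolding coboundaries_def obj_cone by (intro image_eqI[of _ _ "(x', y')"]) (auto simp: xy)
qed

text \<open>A diagram chase in place of the long exact sequence of the cone. It replaces a statement
  about cohomology classes by one about elements, to which the filtration argument applies.\<close>

lemma quasi_iso_iff_cone:
  assumes f: "cochain_map R C D f"
  shows "quasi_iso R C D f \<longleftrightarrow> acyclic_complex (cone C D f)"
proof -
  note C = cochain_complexD[OF cochain_mapD(1)[OF f]] and D = cochain_complexD[OF cochain_mapD(2)[OF f]]
  note fh = cochain_mapD(3)[OF f] and fd = cochain_mapD(4)[OF f]
  show ?thesis
    unfolding quasi_iso_iff_elements[OF f]
  proof (intro iffI allI conjI ballI impI)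
    assume H: "\<forall>k. (\<forall>x\<in>cocycles C k. f k x \<in> coboundaries D k \<longrightarrow> x \<in> coboundaries C k) \<and>
         (\<forall>y\<in>cocycles D k. \<exists>x\<in>cocycles C k. y \<ominus>\<^bsub>obj D k\<^esub> f k x \<in> coboundaries D k)"
    show "acyclic_complex (cone C D f)"
    proof (rule acyclic_coneI[OF _ f])
      fix k x y assume xy: "x \<in> carrier (obj C k)" "y \<in> carrier (obj D (k - 1))"
        "diff C k x = \<zero>\<^bsub>obj C (k + 1)\<^esub>" "f k x = diff D (k - 1) y"
      interpret C1: left_module R "obj C (k - 1)" by (rule C(1))
      interpret Ck: left_module R "obj C k" by (rule C(1))
      interpret D1: left_module R "obj D (k - 1)" by (rule D(1))
      interpret D2: left_module R "obj D (k - 2)" by (rule D(1))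
      interpret Dk: left_module R "obj D k" by (rule D(1))
      have dC: "diff C (k - 1) \<in> mod_hom R (obj C (k - 1)) (obj C k)" by (rule C(2)) simp
      have dD: "diff D (k - 1) \<in> mod_hom R (obj D (k - 1)) (obj D k)" by (rule D(2)) simp
      have dD2: "diff D (k - 2) \<in> mod_hom R (obj D (k - 2)) (obj D (k - 1))" by (rule D(2)) simp
      have "x \<in> cocycles C k" "f k x \<in> coboundaries D k"
        using xy by (auto simp: cocycles_def coboundaries_def)
      then have "x \<in> coboundaries C k" using H by blast
      then obtain x1 where x1: "x1 \<in> carrier (obj C (k - 1))" "x = diff C (k - 1) x1"
        by (auto simp: coboundaries_def)
      have fx1: "f (k - 1) x1 \<in> carrier (obj D (k - 1))" by (rule mod_hom_closed[OF fh x1(1)])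
      have "diff D (k - 1) (f (k - 1) x1) = f k x" unfolding x1(2) by (rule fd[OF x1(1), symmetric]) simp
      \<comment> \<open>\<open>x1\<close> bounds \<open>x\<close>, but its image may differ from
        \<open>y\<close>. The difference is a cocycle, so surjectivity in degree
        \<open>k - 1\<close> provides a cocycle \<open>x2\<close> that corrects \<open>x1\<close>
        without changing its differential.\<close>
      then have "diff D (k - 1) (y \<ominus>\<^bsub>obj D (k - 1)\<^esub> f (k - 1) x1) = \<zero>\<^bsub>obj D k\<^esub>"
        using mod_hom_minus[OF D(1) D(1) dD xy(2) fx1] xy(4) mod_hom_closed[OF dD xy(2)]
        by (simp add: a_minus_def Dk.M.r_neg)
      then have "y \<ominus>\<^bsub>obj D (k - 1)\<^esub> f (k - 1) x1 \<in> cocycles D (k - 1)"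
        using xy(2) fx1 by (simp add: cocycles_def)
      then obtain x2 where x2: "x2 \<in> cocycles C (k - 1)"
        "y \<ominus>\<^bsub>obj D (k - 1)\<^esub> f (k - 1) x1 \<ominus>\<^bsub>obj D (k - 1)\<^esub> f (k - 1) x2 \<in> coboundaries D (k - 1)"
        using H by blast
      have x2': "x2 \<in> carrier (obj C (k - 1))" "diff C (k - 1) x2 = \<zero>\<^bsub>obj C k\<^esub>"
        using x2(1) by (auto simp: cocycles_def)
      have fx2: "f (k - 1) x2 \<in> carrier (obj D (k - 1))" by (rule mod_hom_closed[OF fh x2'(1)])
      have "k - 1 - 1 = k - 2" by simp
      then obtain w where w: "w \<in> carrier (obj D (k - 2))"
        "y \<ominus>\<^bsub>obj D (k - 1)\<^esub> f (k - 1) x1 \<ominus>\<^bsub>obj D (k - 1)\<^esub> f (k - 1) x2 = diff D (k - 2) w"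
        using x2(2) by (auto simp: coboundaries_def)
      have dw: "diff D (k - 2) w \<in> carrier (obj D (k - 1))" by (rule mod_hom_closed[OF dD2 w(1)])
      have "diff C (k - 1) (x1 \<oplus>\<^bsub>obj C (k - 1)\<^esub> x2) = x"
        using mod_hom_add[OF dC x1(1) x2'(1)] x1(2) x2'(2) xy(1) by simp
      \<comment> \<open>The cone differential subtracts the boundary term, hence the second
        component of the witness is minus \<open>w\<close>.\<close>
      moreover have "f (k - 1) (x1 \<oplus>\<^bsub>obj C (k - 1)\<^esub> x2) \<ominus>\<^bsub>obj D (k - 1)\<^esub>
          diff D (k - 2) (\<ominus>\<^bsub>obj D (k - 2)\<^esub> w) = y"
      proof -
        have "y = f (k - 1) x1 \<oplus>\<^bsub>obj D (k - 1)\<^esub> (f (k - 1) x2 \<oplus>\<^bsub>obj D (k - 1)\<^esub> (y \<ominus>\<^bsub>obj D (k - 1)\<^esub> f (k - 1) x1 \<ominus>\<^bsub>obj D (k - 1)\<^esub> f (k - 1) x2))"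
          using xy(2) fx1 fx2 by (simp add: D1.add_minus_cancel)
        also have "\<dots> = f (k - 1) x1 \<oplus>\<^bsub>obj D (k - 1)\<^esub> (f (k - 1) x2 \<oplus>\<^bsub>obj D (k - 1)\<^esub> diff D (k - 2) w)"
          unfolding w(2) ..
        also have "\<dots> = f (k - 1) (x1 \<oplus>\<^bsub>obj C (k - 1)\<^esub> x2) \<ominus>\<^bsub>obj D (k - 1)\<^esub>
          diff D (k - 2) (\<ominus>\<^bsub>obj D (k - 2)\<^esub> w)"
          unfolding mod_hom_add[OF fh x1(1) x2'(1)] mod_hom_neg[OF D(1) D(1) dD2 w(1)]
          using fx1 fx2 dw by (simp add: a_minus_def D1.M.a_assoc)
        finally show ?thesis ..
      qed
      ultimately show "\<exists>x'\<in>carrier (obj C (k - 1)). \<exists>y'\<in>carrier (obj D (k - 2)).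
          diff C (k - 1) x' = x \<and> f (k - 1) x' \<ominus>\<^bsub>obj D (k - 1)\<^esub> diff D (k - 2) y' = y"
        using x1(1) x2'(1) w(1)
        by (intro bexI[of _ "x1 \<oplus>\<^bsub>obj C (k - 1)\<^esub> x2"] bexI[of _ "\<ominus>\<^bsub>obj D (k - 2)\<^esub> w"]) auto
    qed
  next
    fix k x assume A: "acyclic_complex (cone C D f)" and x: "x \<in> cocycles C k" "f k x \<in> coboundaries D k"
    have x': "x \<in> carrier (obj C k)" "diff C k x = \<zero>\<^bsub>obj C (k + 1)\<^esub>" using x by (auto simp: cocycles_def)
    obtain y where y: "y \<in> carrier (obj D (k - 1))" "f k x = diff D (k - 1) y"
      using x(2) by (auto simp: coboundaries_def)
    obtain a where "a \<in> carrier (obj C (k - 1))" "diff C (k - 1) a = x"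
      by (rule acyclic_coneD[OF A f x'(1) y(1) x'(2) y(2) refl refl])
    then show "x \<in> coboundaries C k" by (auto simp: coboundaries_def)
  next
    fix k y assume A: "acyclic_complex (cone C D f)" and y: "y \<in> cocycles D k"
    have y': "y \<in> carrier (obj D k)" "diff D k y = \<zero>\<^bsub>obj D (k + 1)\<^esub>" using y by (auto simp: cocycles_def)
    interpret C1: left_module R "obj C (k + 1)" by (rule C(1))
    interpret Dk: left_module R "obj D k" by (rule D(1))
    interpret D1: left_module R "obj D (k - 1)" by (rule D(1))
    \<comment> \<open>Surjectivity comes from the cocycle \<open>(0, y)\<close> of the cone in
      degree \<open>k + 1\<close>: in an element bounding it the first component is a cocycle whose
      image differs from \<open>y\<close> by a coboundary.\<close>
    have "diff C (k + 1) \<zero>\<^bsub>obj C (k + 1)\<^esub> = \<zero>\<^bsub>obj C (k + 1 + 1)\<^esub>"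
      by (rule mod_hom_zero[OF C(1) C(1) C(2)]) simp
    moreover have "f (k + 1) \<zero>\<^bsub>obj C (k + 1)\<^esub> = diff D k y"
      unfolding y'(2) by (rule mod_hom_zero[OF C(1) D(1) fh])
    ultimately obtain x' y'' where x': "x' \<in> carrier (obj C k)" "y'' \<in> carrier (obj D (k - 1))"
      "diff C k x' = \<zero>\<^bsub>obj C (k + 1)\<^esub>" "f k x' \<ominus>\<^bsub>obj D k\<^esub> diff D (k - 1) y'' = y"
      by (rule acyclic_coneD[OF A f C1.M.zero_closed y'(1)]) auto
    have d: "diff D (k - 1) \<in> mod_hom R (obj D (k - 1)) (obj D k)" by (rule D(2)) simp
    have fx: "f k x' \<in> carrier (obj D k)" by (rule mod_hom_closed[OF fh x'(1)])
    have dy: "diff D (k - 1) y'' \<in> carrier (obj D k)" by (rule mod_hom_closed[OF d x'(2)])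
    have "y \<ominus>\<^bsub>obj D k\<^esub> f k x' = diff D (k - 1) (\<ominus>\<^bsub>obj D (k - 1)\<^esub> y'')"
      unfolding x'(4)[symmetric] mod_hom_neg[OF D(1) D(1) d x'(2)]
      using fx dy by (simp add: a_minus_def Dk.M.a_ac Dk.M.r_neg Dk.M.r_neg1 Dk.M.r_neg2)
    then have "y \<ominus>\<^bsub>obj D k\<^esub> f k x' \<in> coboundaries D k" using x'(2) by (auto simp: coboundaries_def)
    moreover have "x' \<in> cocycles C k" using x' by (simp add: cocycles_def)
    ultimately show "\<exists>x\<in>cocycles C k. y \<ominus>\<^bsub>obj D k\<^esub> f k x \<in> coboundaries D k" by blast
  qed
qed

section \<open>Contractions and homotopy equivalences\<close>

text \<open>Projectivity relative to one pair of modules, all three on arbitrary types. It can be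
  stated for the terms of the cone, whose types are not those covered by the definition of
  \<open>projective\<close> for the summands.\<close>

definition lifts ::
  "('r, 'k) ring_scheme \<Rightarrow> ('r, 'p) module \<Rightarrow> ('r, 'a) module \<Rightarrow> ('r, 'b) module \<Rightarrow> bool" where
  "lifts R P M N \<longleftrightarrow> (\<forall>g\<in>mod_hom R M N. \<forall>f\<in>mod_hom R P N. g ` carrier M = carrier N \<longrightarrow>
     (\<exists>f'\<in>mod_hom R P M. \<forall>x\<in>carrier P. g (f' x) = f x))"

lemma liftsD:
  assumes "lifts R P M N" "g \<in> mod_hom R M N" "f \<in> mod_hom R P N" "g ` carrier M = carrier N"
  shows "\<exists>f'\<in>mod_hom R P M. \<forall>x\<in>carrier P. g (f' x) = f x"
  using assms(1)[unfolded lifts_def, rule_format, OF assms(2-4)] .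

lemma lifts_projective:
  assumes "projective R P" "left_module R M" "left_module R N"
  shows "lifts R P M N"
  unfolding lifts_def by (intro ballI impI projective_lift[OF assms])

text \<open>A homomorphism out of a finite product is the sum of its restrictions along the
  inclusions \<open>e i\<close>. These restrictions are lifted separately, and the lifts are
  added.\<close>

lemma lifts_prod_module:
  assumes R: "ring R" and I: "finite I" and P: "\<And>i. i \<in> I \<Longrightarrow> left_module R (P i)"
    and M: "left_module R M" and N: "left_module R N"
    and L: "\<And>i. i \<in> I \<Longrightarrow> lifts R (P i) M N"
  shows "lifts R (prod_module I P) M N"
  unfolding lifts_def
proof (intro ballI impI)
  fix g f assume g: "g \<in> mod_hom R M N" and f: "f \<in> mod_hom R (prod_module I P) N"
    and surj: "g ` carrier M = carrier N"
  interpret M: left_module R M by fact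
  interpret N: left_module R N by fact
  have LP: "left_module R (prod_module I P)" using R P by (rule left_module_prod_module)
  define e where "e i p = (\<lambda>j\<in>I. if j = i then p else \<zero>\<^bsub>P j\<^esub>)" for i p
  have e: "e i \<in> mod_hom R (P i) (prod_module I P)" if "i \<in> I" for i
    unfolding e_def[abs_def]
  proof (rule mod_hom_tuple)
    fix j assume j: "j \<in> I"
    show "(\<lambda>p. if j = i then p else \<zero>\<^bsub>P j\<^esub>) \<in> mod_hom R (P i) (P j)"
      using mod_hom_id mod_hom_zero_map[OF P[OF j]] by (cases "j = i") auto
  qed
  have "\<forall>i\<in>I. \<exists>f'\<in>mod_hom R (P i) M. \<forall>p\<in>carrier (P i). g (f' p) = f (e i p)"
    using liftsD[OF L g mod_hom_comp[OF e f] surj] by (rule ballI)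
  then obtain f' where f': "\<And>i. i \<in> I \<Longrightarrow> f' i \<in> mod_hom R (P i) M"
    "\<And>i p. i \<in> I \<Longrightarrow> p \<in> carrier (P i) \<Longrightarrow> g (f' i p) = f (e i p)" by metis
  have hom: "(\<lambda>x. \<Oplus>\<^bsub>M\<^esub>i\<in>I. f' i (x i)) \<in> mod_hom R (prod_module I P) M"
    by (intro mod_hom_sum M I mod_hom_comp[OF mod_hom_proj[where M = P]] f'(1))
  have "g (\<Oplus>\<^bsub>M\<^esub>i\<in>I. f' i (x i)) = f x" if x: "x \<in> carrier (prod_module I P)" for x
  proof -
    have xi: "x i \<in> carrier (P i)" if "i \<in> I" for i using x that by auto
    have ex: "e i (x i) \<in> carrier (prod_module I P)" if "i \<in> I" for i
      using mod_hom_closed[OF e xi] that by blast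
    interpret PP: left_module R "prod_module I P" by fact
    have "x = (\<Oplus>\<^bsub>prod_module I P\<^esub>i\<in>I. e i (x i))"
    proof (rule PiE_ext[of _ I "\<lambda>i. carrier (P i)"])
      show "x \<in> (\<Pi>\<^sub>E i\<in>I. carrier (P i))" using x by simp
      have "(\<Oplus>\<^bsub>prod_module I P\<^esub>i\<in>I. e i (x i)) \<in> carrier (prod_module I P)"
        using ex by (intro PP.M.finsum_closed) blast
      then show "(\<Oplus>\<^bsub>prod_module I P\<^esub>i\<in>I. e i (x i)) \<in> (\<Pi>\<^sub>E i\<in>I. carrier (P i))" by simp
      fix j assume j: "j \<in> I"
      interpret Pj: left_module R "P j" by (rule P[OF j])
      have "(\<Oplus>\<^bsub>prod_module I P\<^esub>i\<in>I. e i (x i)) j = (\<Oplus>\<^bsub>P j\<^esub>i\<in>I. e i (x i) j)"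
        using ex by (intro mod_hom_finsum[OF LP P[OF j] mod_hom_proj[OF j] I]) blast
      also have "\<dots> = (\<Oplus>\<^bsub>P j\<^esub>i\<in>I. if j = i then x j else \<zero>\<^bsub>P j\<^esub>)"
        using j xi by (intro Pj.M.finsum_cong') (auto simp: e_def)
      also have "\<dots> = x j"
        using j xi I by (intro Pj.M.add.finprod_singleton[of j I "\<lambda>_. x j"]) auto
      finally show "x j = (\<Oplus>\<^bsub>prod_module I P\<^esub>i\<in>I. e i (x i)) j" ..
    qed
    then have "f x = f (\<Oplus>\<^bsub>prod_module I P\<^esub>i\<in>I. e i (x i))" by (rule arg_cong)
    also have "\<dots> = (\<Oplus>\<^bsub>N\<^esub>i\<in>I. f (e i (x i)))"
      using ex by (intro mod_hom_finsum[OF LP N f I]) blast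
    also have "\<dots> = (\<Oplus>\<^bsub>N\<^esub>i\<in>I. g (f' i (x i)))"
      using f'(2) xi mod_hom_closed[OF g] mod_hom_closed[OF f'(1) xi]
      by (intro N.M.finsum_cong') (auto simp: f'(2))
    also have "\<dots> = g (\<Oplus>\<^bsub>M\<^esub>i\<in>I. f' i (x i))"
      using mod_hom_closed[OF f'(1) xi] by (intro mod_hom_finsum[OF M N g I, symmetric]) blast
    finally show ?thesis ..
  qed
  then show "\<exists>f'\<in>mod_hom R (prod_module I P) M. \<forall>x\<in>carrier (prod_module I P). g (f' x) = f x"
    using hom by (intro bexI[of _ "\<lambda>x. \<Oplus>\<^bsub>M\<^esub>i\<in>I. f' i (x i)"]) auto
qed

lemma lifts_pair_module:
  assumes P: "left_module R P" and Q: "left_module R Q" and M: "left_module R M"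
    and LP: "lifts R P M N" and LQ: "lifts R Q M N"
  shows "lifts R (pair_module P Q) M N"
  unfolding lifts_def
proof (intro ballI impI)
  fix g f assume g: "g \<in> mod_hom R M N" and f: "f \<in> mod_hom R (pair_module P Q) N"
    and surj: "g ` carrier M = carrier N"
  interpret P: left_module R P by fact
  interpret Q: left_module R Q by fact
  obtain p where p: "p \<in> mod_hom R P M" "\<And>x. x \<in> carrier P \<Longrightarrow> g (p x) = f (x, \<zero>\<^bsub>Q\<^esub>)"
    using liftsD[OF LP g mod_hom_comp[OF mod_hom_inl[OF P Q] f] surj] by (elim bexE) (rule that, auto)
  obtain q where q: "q \<in> mod_hom R Q M" "\<And>x. x \<in> carrier Q \<Longrightarrow> g (q x) = f (\<zero>\<^bsub>P\<^esub>, x)"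
    using liftsD[OF LQ g mod_hom_comp[OF mod_hom_inr[OF P Q] f] surj] by (elim bexE) (rule that, auto)
  have "(\<lambda>z. p (fst z) \<oplus>\<^bsub>M\<^esub> q (snd z)) \<in> mod_hom R (pair_module P Q) M"
    by (intro mod_hom_plus M mod_hom_comp[OF mod_hom_fst p(1)] mod_hom_comp[OF mod_hom_snd q(1)])
  moreover have "g (p (fst z) \<oplus>\<^bsub>M\<^esub> q (snd z)) = f z" if z: "z \<in> carrier (pair_module P Q)" for z
  proof -
    obtain x y where xy: "z = (x, y)" "x \<in> carrier P" "y \<in> carrier Q" using z by auto
    have "f z = f ((x, \<zero>\<^bsub>Q\<^esub>) \<oplus>\<^bsub>pair_module P Q\<^esub> (\<zero>\<^bsub>P\<^esub>, y))" using xy by simp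
    also have "\<dots> = f (x, \<zero>\<^bsub>Q\<^esub>) \<oplus>\<^bsub>N\<^esub> f (\<zero>\<^bsub>P\<^esub>, y)" using xy by (intro mod_hom_add[OF f]) auto
    also have "\<dots> = g (p x) \<oplus>\<^bsub>N\<^esub> g (q y)" using p q xy by simp
    also have "\<dots> = g (p x \<oplus>\<^bsub>M\<^esub> q y)"
      using xy by (intro mod_hom_add[OF g, symmetric] mod_hom_closed[OF p(1)] mod_hom_closed[OF q(1)])
    finally show ?thesis by (simp add: xy(1))
  qed
  ultimately show "\<exists>f'\<in>mod_hom R (pair_module P Q) M. \<forall>x\<in>carrier (pair_module P Q). g (f' x) = f x"
    by (intro bexI[of _ "\<lambda>z. p (fst z) \<oplus>\<^bsub>M\<^esub> q (snd z)"] ballI)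
qed

lemma left_module_submodule:
  assumes M: "left_module R M" and B: "submodule_of R M B"
  shows "left_module R (M\<lparr>carrier := B\<rparr>)"
proof -
  interpret M: left_module R M by fact
  have c: "x \<in> carrier M" if "x \<in> B" for x using B that by (auto simp: submodule_of_def)
  show ?thesis
  proof (intro left_module.intro left_module_axioms.intro M.R.ring_axioms)
    show "abelian_group (M\<lparr>carrier := B\<rparr>)"
    proof (rule abelian_groupI)
      fix x assume "x \<in> carrier (M\<lparr>carrier := B\<rparr>)"
      then show "\<exists>y\<in>carrier (M\<lparr>carrier := B\<rparr>). y \<oplus>\<^bsub>M\<lparr>carrier := B\<rparr>\<^esub> x = \<zero>\<^bsub>M\<lparr>carrier := B\<rparr>\<^esub>"
        using B c by (intro bexI[of _ "\<ominus>\<^bsub>M\<^esub> x"]) (auto simp: submodule_of_def M.M.l_neg)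
    qed (use B c in \<open>auto simp: submodule_of_def M.M.a_ac\<close>)
  qed (use B c in \<open>auto simp: submodule_of_def M.smult_l_distr M.smult_r_distr M.smult_assoc1\<close>)
qed

text \<open>Descending recursion: above the bound the contraction is zero, and a contraction in degrees
  \<open>> k\<close> makes \<open>1 - s d\<close> take values in the cocycles of degree \<open>k\<close>, where it lifts along \<open>d\<close>.\<close>

lemma exists_contraction:
  fixes K :: "('r, 'm) cochain"
  assumes K: "cochain_complex R K" and acyc: "acyclic_complex K" and bd: "bounded_above K"
    and L: "\<And>k. lifts R (obj K k) (obj K (k - 1)) ((obj K k)\<lparr>carrier := cocycles K k\<rparr>)"
  shows "\<exists>s. graded_map R K K (-1) s \<and>
    (\<forall>k. \<forall>x\<in>carrier (obj K k). diff K (k - 1) (s k x) \<oplus>\<^bsub>obj K k\<^esub> s (k + 1) (diff K k x) = x)"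
proof -
  note lm = cochain_complexD(1)[OF K] and dh = cochain_complexD(2)[OF K]
  obtain m where m: "\<And>k. k > m \<Longrightarrow> carrier (obj K k) = {\<zero>\<^bsub>obj K k\<^esub>}"
    using bd by (auto simp: bounded_above_def)
  have dz: "diff K k \<zero>\<^bsub>obj K k\<^esub> = \<zero>\<^bsub>obj K (k + 1)\<^esub>" for k
    by (rule mod_hom_zero[OF lm lm dh]) simp
  \<comment> \<open>The contraction identity \<open>Q\<close> ties two consecutive maps together.
    \<open>P\<close> isolates what the next step needs of the previous map, namely that it splits
    the differential on cocycles.\<close>
  define P where "P k a \<longleftrightarrow> a \<in> mod_hom R (obj K k) (obj K (k - 1)) \<and>
    (\<forall>y\<in>cocycles K k. diff K (k - 1) (a y) = y)" for k a
  define Q where "Q k a b \<longleftrightarrow>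
    (\<forall>x\<in>carrier (obj K k). diff K (k - 1) (b x) \<oplus>\<^bsub>obj K k\<^esub> a (diff K k x) = x)" for k a b
  \<comment> \<open>In degree \<open>m + 1\<close> the module is already zero, so the zero map can
    start the recursion.\<close>
  have base: "P (m + 1) (\<lambda>x. \<zero>\<^bsub>obj K m\<^esub>)"
    unfolding P_def
  proof (intro conjI ballI)
    show "(\<lambda>x. \<zero>\<^bsub>obj K m\<^esub>) \<in> mod_hom R (obj K (m + 1)) (obj K (m + 1 - 1))"
      using mod_hom_zero_map[OF lm] by simp
    fix y assume "y \<in> cocycles K (m + 1)"
    then have "y = \<zero>\<^bsub>obj K (m + 1)\<^esub>" using m[of "m + 1"] by (auto simp: cocycles_def)
    then show "diff K (m + 1 - 1) \<zero>\<^bsub>obj K m\<^esub> = y" using dz[of m] by simp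
  qed
  have step: "\<exists>b. P k b \<and> Q k a b" if a: "P (k + 1) a" for k a
  proof -
    interpret M: left_module R "obj K k" by (rule lm)
    interpret M1: left_module R "obj K (k + 1)" by (rule lm)
    let ?N = "(obj K k)\<lparr>carrier := cocycles K k\<rparr>"
    have ah: "a \<in> mod_hom R (obj K (k + 1)) (obj K k)" using a by (simp add: P_def)
    have d: "diff K k \<in> mod_hom R (obj K k) (obj K (k + 1))" by (rule dh) simp
    have d': "diff K (k - 1) \<in> mod_hom R (obj K (k - 1)) (obj K k)" by (rule dh) simp
    have im: "diff K (k - 1) ` carrier (obj K (k - 1)) = cocycles K k"
      using acyc coboundaries_subset_cocycles[OF K, of k] by (auto simp: acyclic_complex_def coboundaries_def)
    have dN: "diff K (k - 1) \<in> mod_hom R (obj K (k - 1)) ?N"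
      using d' im by (auto simp: mod_hom_def)
    define r where "r x = x \<ominus>\<^bsub>obj K k\<^esub> a (diff K k x)" for x
    have rh: "r \<in> mod_hom R (obj K k) (obj K k)"
      unfolding r_def[abs_def] by (intro mod_hom_diff lm mod_hom_id mod_hom_comp[OF d ah])
    have rz: "r x \<in> cocycles K k" if x: "x \<in> carrier (obj K k)" for x
    proof -
      have dx: "diff K k x \<in> carrier (obj K (k + 1))" by (rule mod_hom_closed[OF d x])
      have "diff K k x \<in> cocycles K (k + 1)"
        using dx cochain_complexD(3)[OF K x, of "k + 1" "k + 1 + 1"] by (simp add: cocycles_def)
      then have "diff K k (a (diff K k x)) = diff K k x" using a by (simp add: P_def)
      then have "diff K k (r x) = \<zero>\<^bsub>obj K (k + 1)\<^esub>"
        unfolding r_def mod_hom_minus[OF lm lm d x mod_hom_closed[OF ah dx]]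
        using dx by (simp add: M1.minus_eq_zero_iff)
      then show ?thesis using mod_hom_closed[OF rh x] by (simp add: cocycles_def)
    qed
    have rN: "r \<in> mod_hom R (obj K k) ?N" using rh rz by (auto simp: mod_hom_def)
    obtain b where b: "b \<in> mod_hom R (obj K k) (obj K (k - 1))"
      "\<And>x. x \<in> carrier (obj K k) \<Longrightarrow> diff K (k - 1) (b x) = r x"
      using liftsD[OF L dN rN] im by (auto intro: that)
    have "Q k a b"
      unfolding Q_def
    proof
      fix x assume x: "x \<in> carrier (obj K k)"
      show "diff K (k - 1) (b x) \<oplus>\<^bsub>obj K k\<^esub> a (diff K k x) = x"
        unfolding b(2)[OF x] r_def
        by (rule M.minus_add_cancel[OF mod_hom_closed[OF ah mod_hom_closed[OF d x]] x])
    qed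
    moreover have "P k b"
      unfolding P_def
    proof (intro conjI ballI b(1))
      fix y assume "y \<in> cocycles K k"
      then have y: "y \<in> carrier (obj K k)" "diff K k y = \<zero>\<^bsub>obj K (k + 1)\<^esub>" by (auto simp: cocycles_def)
      \<comment> \<open>On cocycles the correction term is \<open>a\<close> at zero, so
        \<open>r\<close> is the identity there and its lift \<open>b\<close> splits the differential
        again.\<close>
      have "r y = y" unfolding r_def y(2) mod_hom_zero[OF lm lm ah] by (rule M.minus_zero_right[OF y(1)])
      then show "diff K (k - 1) (b y) = y" using b(2)[OF y(1)] by simp
    qed
    ultimately show ?thesis by blast
  qed
  \<comment> \<open>\<open>t n\<close> starts in degree \<open>m + 1 - n\<close>; the identity
    linking \<open>t n\<close> and \<open>t (Suc n)\<close> therefore belongs to degree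
    \<open>m - n\<close>.\<close>
  have "\<exists>t. \<forall>n. P (m + 1 - int n) (t n) \<and> Q (m - int n) (t n) (t (Suc n))"
  proof (rule dependent_nat_choice)
    show "\<exists>a. P (m + 1 - int 0) a" using base by auto
    fix a n assume "P (m + 1 - int n) a"
    moreover have "m + 1 - int n = m - int n + 1" "m + 1 - int (Suc n) = m - int n" by simp_all
    ultimately show "\<exists>b. P (m + 1 - int (Suc n)) b \<and> Q (m - int n) a b"
      using step[of "m - int n" a] by (simp only:)
  qed
  then obtain t where t: "\<And>n. P (m + 1 - int n) (t n)" "\<And>n. Q (m - int n) (t n) (t (Suc n))" by blast
  define s where "s k = (if k > m + 1 then (\<lambda>x. \<zero>\<^bsub>obj K (k - 1)\<^esub>) else t (nat (m + 1 - k)))" for k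
  have sh: "s k \<in> mod_hom R (obj K k) (obj K (k - 1))" for k
  proof (cases "k > m + 1")
    case True
    then show ?thesis using mod_hom_zero_map[OF lm] by (simp add: s_def)
  next
    case False
    then have "m + 1 - int (nat (m + 1 - k)) = k" by simp
    then show ?thesis using t(1)[of "nat (m + 1 - k)"] False by (simp add: s_def P_def)
  qed
  have "diff K (k - 1) (s k x) \<oplus>\<^bsub>obj K k\<^esub> s (k + 1) (diff K k x) = x" if x: "x \<in> carrier (obj K k)" for k x
  proof (cases "k > m")
    case True
    interpret M: left_module R "obj K k" by (rule lm)
    have "diff K (k - 1) (s k x) \<oplus>\<^bsub>obj K k\<^esub> s (k + 1) (diff K k x) \<in> carrier (obj K k)"
    proof (rule M.M.a_closed)
      show "diff K (k - 1) (s k x) \<in> carrier (obj K k)"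
        by (rule mod_hom_closed[OF dh mod_hom_closed[OF sh x]]) simp
      have "diff K k x \<in> carrier (obj K (k + 1))" by (rule mod_hom_closed[OF dh x]) simp
      then show "s (k + 1) (diff K k x) \<in> carrier (obj K k)"
        using mod_hom_closed[OF sh[of "k + 1"]] by simp
    qed
    then show ?thesis using m[OF True] x by auto
  next
    case False
    define n where "n = nat (m - k)"
    have n: "m - int n = k" "nat (m + 1 - k) = Suc n" "nat (m + 1 - (k + 1)) = n"
      using False by (auto simp: n_def)
    have "s k = t (Suc n)" "s (k + 1) = t n" using False n by (auto simp: s_def)
    then show ?thesis using t(2)[of n] x unfolding n(1) Q_def by simp
  qed
  then show ?thesis using sh by (intro exI[of _ s]) (auto simp: graded_map_def)
qed

text \<open>With \<open>s\<close> written as a 2 by 2 matrix, the contraction identity on pairs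
  \<open>(x, 0)\<close> gives \<open>d a + a d + g f = 1\<close> in the first component; on pairs
  \<open>(0, y)\<close> it gives \<open>d g = g d\<close> and
  \<open>f g - d c - c d = 1\<close>.\<close>

lemma homotopy_equivalence_of_contraction:
  assumes f: "cochain_map R C D f"
    and sg: "graded_map R (cone C D f) (cone C D f) (-1) s"
    and s: "\<And>k z. z \<in> carrier (obj (cone C D f) k) \<Longrightarrow> diff (cone C D f) (k - 1) (s k z)
      \<oplus>\<^bsub>obj (cone C D f) k\<^esub> s (k + 1) (diff (cone C D f) k z) = z"
  shows "homotopy_equivalence R C D f"
proof -
  note CC = cochain_mapD(1)[OF f] and DD = cochain_mapD(2)[OF f]
  note C = cochain_complexD[OF CC] and D = cochain_complexD[OF DD] and fh = cochain_mapD(3)[OF f]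
  have sh: "s k \<in> mod_hom R (pair_module (obj C k) (obj D k')) (pair_module (obj C k') (obj D k''))"
    if "k' = k - 1" "k'' = k - 2" for k k' k''
  proof -
    have "s k \<in> mod_hom R (obj (cone C D f) k) (obj (cone C D f) (k + -1))"
      using sg unfolding graded_map_def by blast
    moreover have "k - 1 - 1 = k - 2" by simp
    ultimately show ?thesis using that unfolding obj_cone by simp
  qed
  define a where "a k x = fst (s k (x, \<zero>\<^bsub>obj D (k - 1)\<^esub>))" for k x
  \<comment> \<open>Elements of \<open>D\<close> of degree \<open>k\<close> have degree
    \<open>k + 1\<close> in the cone. This shift makes \<open>g\<close> a map of degree 0 and
    \<open>c\<close> one of degree -1.\<close>
  define g where "g k y = fst (s (k + 1) (\<zero>\<^bsub>obj C (k + 1)\<^esub>, y))" for k y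
  define c where "c k y = snd (s (k + 1) (\<zero>\<^bsub>obj C (k + 1)\<^esub>, y))" for k y
  have ah: "a k \<in> mod_hom R (obj C k) (obj C (k - 1))" for k
    unfolding a_def[abs_def]
    by (rule mod_hom_comp[OF mod_hom_comp[OF mod_hom_inl[OF C(1) D(1)] sh[OF refl refl]] mod_hom_fst])
  have sh1: "s (k + 1) \<in> mod_hom R (pair_module (obj C (k + 1)) (obj D k)) (pair_module (obj C k) (obj D (k - 1)))" for k
    by (rule sh) auto
  have gh: "g k \<in> mod_hom R (obj D k) (obj C k)" for k
    unfolding g_def[abs_def]
    by (rule mod_hom_comp[OF mod_hom_comp[OF mod_hom_inr[OF C(1) D(1)] sh1] mod_hom_fst])
  have ch: "c k \<in> mod_hom R (obj D k) (obj D (k - 1))" for k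
    unfolding c_def[abs_def]
    by (rule mod_hom_comp[OF mod_hom_comp[OF mod_hom_inr[OF C(1) D(1)] sh1] mod_hom_snd])
  have idC: "diff C (k - 1) (a k x) \<oplus>\<^bsub>obj C k\<^esub> (a (k + 1) (diff C k x) \<oplus>\<^bsub>obj C k\<^esub> g k (f k x)) = x"
    if x: "x \<in> carrier (obj C k)" for k x
  proof -
    interpret C1: left_module R "obj C (k + 1)" by (rule C(1))
    interpret Dk: left_module R "obj D k" by (rule D(1))
    interpret D1: left_module R "obj D (k - 1)" by (rule D(1))
    let ?z = "(x, \<zero>\<^bsub>obj D (k - 1)\<^esub>)"
    have dx: "diff C k x \<in> carrier (obj C (k + 1))" by (rule mod_hom_closed[OF C(2) x]) simp
    have fx: "f k x \<in> carrier (obj D k)" by (rule mod_hom_closed[OF fh x])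
    have d0: "diff D (k - 1) \<zero>\<^bsub>obj D (k - 1)\<^esub> = \<zero>\<^bsub>obj D k\<^esub>" by (rule mod_hom_zero[OF D(1) D(1) D(2)]) simp
    have "diff (cone C D f) k ?z = (diff C k x, \<zero>\<^bsub>obj D k\<^esub>) \<oplus>\<^bsub>pair_module (obj C (k + 1)) (obj D k)\<^esub> (\<zero>\<^bsub>obj C (k + 1)\<^esub>, f k x)"
      using dx fx by (simp add: d0 Dk.minus_zero_right)
    then have "s (k + 1) (diff (cone C D f) k ?z) = s (k + 1) (diff C k x, \<zero>\<^bsub>obj D k\<^esub>)
       \<oplus>\<^bsub>pair_module (obj C k) (obj D (k - 1))\<^esub> s (k + 1) (\<zero>\<^bsub>obj C (k + 1)\<^esub>, f k x)"
      using dx fx by (simp only:) (intro mod_hom_add[OF sh1], auto)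
    then have "fst (s (k + 1) (diff (cone C D f) k ?z)) = a (k + 1) (diff C k x) \<oplus>\<^bsub>obj C k\<^esub> g k (f k x)"
      by (simp add: a_def g_def)
    moreover have "fst (diff (cone C D f) (k - 1) (s k ?z) \<oplus>\<^bsub>obj (cone C D f) k\<^esub>
        s (k + 1) (diff (cone C D f) k ?z)) = fst ?z"
      using x by (intro arg_cong[of _ _ fst] s) auto
    ultimately show ?thesis by (simp add: a_def)
  qed
  have idD: "diff C k (g k y) = g (k + 1) (diff D k y) \<and>
      diff D (k - 1) (c k y) \<oplus>\<^bsub>obj D k\<^esub> c (k + 1) (diff D k y) = f k (g k y) \<ominus>\<^bsub>obj D k\<^esub> y"
    if y: "y \<in> carrier (obj D k)" for k y
  proof -
    interpret C1: left_module R "obj C (k + 1)" by (rule C(1))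
    interpret C2: left_module R "obj C (k + 2)" by (rule C(1))
    interpret Dk: left_module R "obj D k" by (rule D(1))
    interpret D1: left_module R "obj D (k + 1)" by (rule D(1))
    let ?z = "(\<zero>\<^bsub>obj C (k + 1)\<^esub>, y)"
    have k2: "k + 1 + 1 = k + 2" "k + 1 - 1 = k" by simp_all
    have dy: "diff D k y \<in> carrier (obj D (k + 1))" by (rule mod_hom_closed[OF D(2) y]) simp
    have d0: "diff C (k + 1) \<zero>\<^bsub>obj C (k + 1)\<^esub> = \<zero>\<^bsub>obj C (k + 2)\<^esub>"
      by (rule mod_hom_zero[OF C(1) C(1) C(2)]) simp
    have f0: "f (k + 1) \<zero>\<^bsub>obj C (k + 1)\<^esub> = \<zero>\<^bsub>obj D (k + 1)\<^esub>" by (rule mod_hom_zero[OF C(1) D(1) fh])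
    \<comment> \<open>The minus sign on the differential of \<open>D\<close> in the cone turns the
      two relations for this column into commutation of \<open>g\<close> with \<open>d\<close> and
      the homotopy formula for \<open>c\<close>.\<close>
    have "diff (cone C D f) (k + 1) ?z = (\<zero>\<^bsub>obj C (k + 2)\<^esub>, \<ominus>\<^bsub>obj D (k + 1)\<^esub> diff D k y)"
      using dy by (simp add: d0 f0 a_minus_def)
    then have e: "fst (s (k + 2) (diff (cone C D f) (k + 1) ?z)) = \<ominus>\<^bsub>obj C (k + 1)\<^esub> g (k + 1) (diff D k y)"
        "snd (s (k + 2) (diff (cone C D f) (k + 1) ?z)) = \<ominus>\<^bsub>obj D k\<^esub> c (k + 1) (diff D k y)"
      using mod_hom_neg[OF D(1) C(1) gh dy] mod_hom_neg[OF D(1) D(1) ch dy]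
      by (simp_all add: g_def c_def k2)
    have "diff (cone C D f) k (s (k + 1) ?z) \<oplus>\<^bsub>obj (cone C D f) (k + 1)\<^esub>
        s (k + 2) (diff (cone C D f) (k + 1) ?z) = ?z"
      using s[of ?z "k + 1"] y unfolding k2 by simp
    then have "fst (diff (cone C D f) k (s (k + 1) ?z) \<oplus>\<^bsub>obj (cone C D f) (k + 1)\<^esub>
        s (k + 2) (diff (cone C D f) (k + 1) ?z)) = fst ?z"
      and "snd (diff (cone C D f) k (s (k + 1) ?z) \<oplus>\<^bsub>obj (cone C D f) (k + 1)\<^esub>
        s (k + 2) (diff (cone C D f) (k + 1) ?z)) = snd ?z" by (simp_all only:)
    then have 1: "diff C k (g k y) \<oplus>\<^bsub>obj C (k + 1)\<^esub> \<ominus>\<^bsub>obj C (k + 1)\<^esub> g (k + 1) (diff D k y) = \<zero>\<^bsub>obj C (k + 1)\<^esub>"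
      and 2: "(f k (g k y) \<ominus>\<^bsub>obj D k\<^esub> diff D (k - 1) (c k y)) \<oplus>\<^bsub>obj D k\<^esub>
        \<ominus>\<^bsub>obj D k\<^esub> c (k + 1) (diff D k y) = y"
      unfolding obj_cone add_pair_module fst_conv snd_conv e k2 by (simp_all add: g_def c_def)
    have gy: "g k y \<in> carrier (obj C k)" by (rule mod_hom_closed[OF gh y])
    have dgy: "diff C k (g k y) \<in> carrier (obj C (k + 1))" by (rule mod_hom_closed[OF C(2) gy]) simp
    have gdy: "g (k + 1) (diff D k y) \<in> carrier (obj C (k + 1))" by (rule mod_hom_closed[OF gh dy])
    have fgy: "f k (g k y) \<in> carrier (obj D k)" by (rule mod_hom_closed[OF fh gy])
    have dcy: "diff D (k - 1) (c k y) \<in> carrier (obj D k)"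
      by (rule mod_hom_closed[OF D(2) mod_hom_closed[OF ch y]]) simp
    have cdy: "c (k + 1) (diff D k y) \<in> carrier (obj D k)"
      using mod_hom_closed[OF ch dy] by simp
    have "diff C k (g k y) = g (k + 1) (diff D k y)"
      using 1 dgy gdy C1.minus_eq_zero_iff[OF dgy gdy] by (simp add: a_minus_def)
    moreover have "diff D (k - 1) (c k y) \<oplus>\<^bsub>obj D k\<^esub> c (k + 1) (diff D k y) = f k (g k y) \<ominus>\<^bsub>obj D k\<^esub> y"
    proof -
      let ?p = "diff D (k - 1) (c k y)" and ?q = "c (k + 1) (diff D k y)"
      have "f k (g k y) \<ominus>\<^bsub>obj D k\<^esub> y = f k (g k y) \<oplus>\<^bsub>obj D k\<^esub> (\<ominus>\<^bsub>obj D k\<^esub> f k (g k y) \<oplus>\<^bsub>obj D k\<^esub> (?p \<oplus>\<^bsub>obj D k\<^esub> ?q))"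
        by (subst 2[symmetric]) (use fgy dcy cdy in \<open>simp add: a_minus_def Dk.M.minus_add Dk.M.a_assoc\<close>)
      also have "\<dots> = ?p \<oplus>\<^bsub>obj D k\<^esub> ?q" using fgy dcy cdy by (simp add: Dk.M.r_neg2)
      finally show ?thesis ..
    qed
    ultimately show ?thesis by blast
  qed
  have "cochain_map R D C g"
    unfolding cochain_map_def graded_map_def using CC DD gh idD by simp
  \<comment> \<open>The contraction gives \<open>d a + a d = 1 - g f\<close>, whereas a homotopy
    from the identity to \<open>g f\<close> needs the opposite sign; hence minus
    \<open>a\<close>.\<close>
  moreover have "homotopy R C C (\<lambda>k x. x) (\<lambda>k x. g k (f k x)) (\<lambda>k x. \<ominus>\<^bsub>obj C (k - 1)\<^esub> a k x)"
    unfolding homotopy_def graded_map_def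
  proof (intro conjI allI ballI)
    fix k
    show "(\<lambda>x. \<ominus>\<^bsub>obj C (k - 1)\<^esub> a k x) \<in> mod_hom R (obj C k) (obj C (k + -1))"
      using mod_hom_uminus[OF C(1) ah] by simp
    fix x assume x: "x \<in> carrier (obj C k)"
    interpret Ck: left_module R "obj C k" by (rule C(1))
    have ax: "a k x \<in> carrier (obj C (k - 1))" by (rule mod_hom_closed[OF ah x])
    have dx: "diff C k x \<in> carrier (obj C (k + 1))" by (rule mod_hom_closed[OF C(2) x]) simp
    have dax: "diff C (k - 1) (a k x) \<in> carrier (obj C k)" by (rule mod_hom_closed[OF C(2) ax]) simp
    have adx: "a (k + 1) (diff C k x) \<in> carrier (obj C k)" using mod_hom_closed[OF ah dx] by simp
    have gfx: "g k (f k x) \<in> carrier (obj C k)" by (rule mod_hom_closed[OF gh mod_hom_closed[OF fh x]])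
    have "diff C (k - 1) (\<ominus>\<^bsub>obj C (k - 1)\<^esub> a k x) = \<ominus>\<^bsub>obj C k\<^esub> diff C (k - 1) (a k x)"
      by (rule mod_hom_neg[OF C(1) C(1) C(2) ax]) simp
    moreover have "g k (f k x) \<ominus>\<^bsub>obj C k\<^esub> x = \<ominus>\<^bsub>obj C k\<^esub> diff C (k - 1) (a k x) \<oplus>\<^bsub>obj C k\<^esub> \<ominus>\<^bsub>obj C k\<^esub> a (k + 1) (diff C k x)"
    proof -
      let ?p = "diff C (k - 1) (a k x)" and ?q = "a (k + 1) (diff C k x)" and ?r = "g k (f k x)"
      have "?r \<ominus>\<^bsub>obj C k\<^esub> x = ?r \<ominus>\<^bsub>obj C k\<^esub> (?p \<oplus>\<^bsub>obj C k\<^esub> (?q \<oplus>\<^bsub>obj C k\<^esub> ?r))"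
        using idC[OF x] by simp
      also have "\<dots> = ?r \<oplus>\<^bsub>obj C k\<^esub> (\<ominus>\<^bsub>obj C k\<^esub> ?r \<oplus>\<^bsub>obj C k\<^esub> (\<ominus>\<^bsub>obj C k\<^esub> ?p \<oplus>\<^bsub>obj C k\<^esub> \<ominus>\<^bsub>obj C k\<^esub> ?q))"
        using dax adx gfx by (simp add: a_minus_def Ck.M.minus_add Ck.M.a_ac)
      also have "\<dots> = \<ominus>\<^bsub>obj C k\<^esub> ?p \<oplus>\<^bsub>obj C k\<^esub> \<ominus>\<^bsub>obj C k\<^esub> ?q"
        using dax adx gfx by (simp add: Ck.M.r_neg2)
      finally show ?thesis .
    qed
    ultimately show "diff C (k - 1) (\<ominus>\<^bsub>obj C (k - 1)\<^esub> a k x) \<oplus>\<^bsub>obj C k\<^esub>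
       \<ominus>\<^bsub>obj C (k + 1 - 1)\<^esub> a (k + 1) (diff C k x) = g k (f k x) \<ominus>\<^bsub>obj C k\<^esub> x" by simp
  qed
  moreover have "homotopy R D D (\<lambda>k x. x) (\<lambda>k x. f k (g k x)) c"
    unfolding homotopy_def graded_map_def using ch idD by simp
  ultimately show ?thesis unfolding homotopy_equivalence_def using f by blast
qed

section \<open>The diagonal map\<close>

context derived_cube
begin

text \<open>The leading term for the filtration by cardinality: off-diagonal contributions at
  \<open>B\<close> come from proper subsets of \<open>B\<close>, where \<open>x\<close> is assumed
  to vanish.\<close>

lemma tot_diff_at:
  assumes x: "x \<in> carrier (cube_obj N C l)" and B: "B \<subseteq> N"
    and z: "\<And>A. A \<subset> B \<Longrightarrow> x A = \<zero>\<^bsub>obj C (l - int (card A))\<^esub>"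
    and k: "k = l - int (card B)" "k' = k + 1"
  shows "tot_diff l x B = [((-1) ^ card B :: int)] \<cdot>\<^bsub>obj C k'\<^esub> diff C k (x B)"
proof -
  have k': "k' = l + 1 - int (card B)" using k by simp
  interpret M: left_module R "obj C k'" by (rule C.lm)
  interpret M': left_module R "obj D k'" by (rule lm)
  have fB: "finite B" using B by (rule finite_vertex)
  have t: "[tot_sign B A] \<cdot>\<^bsub>obj D k'\<^esub> word_sum D h G (B - A) (l - int (card A)) (plain_diag N \<alpha> l x A)
    = \<zero>\<^bsub>obj D k'\<^esub>" if A: "A \<in> Pow B" for A
  proof (cases "A = B")
    case True
    have "word_sum D h G (B - B) (l - int (card B)) (plain_diag N \<alpha> l x B) = \<zero>\<^bsub>obj D k'\<^esub>"
      using k by (simp add: word_sum_def)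
    then show ?thesis using True by simp
  next
    case False
    have "int (card (B - A)) = int (card B) - int (card A)"
      using A fB by (simp add: card_Diff_subset finite_subset card_mono of_nat_diff)
    then have "k' = l - int (card A) + 1 - int (card (B - A))" using k by simp
    then have w: "word_sum D h G (B - A) (l - int (card A)) \<in>
        mod_hom R (obj D (l - int (card A))) (obj D k')"
      using B by (intro word_sum_hom) auto
    have "plain_diag N \<alpha> l x A = \<alpha> (l - int (card A)) \<zero>\<^bsub>obj C (l - int (card A))\<^esub>"
      using A B False z[of A] by (auto simp: plain_diag_def)
    also have "\<dots> = \<zero>\<^bsub>obj D (l - int (card A))\<^esub>" by (rule mod_hom_zero[OF C.lm lm a_hom])
    finally show ?thesis using mod_hom_zero[OF lm lm w] by simp
  qed
  have "cube_sum N D h G l (plain_diag N \<alpha> l x) B = (\<Oplus>\<^bsub>obj D k'\<^esub>A\<in>Pow B. [tot_sign B A] \<cdot>\<^bsub>obj D k'\<^esub>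
      word_sum D h G (B - A) (l - int (card A)) (plain_diag N \<alpha> l x A))"
    using B by (simp add: cube_sum_def k')
  also have "\<dots> = \<zero>\<^bsub>obj D k'\<^esub>" using t by (rule M'.M.add.finprod_one_eqI)
  finally have v: "cube_sum N D h G l (plain_diag N \<alpha> l x) B = \<zero>\<^bsub>obj D k'\<^esub>" .
  have xB: "x B \<in> carrier (obj C k)" using B k by (intro C.cube_obj_closed[OF x])
  have dx: "diff C k (x B) \<in> carrier (obj C k')" by (rule mod_hom_closed[OF C.diff_hom[OF k(2)] xB])
  have "tot_diff l x B = signed_diag N C 1 (diff C) l x B \<oplus>\<^bsub>obj C k'\<^esub>
     plain_diag N \<beta> (l + 1) (cube_sum N D h G l (plain_diag N \<alpha> l x)) B"
    unfolding tot_diff_def using B k' by (rule C.cube_obj_add)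
  also have "signed_diag N C 1 (diff C) l x B = [((-1) ^ card B :: int)] \<cdot>\<^bsub>obj C k'\<^esub> diff C k (x B)"
    using B by (simp add: signed_diag_def k' k(1))
  also have "plain_diag N \<beta> (l + 1) (cube_sum N D h G l (plain_diag N \<alpha> l x)) B = \<beta> k' \<zero>\<^bsub>obj D k'\<^esub>"
    unfolding v[symmetric] using B by (simp add: plain_diag_def[of N \<beta>] k')
  also have "\<dots> = \<zero>\<^bsub>obj C k'\<^esub>" by (rule mod_hom_zero[OF lm C.lm b_hom])
  finally show ?thesis using dx by simp
qed

text \<open>\<open>Y\<close> belongs to the same locale as \<open>Z\<close>, with target
  \<open>D\<close>, inner map the composite and outer map the identity. The composite of the new
  pair is again the old one, so \<open>G\<close> remains a valid homotopy.\<close>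

lemma derived_cube_idD: "derived_cube R D D N h G (\<lambda>k x. \<alpha> k (\<beta> k x)) (\<lambda>k x. x)"
proof unfold_locales
  show "cochain_map R D D (\<lambda>k x. x)"
    using cx by (simp add: cochain_map_def graded_map_def mod_hom_id)
qed (use rmap in simp)

abbreviation "Y \<equiv> Tot N (Der D D (\<lambda>k x. \<alpha> k (\<beta> k x)) (\<lambda>k x. x) G h)"
abbreviation "Z \<equiv> Tot N (Der C D \<alpha> \<beta> G h)"
abbreviation "L \<equiv> diag_map N (Der C D \<alpha> \<beta> G h) \<beta>"

interpretation Y: derived_cube R D D N h G "\<lambda>k x. \<alpha> k (\<beta> k x)" "\<lambda>k x. x"
  by (rule derived_cube_idD)

text \<open>The differential of \<open>Y\<close> is \<open>d + \<Delta> \<alpha> \<beta>\<close>,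
  that of \<open>Z\<close> is \<open>d + \<beta> \<Delta> \<alpha>\<close>. Composing the first with
  \<open>\<beta>\<close> on the left and the second with \<open>\<beta>\<close> on the right gives
  the same map.\<close>

lemma diag_map_cochain_map: "cochain_map R Y Z L"
  unfolding cochain_map_def graded_map_def
proof (intro conjI allI ballI Y.Tot_cochain_complex Tot_cochain_complex)
  fix k
  have "L k \<in> mod_hom R (cube_obj N D k) (cube_obj N C k)"
    by (rule mod_hom_cong[OF lm_cube b_diag_hom diag_map_eq])
  then show "L k \<in> mod_hom R (obj Y k) (obj Z (k + 0))" by (simp add: Tot_obj Y.Tot_obj)
  fix x assume "x \<in> carrier (obj Y k)"
  then have x: "x \<in> carrier (cube_obj N D k)" by (simp add: Y.Tot_obj)
  have dx: "signed_diag N D 1 (diff D) k x \<in> carrier (cube_obj N D (k + 1))"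
    by (rule mod_hom_closed[OF signed_diag_hom[OF diff_graded refl] x])
  have v: "cube_sum N D h G k (plain_diag N (\<lambda>k x. \<alpha> k (\<beta> k x)) k x) \<in> carrier (cube_obj N D (k + 1))"
    by (rule mod_hom_closed[OF cube_sum_hom[OF refl] mod_hom_closed[OF Y.a_diag_hom x]])
  have "plain_diag N (\<lambda>k x. x) (k + 1) v = v" if "v \<in> carrier (cube_obj N D (k + 1))" for v
    using that by (intro cube_obj_eqI[of _ "k + 1"] mod_hom_closed[OF Y.b_diag_hom])
      (auto simp: plain_diag_def)
  then have T: "Y.tot_diff k x = signed_diag N D 1 (diff D) k x \<oplus>\<^bsub>cube_obj N D (k + 1)\<^esub>
      cube_sum N D h G k (plain_diag N (\<lambda>k x. \<alpha> k (\<beta> k x)) k x)"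
    using v by (simp add: Y.tot_diff_def)
  have "plain_diag N \<beta> (k + 1) (Y.tot_diff k x) =
    plain_diag N \<beta> (k + 1) (signed_diag N D 1 (diff D) k x) \<oplus>\<^bsub>cube_obj N C (k + 1)\<^esub>
    plain_diag N \<beta> (k + 1) (cube_sum N D h G k (plain_diag N (\<lambda>k x. \<alpha> k (\<beta> k x)) k x))"
    unfolding T by (rule mod_hom_add[OF b_diag_hom dx v])
  also have "plain_diag N \<beta> (k + 1) (signed_diag N D 1 (diff D) k x) =
      signed_diag N C 1 (diff C) k (plain_diag N \<beta> k x)"
    by (rule plain_diag_signed_diag[OF cube_base_axioms C.cube_base_axioms bmap x, symmetric])
  also have "plain_diag N (\<lambda>k x. \<alpha> k (\<beta> k x)) k x = plain_diag N \<alpha> k (plain_diag N \<beta> k x)"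
    unfolding plain_diag_def by (rule restrict_ext) simp
  finally have "plain_diag N \<beta> (k + 1) (Y.tot_diff k x) = tot_diff k (plain_diag N \<beta> k x)"
    by (simp add: tot_diff_def)
  then show "L (k + 1) (diff Y k x) = diff Z k (L k x)"
    using x mod_hom_closed[OF Y.tot_diff_hom x] mod_hom_closed[OF b_diag_hom x]
    by (simp add: Y.Tot_diff Tot_diff diag_map_eq)
qed

text \<open>The differential is block triangular for the filtration by cardinality of vertices with
  diagonal blocks the cones of \<open>\<beta>\<close>, so a cocycle can be cleared one cardinality at a time.\<close>

lemma cone_level_coboundary:
  assumes ac: "acyclic_complex (cone D C \<beta>)"
  shows "z \<in> cocycles (cone Y Z L) k \<Longrightarrow>
    (\<And>A. A \<subseteq> N \<Longrightarrow> card A < m \<Longrightarrow> fst z A = \<zero>\<^bsub>obj D (k - int (card A))\<^esub> \<and>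
       snd z A = \<zero>\<^bsub>obj C (k - 1 - int (card A))\<^esub>) \<Longrightarrow>
    z \<in> coboundaries (cone Y Z L) k"
\<comment> \<open>The induction counts the cardinalities still to be cleared. Once \<open>m\<close>
  exceeds \<open>card N\<close>, no vertex is left and \<open>z\<close> is zero.\<close>
proof (induction "card N + 1 - m" arbitrary: m z)
  case 0
  let ?K = "cone Y Z L"
  have K: "cochain_complex R ?K" by (rule cochain_complex_cone[OF diag_map_cochain_map])
  have lt: "card A < m" if "A \<subseteq> N" for A using 0(1) card_mono[OF fin that] by simp
  have zc: "fst z \<in> carrier (cube_obj N D k)" "snd z \<in> carrier (cube_obj N C (k - 1))"
    using 0(2) by (auto simp: cocycles_def Y.Tot_obj Tot_obj)
  interpret P: left_module R "cube_obj N D k" by (rule lm_cube)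
  interpret P': left_module R "cube_obj N C (k - 1)" by (rule C.lm_cube)
  have "fst z = \<zero>\<^bsub>cube_obj N D k\<^esub>"
    using 0(3) lt by (intro cube_obj_eqI[OF zc(1) P.M.zero_closed]) (simp add: cube_obj_zero)
  moreover have "snd z = \<zero>\<^bsub>cube_obj N C (k - 1)\<^esub>"
    using 0(3) lt by (intro C.cube_obj_eqI[OF zc(2) P'.M.zero_closed]) (simp add: C.cube_obj_zero)
  ultimately have "z = \<zero>\<^bsub>obj ?K k\<^esub>" by (simp add: prod_eq_iff Y.Tot_obj Tot_obj)
  then show ?case using submodule_coboundaries[OF K, of k] by (simp add: submodule_of_def)
next
  case (Suc j)
  let ?K = "cone Y Z L"
  have K: "cochain_complex R ?K" by (rule cochain_complex_cone[OF diag_map_cochain_map])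
  obtain x y where z: "z = (x, y)" by (cases z)
  have e2: "k - 1 - 1 = k - 2" by simp
  have x: "x \<in> carrier (cube_obj N D k)" and y: "y \<in> carrier (cube_obj N C (k - 1))"
    and zK: "z \<in> carrier (obj ?K k)"
    using Suc.prems(1) by (auto simp: cocycles_def z Y.Tot_obj Tot_obj)
  have Lx: "L k x = plain_diag N \<beta> k x" by (rule diag_map_eq[OF x])
  have Lxc: "plain_diag N \<beta> k x \<in> carrier (cube_obj N C k)" by (rule mod_hom_closed[OF b_diag_hom x])
  have dyc: "tot_diff (k - 1) y \<in> carrier (cube_obj N C k)"
    using mod_hom_closed[OF tot_diff_hom y] by simp
  interpret PC: left_module R "cube_obj N C k" by (rule C.lm_cube)
  have dx0: "Y.tot_diff k x = \<zero>\<^bsub>cube_obj N D (k + 1)\<^esub>"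
    using Suc.prems(1) x by (simp add: cocycles_def z Y.Tot_obj Tot_obj Y.Tot_diff)
  have "L k x \<ominus>\<^bsub>cube_obj N C k\<^esub> tot_diff (k - 1) y = \<zero>\<^bsub>cube_obj N C k\<^esub>"
    using Suc.prems(1) y by (simp add: cocycles_def z Y.Tot_obj Tot_obj Tot_diff)
  then have Ly: "plain_diag N \<beta> k x = tot_diff (k - 1) y"
    using PC.minus_eq_zero_iff[OF Lxc dyc] Lx by simp
  have x0: "x A = \<zero>\<^bsub>obj D (k - int (card A))\<^esub>" and y0: "y A = \<zero>\<^bsub>obj C (k - 1 - int (card A))\<^esub>"
    if "A \<subseteq> N" "card A < m" for A using Suc.prems(2)[OF that] by (auto simp: z)
  have sub: "card A < card B" "A \<subseteq> N" if "A \<subset> B" "B \<subseteq> N" for A B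
    using that finite_vertex by (auto intro: psubset_card_mono)
  \<comment> \<open>On vertices of cardinality \<open>m\<close> the leading term is the differential
    times this sign, while the cone of \<open>\<beta>\<close> carries no such sign. The factor
    converts between the two.\<close>
  let ?s = "(-1) ^ m :: int"
  define d where "d = k - int m"
  have ss: "?s * ?s = 1" by (simp flip: power_add)
  \<comment> \<open>At each vertex \<open>A\<close> of cardinality \<open>m\<close> the pair
    consisting of \<open>x A\<close> and \<open>?s\<close> times \<open>y A\<close> is a cocycle of
    the cone of \<open>\<beta>\<close> in degree \<open>d\<close>, and \<open>(p, q)\<close> bounds
    it.\<close>
  have "\<exists>p q. p \<in> carrier (obj D (d - 1)) \<and> q \<in> carrier (obj C (d - 2)) \<and>
      diff D (d - 1) p = x A \<and> \<beta> (d - 1) p \<ominus>\<^bsub>obj C (d - 1)\<^esub> diff C (d - 2) q = [?s] \<cdot>\<^bsub>obj C (d - 1)\<^esub> y A"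
    if A: "A \<subseteq> N" "card A = m" for A
  proof -
    interpret D1: left_module R "obj D (d + 1)" by (rule lm)
    interpret Cd: left_module R "obj C d" by (rule C.lm)
    interpret C1: left_module R "obj C (d - 1)" by (rule C.lm)
    have xA: "x A \<in> carrier (obj D d)" using A by (intro cube_obj_closed[OF x]) (auto simp: d_def)
    have yA: "y A \<in> carrier (obj C (d - 1))" using A by (intro C.cube_obj_closed[OF y]) (auto simp: d_def)
    have dxA: "diff D d (x A) \<in> carrier (obj D (d + 1))" by (rule mod_hom_closed[OF diff_hom xA]) simp
    have dC: "diff C (d - 1) \<in> mod_hom R (obj C (d - 1)) (obj C d)" by (rule C.diff_hom) simp
    have "Y.tot_diff k x A = [((-1) ^ card A :: int)] \<cdot>\<^bsub>obj D (d + 1)\<^esub> diff D d (x A)"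
    proof (rule Y.tot_diff_at[OF x A(1)])
      fix B assume "B \<subset> A"
      then show "x B = \<zero>\<^bsub>obj D (k - int (card B))\<^esub>" using sub[of B A] A by (intro x0) auto
    qed (use A in \<open>auto simp: d_def\<close>)
    moreover have "Y.tot_diff k x A = \<zero>\<^bsub>obj D (d + 1)\<^esub>"
      unfolding dx0 using A by (intro cube_obj_zero) (auto simp: d_def)
    ultimately have "[?s] \<cdot>\<^bsub>obj D (d + 1)\<^esub> diff D d (x A) = \<zero>\<^bsub>obj D (d + 1)\<^esub>"
      unfolding A(2) by (rule trans[OF sym])
    then have "[?s] \<cdot>\<^bsub>obj D (d + 1)\<^esub> ([?s] \<cdot>\<^bsub>obj D (d + 1)\<^esub> diff D d (x A)) = \<zero>\<^bsub>obj D (d + 1)\<^esub>"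
      by simp
    then have dx: "diff D d (x A) = \<zero>\<^bsub>obj D (d + 1)\<^esub>"
      using dxA D1.M.add.int_pow_1[OF dxA] by (simp add: D1.int_mult_assoc ss)
    have "\<beta> d (x A) = plain_diag N \<beta> k x A" using A by (simp add: plain_diag_def d_def)
    also have "\<dots> = [((-1) ^ card A :: int)] \<cdot>\<^bsub>obj C d\<^esub> diff C (d - 1) (y A)"
      unfolding Ly
    proof (rule tot_diff_at[OF y A(1)])
      fix B assume "B \<subset> A"
      then show "y B = \<zero>\<^bsub>obj C (k - 1 - int (card B))\<^esub>" using sub[of B A] A by (intro y0) auto
    qed (use A in \<open>auto simp: d_def\<close>)
    also have "\<dots> = diff C (d - 1) ([?s] \<cdot>\<^bsub>obj C (d - 1)\<^esub> y A)"
      using mod_hom_int_mult[OF C.lm C.lm dC yA] A by simp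
    finally have by': "\<beta> d (x A) = diff C (d - 1) ([?s] \<cdot>\<^bsub>obj C (d - 1)\<^esub> y A)" .
    show ?thesis
      by (rule acyclic_coneD[OF ac bmap xA C1.M.add.int_pow_closed[OF yA] dx by' refl refl]) blast
  qed
  then have "\<forall>A. \<exists>p q. A \<subseteq> N \<and> card A = m \<longrightarrow> p \<in> carrier (obj D (d - 1)) \<and> q \<in> carrier (obj C (d - 2)) \<and>
      diff D (d - 1) p = x A \<and> \<beta> (d - 1) p \<ominus>\<^bsub>obj C (d - 1)\<^esub> diff C (d - 2) q = [?s] \<cdot>\<^bsub>obj C (d - 1)\<^esub> y A"
    by blast
  then obtain p q where pq: "\<And>A. A \<subseteq> N \<Longrightarrow> card A = m \<Longrightarrow> p A \<in> carrier (obj D (d - 1)) \<and> q A \<in> carrier (obj C (d - 2)) \<and>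
      diff D (d - 1) (p A) = x A \<and>
      \<beta> (d - 1) (p A) \<ominus>\<^bsub>obj C (d - 1)\<^esub> diff C (d - 2) (q A) = [?s] \<cdot>\<^bsub>obj C (d - 1)\<^esub> y A"
    by metis
  \<comment> \<open>Only the first component is multiplied by the sign: the leading term
    \<open>?s d\<close> then sends it to \<open>x A\<close>, and the second component of the cone
    differential becomes \<open>?s\<close> times \<open>\<beta> p - d q\<close>, which is
    \<open>y A\<close>.\<close>
  define x1 where "x1 = (\<lambda>A\<in>Pow N. if card A = m then [?s] \<cdot>\<^bsub>obj D (d - 1)\<^esub> p A
    else \<zero>\<^bsub>obj D (k - 1 - int (card A))\<^esub>)"
  define y1 where "y1 = (\<lambda>A\<in>Pow N. if card A = m then q A else \<zero>\<^bsub>obj C (k - 2 - int (card A))\<^esub>)"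
  interpret D1: left_module R "obj D (d - 1)" by (rule lm)
  interpret C1: left_module R "obj C (d - 1)" by (rule C.lm)
  have x1A: "x1 A \<in> carrier (obj D (k - 1 - int (card A)))" if "A \<subseteq> N" for A
  proof -
    interpret M: left_module R "obj D (k - 1 - int (card A))" by (rule lm)
    show ?thesis
    proof (cases "card A = m")
      case True
      have "k - 1 - int (card A) = d - 1" using True by (simp add: d_def)
      moreover have "x1 A = [?s] \<cdot>\<^bsub>obj D (d - 1)\<^esub> p A" using True that by (simp add: x1_def)
      ultimately show ?thesis using pq[OF that True] by (simp only: D1.M.add.int_pow_closed)
    qed (use that in \<open>simp add: x1_def\<close>)
  qed
  have x1: "x1 \<in> carrier (cube_obj N D (k - 1))"
    unfolding cube_obj_def carrier_prod_module by (rule PiE_I) (use x1A in \<open>auto simp: x1_def\<close>)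
  have y1A: "y1 A \<in> carrier (obj C (k - 2 - int (card A)))" if "A \<subseteq> N" for A
  proof -
    interpret M: left_module R "obj C (k - 2 - int (card A))" by (rule C.lm)
    show ?thesis
    proof (cases "card A = m")
      case True
      have "k - 2 - int (card A) = d - 2" using True by (simp add: d_def)
      moreover have "y1 A = q A" using True that by (simp add: y1_def)
      ultimately show ?thesis using pq[OF that True] by (simp only:)
    qed (use that in \<open>simp add: y1_def\<close>)
  qed
  have y1: "y1 \<in> carrier (cube_obj N C (k - 2))"
    unfolding cube_obj_def carrier_prod_module by (rule PiE_I) (use y1A in \<open>auto simp: y1_def\<close>)
  have x1z: "x1 A = \<zero>\<^bsub>obj D (k - 1 - int (card A))\<^esub>" and y1z: "y1 A = \<zero>\<^bsub>obj C (k - 2 - int (card A))\<^esub>"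
    if "A \<subseteq> N" "card A < m" for A using that by (auto simp: x1_def y1_def)
  have z1: "(x1, y1) \<in> carrier (obj ?K (k - 1))"
    using x1 y1 by (simp add: Y.Tot_obj Tot_obj e2)
  define w where "w = diff ?K (k - 1) (x1, y1)"
  have dx1: "Y.tot_diff (k - 1) x1 \<in> carrier (cube_obj N D k)" using mod_hom_closed[OF Y.tot_diff_hom x1] by simp
  have Lx1: "plain_diag N \<beta> (k - 1) x1 \<in> carrier (cube_obj N C (k - 1))" by (rule mod_hom_closed[OF b_diag_hom x1])
  have dy1: "tot_diff (k - 2) y1 \<in> carrier (cube_obj N C (k - 1))" using mod_hom_closed[OF tot_diff_hom y1] by simp
  have wx: "fst w = Y.tot_diff (k - 1) x1"
    unfolding w_def diff_cone fst_conv by (rule Y.Tot_diff[OF x1])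
  have wy: "snd w = plain_diag N \<beta> (k - 1) x1 \<ominus>\<^bsub>cube_obj N C (k - 1)\<^esub> tot_diff (k - 2) y1"
    unfolding w_def diff_cone snd_conv fst_conv e2 Tot_obj Tot_diff[OF y1] diag_map_eq[OF x1] ..
  interpret Kk: left_module R "obj ?K k" by (rule cochain_complexD(1)[OF K])
  have wB: "w \<in> coboundaries ?K k" unfolding w_def coboundaries_def using z1 by (rule imageI)
  then have wZ: "w \<in> cocycles ?K k" using coboundaries_subset_cocycles[OF K] by blast
  then have wK: "w \<in> carrier (obj ?K k)" by (simp add: cocycles_def)
  define z2 where "z2 = z \<ominus>\<^bsub>obj ?K k\<^esub> w"
  have z2Z: "z2 \<in> cocycles ?K k"
    using submodule_cocycles[OF K, of k] Suc.prems(1) wZ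
    unfolding z2_def a_minus_def submodule_of_def by blast
  have z2e: "z2 = (x \<ominus>\<^bsub>cube_obj N D k\<^esub> Y.tot_diff (k - 1) x1,
      y \<ominus>\<^bsub>cube_obj N C (k - 1)\<^esub> (plain_diag N \<beta> (k - 1) x1 \<ominus>\<^bsub>cube_obj N C (k - 1)\<^esub> tot_diff (k - 2) y1))"
  proof -
    have "z2 = (fst z \<ominus>\<^bsub>obj Y k\<^esub> fst w, snd z \<ominus>\<^bsub>obj Z (k - 1)\<^esub> snd w)"
      unfolding z2_def obj_cone
      by (rule minus_pair_module[OF cochain_complexD(1)[OF Y.Tot_cochain_complex]
            cochain_complexD(1)[OF Tot_cochain_complex] zK[unfolded obj_cone] wK[unfolded obj_cone]])
    then show ?thesis unfolding wx wy by (simp add: z Y.Tot_obj Tot_obj)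
  qed
  \<comment> \<open>On cardinality \<open>m\<close> the boundary \<open>w\<close> agrees with
    \<open>z\<close>. On smaller vertices it is zero, because \<open>x1\<close> and
    \<open>y1\<close> vanish there and the differential never leads to smaller vertices.\<close>
  have van: "fst z2 A = \<zero>\<^bsub>obj D (k - int (card A))\<^esub> \<and> snd z2 A = \<zero>\<^bsub>obj C (k - 1 - int (card A))\<^esub>"
    if A: "A \<subseteq> N" "card A < Suc m" for A
  proof -
    define c where "c = k - int (card A)"
    interpret Dc: left_module R "obj D c" by (rule lm)
    interpret Cc: left_module R "obj C (c - 1)" by (rule C.lm)
    have dD: "diff D (c - 1) \<in> mod_hom R (obj D (c - 1)) (obj D c)" by (rule diff_hom) simp
    have dC: "diff C (c - 2) \<in> mod_hom R (obj C (c - 2)) (obj C (c - 1))" by (rule C.diff_hom) simp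
    have TY: "Y.tot_diff (k - 1) x1 A = [((-1) ^ card A :: int)] \<cdot>\<^bsub>obj D c\<^esub> diff D (c - 1) (x1 A)"
    proof (rule Y.tot_diff_at[OF x1 A(1)])
      fix B assume "B \<subset> A"
      then show "x1 B = \<zero>\<^bsub>obj D (k - 1 - int (card B))\<^esub>" using sub[of B A] A by (intro x1z) auto
    qed (auto simp: c_def)
    have TZ: "tot_diff (k - 2) y1 A = [((-1) ^ card A :: int)] \<cdot>\<^bsub>obj C (c - 1)\<^esub> diff C (c - 2) (y1 A)"
    proof (rule tot_diff_at[OF y1 A(1)])
      fix B assume "B \<subset> A"
      then show "y1 B = \<zero>\<^bsub>obj C (k - 2 - int (card B))\<^esub>" using sub[of B A] A by (intro y1z) auto
    qed (auto simp: c_def)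
    have LA: "plain_diag N \<beta> (k - 1) x1 A = \<beta> (c - 1) (x1 A)"
      using A by (simp add: plain_diag_def c_def algebra_simps)
    have f2: "fst z2 A = x A \<ominus>\<^bsub>obj D c\<^esub> Y.tot_diff (k - 1) x1 A"
      unfolding z2e fst_conv using A by (intro cube_obj_minus[OF x dx1]) (auto simp: c_def)
    interpret PC1: left_module R "cube_obj N C (k - 1)" by (rule C.lm_cube)
    have s2: "snd z2 A = y A \<ominus>\<^bsub>obj C (c - 1)\<^esub> (plain_diag N \<beta> (k - 1) x1 A \<ominus>\<^bsub>obj C (c - 1)\<^esub> tot_diff (k - 2) y1 A)"
    proof -
      have e: "c - 1 = k - 1 - int (card A)" by (simp add: c_def)
      show ?thesis
        unfolding z2e snd_conv C.cube_obj_minus[OF y PC1.M.minus_closed[OF Lx1 dy1] A(1) e]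
          C.cube_obj_minus[OF Lx1 dy1 A(1) e] ..
    qed
    have xA: "x A \<in> carrier (obj D c)" using A by (intro cube_obj_closed[OF x]) (auto simp: c_def)
    have yA: "y A \<in> carrier (obj C (c - 1))" using A by (intro C.cube_obj_closed[OF y]) (auto simp: c_def)
    have "fst z2 A = \<zero>\<^bsub>obj D c\<^esub> \<and> snd z2 A = \<zero>\<^bsub>obj C (c - 1)\<^esub>"
    proof (cases "card A = m")
      case True
      have dc: "c = d" using True by (simp add: c_def d_def)
      note pqA = pq[OF A(1) True]
      have x1e: "x1 A = [?s] \<cdot>\<^bsub>obj D (c - 1)\<^esub> p A" and y1e: "y1 A = q A"
        using A True by (auto simp: x1_def y1_def dc)
      have pA: "p A \<in> carrier (obj D (c - 1))" and qA: "q A \<in> carrier (obj C (c - 2))"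
        and pe: "diff D (c - 1) (p A) = x A"
        and qe: "\<beta> (c - 1) (p A) \<ominus>\<^bsub>obj C (c - 1)\<^esub> diff C (c - 2) (q A) = [?s] \<cdot>\<^bsub>obj C (c - 1)\<^esub> y A"
        using pqA unfolding dc by auto
      have "Y.tot_diff (k - 1) x1 A = x A"
        unfolding TY x1e mod_hom_int_mult[OF lm lm dD pA] pe True
        using xA Dc.M.add.int_pow_1[OF xA] by (simp add: Dc.int_mult_assoc ss)
      moreover have "plain_diag N \<beta> (k - 1) x1 A \<ominus>\<^bsub>obj C (c - 1)\<^esub> tot_diff (k - 2) y1 A = y A"
      proof -
        have bp: "\<beta> (c - 1) (p A) \<in> carrier (obj C (c - 1))" by (rule mod_hom_closed[OF b_hom pA])
        have dq: "diff C (c - 2) (q A) \<in> carrier (obj C (c - 1))" by (rule mod_hom_closed[OF dC qA])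
        have "plain_diag N \<beta> (k - 1) x1 A \<ominus>\<^bsub>obj C (c - 1)\<^esub> tot_diff (k - 2) y1 A =
          [?s] \<cdot>\<^bsub>obj C (c - 1)\<^esub> \<beta> (c - 1) (p A) \<ominus>\<^bsub>obj C (c - 1)\<^esub> [?s] \<cdot>\<^bsub>obj C (c - 1)\<^esub> diff C (c - 2) (q A)"
          unfolding LA TZ x1e y1e mod_hom_int_mult[OF lm C.lm b_hom pA] True ..
        also have "\<dots> = [?s] \<cdot>\<^bsub>obj C (c - 1)\<^esub> (\<beta> (c - 1) (p A) \<ominus>\<^bsub>obj C (c - 1)\<^esub> diff C (c - 2) (q A))"
          using mod_hom_minus[OF C.lm C.lm mod_hom_int_multiple[OF C.lm mod_hom_id] bp dq] ..
        also have "\<dots> = y A"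
          unfolding qe using yA Cc.M.add.int_pow_1[OF yA] by (simp add: Cc.int_mult_assoc ss)
        finally show ?thesis .
      qed
      ultimately show ?thesis unfolding f2 s2 using xA yA
        by (simp add: Dc.minus_eq_zero_iff Cc.minus_eq_zero_iff)
    next
      case False
      then have lt: "card A < m" using A by simp
      have e: "k - 1 - int (card A) = c - 1" "k - 2 - int (card A) = c - 2" by (simp_all add: c_def)
      have xz: "x A = \<zero>\<^bsub>obj D c\<^esub>" "y A = \<zero>\<^bsub>obj C (c - 1)\<^esub>"
        "x1 A = \<zero>\<^bsub>obj D (c - 1)\<^esub>" "y1 A = \<zero>\<^bsub>obj C (c - 2)\<^esub>"
        using x0[OF A(1) lt] y0[OF A(1) lt] x1z[OF A(1) lt] y1z[OF A(1) lt] unfolding e by (simp_all add: c_def)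
      show ?thesis
        unfolding f2 s2 TY TZ LA xz mod_hom_zero[OF lm lm dD] mod_hom_zero[OF C.lm C.lm dC]
          mod_hom_zero[OF lm C.lm b_hom]
        by (simp add: Dc.minus_zero_right Cc.minus_zero_right)
    qed
    moreover have "k - 1 - int (card A) = c - 1" by (simp add: c_def)
    ultimately show ?thesis unfolding c_def[symmetric] by (simp only:)
  qed
  have "j = card N + 1 - Suc m" using Suc.hyps(2) by simp
  then have "z2 \<in> coboundaries ?K k" using z2Z van by (rule Suc.hyps(1))
  then have "z2 \<oplus>\<^bsub>obj ?K k\<^esub> w \<in> coboundaries ?K k"
    using submodule_coboundaries[OF K, of k] wB unfolding submodule_of_def by blast
  moreover have "z2 \<oplus>\<^bsub>obj ?K k\<^esub> w = z" unfolding z2_def by (rule Kk.minus_add_cancel[OF wK zK])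
  ultimately show ?case by (simp only:)
qed

lemma acyclic_cone_diag_map:
  assumes "acyclic_complex (cone D C \<beta>)"
  shows "acyclic_complex (cone Y Z L)"
  \<comment> \<open>At level 0 the vanishing assumption is vacuous, so every cocycle of the cone is
    covered.\<close>
  unfolding acyclic_complex_def using cone_level_coboundary[OF assms, where m = 0] by blast

text \<open>Each term of the cone is a direct sum of finite products of the given projectives, so
  the lifting property is checked summand by summand; together with acyclicity and an upper bound
  this yields a contraction.\<close>

lemma diag_map_homotopy_equivalence:
  assumes ac: "acyclic_complex (cone D C \<beta>)" and bd: "bounded_above C" "bounded_above D"
    and pr: "\<And>k. projective R (obj C k)" "\<And>k. projective R (obj D k)"
  shows "homotopy_equivalence R Y Z L"
proof -
  let ?K = "cone Y Z L"
  have K: "cochain_complex R ?K" by (rule cochain_complex_cone[OF diag_map_cochain_map])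
  obtain m1 where m1: "\<And>k. k > m1 \<Longrightarrow> carrier (obj C k) = {\<zero>\<^bsub>obj C k\<^esub>}"
    using bd(1) by (auto simp: bounded_above_def)
  obtain m2 where m2: "\<And>k. k > m2 \<Longrightarrow> carrier (obj D k) = {\<zero>\<^bsub>obj D k\<^esub>}"
    using bd(2) by (auto simp: bounded_above_def)
  have cA: "int (card A) \<le> int (card N)" if "A \<subseteq> N" for A using card_mono[OF fin that] by simp
  have "bounded_above ?K"
    unfolding bounded_above_def
  \<comment> \<open>A vertex lowers the degree by at most \<open>card N\<close>, and the cone shifts
    the target complex by one more.\<close>
  proof (intro exI[of _ "max m1 m2 + int (card N) + 1"] allI impI)
    fix k assume k: "max m1 m2 + int (card N) + 1 < k"
    have "carrier (cube_obj N D k) = {\<zero>\<^bsub>cube_obj N D k\<^esub>}"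
    proof -
      interpret P: left_module R "cube_obj N D k" by (rule lm_cube)
      have "x = \<zero>\<^bsub>cube_obj N D k\<^esub>" if x: "x \<in> carrier (cube_obj N D k)" for x
      proof (rule cube_obj_eqI[OF x P.M.zero_closed])
        fix A assume A: "A \<subseteq> N"
        have "x A \<in> carrier (obj D (k - int (card A)))" using A by (intro cube_obj_closed[OF x]) auto
        then show "x A = \<zero>\<^bsub>cube_obj N D k\<^esub> A"
          using m2[of "k - int (card A)"] k cA[OF A] A by (simp add: cube_obj_zero)
      qed
      then show ?thesis using P.M.zero_closed by blast
    qed
    moreover have "carrier (cube_obj N C (k - 1)) = {\<zero>\<^bsub>cube_obj N C (k - 1)\<^esub>}"
    proof -
      interpret P: left_module R "cube_obj N C (k - 1)" by (rule C.lm_cube)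
      have "x = \<zero>\<^bsub>cube_obj N C (k - 1)\<^esub>" if x: "x \<in> carrier (cube_obj N C (k - 1))" for x
      proof (rule C.cube_obj_eqI[OF x P.M.zero_closed])
        fix A assume A: "A \<subseteq> N"
        have "x A \<in> carrier (obj C (k - 1 - int (card A)))" using A by (intro C.cube_obj_closed[OF x]) auto
        then show "x A = \<zero>\<^bsub>cube_obj N C (k - 1)\<^esub> A"
          using m1[of "k - 1 - int (card A)"] k cA[OF A] A by (simp add: C.cube_obj_zero)
      qed
      then show ?thesis using P.M.zero_closed by blast
    qed
    ultimately show "carrier (obj ?K k) = {\<zero>\<^bsub>obj ?K k\<^esub>}" by (simp add: Y.Tot_obj Tot_obj)
  qed
  moreover have "lifts R (obj ?K k) (obj ?K (k - 1)) ((obj ?K k)\<lparr>carrier := cocycles ?K k\<rparr>)" for k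
  proof -
    have M: "left_module R (obj ?K (k - 1))" by (rule cochain_complexD(1)[OF K])
    have N: "left_module R ((obj ?K k)\<lparr>carrier := cocycles ?K k\<rparr>)"
      by (rule left_module_submodule[OF cochain_complexD(1)[OF K] submodule_cocycles[OF K]])
    have "lifts R (pair_module (cube_obj N D k) (cube_obj N C (k - 1))) (obj ?K (k - 1))
        ((obj ?K k)\<lparr>carrier := cocycles ?K k\<rparr>)"
    proof (rule lifts_pair_module[OF lm_cube C.lm_cube M])
      show "lifts R (cube_obj N D k) (obj ?K (k - 1)) ((obj ?K k)\<lparr>carrier := cocycles ?K k\<rparr>)"
        unfolding cube_obj_def using fin
        by (intro lifts_prod_module[OF ring _ lm M N] lifts_projective[OF pr(2) M N]) auto
      show "lifts R (cube_obj N C (k - 1)) (obj ?K (k - 1)) ((obj ?K k)\<lparr>carrier := cocycles ?K k\<rparr>)"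
        unfolding cube_obj_def using fin
        by (intro lifts_prod_module[OF ring _ C.lm M N] lifts_projective[OF pr(1) M N]) auto
    qed
    then show ?thesis by (simp only: obj_cone Y.Tot_obj Tot_obj)
  qed
  ultimately obtain s where "graded_map R ?K ?K (-1) s"
    "\<And>k z. z \<in> carrier (obj ?K k) \<Longrightarrow> diff ?K (k - 1) (s k z) \<oplus>\<^bsub>obj ?K k\<^esub> s (k + 1) (diff ?K k z) = z"
    using exists_contraction[OF K acyclic_cone_diag_map[OF ac]] by blast
  then show ?thesis by (rule homotopy_equivalence_of_contraction[OF diag_map_cochain_map])
qed

end

theorem mainTheorem4:
  fixes R :: "('r, 'k) ring_scheme"
    and n :: nat
    and C :: "('r, 'c) cochain" and D :: "('r, 'd) cochain"
    and h :: "nat \<Rightarrow> int \<Rightarrow> 'd \<Rightarrow> 'd"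
    and \<alpha> :: "int \<Rightarrow> 'c \<Rightarrow> 'd" and \<beta> :: "int \<Rightarrow> 'd \<Rightarrow> 'c"
    and G :: "int \<Rightarrow> 'd \<Rightarrow> 'd"
  defines "N \<equiv> {1..n}"
  defines "QY \<equiv> Der D D (\<lambda>k x. \<alpha> k (\<beta> k x)) (\<lambda>k x. x) G h"
    and "QZ \<equiv> Der C D \<alpha> \<beta> G h"
  defines "Y \<equiv> Tot N QY" and "Z \<equiv> Tot N QZ"
  defines "L \<equiv> diag_map N QZ \<beta>"
  assumes "ring R"
    and "cochain_complex R D"
    and "\<And>i. i \<in> N \<Longrightarrow> cochain_map R D D (h i)"
    and "\<And>i j k x. \<lbrakk>i \<in> N; j \<in> N; x \<in> carrier (obj D k)\<rbrakk> \<Longrightarrow> h i k (h j k x) = h j k (h i k x)"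
    and "cochain_complex R C"
    and "cochain_map R C D \<alpha>"
    and "cochain_map R D C \<beta>"
    and "homotopy R D D (\<lambda>k x. x) (\<lambda>k x. \<alpha> k (\<beta> k x)) G"
  shows "cochain_map R Y Z L \<and>
    (quasi_iso R D C \<beta> \<longrightarrow> quasi_iso R Y Z L) \<and>
    (quasi_iso R D C \<beta> \<and> bounded_above C \<and> bounded_above D \<and>
       (\<forall>k. projective R (obj C k)) \<and> (\<forall>k. projective R (obj D k)) \<longrightarrow>
     homotopy_equivalence R Y Z L)"
proof -
  have rmap: "cochain_map R D D (\<lambda>k x. \<alpha> k (\<beta> k x))"
    by (rule cochain_map_comp) fact+
  interpret derived_cube R C D N h G \<alpha> \<beta>
    by (intro derived_cube.intro cube_words.intro cube_base.intro cube_words_axioms.intro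
        derived_cube_axioms.intro) (fact | use assms(1) in simp)+
  show ?thesis
    unfolding Y_def Z_def L_def QY_def QZ_def
    using diag_map_cochain_map diag_map_homotopy_equivalence acyclic_cone_diag_map
    by (simp add: quasi_iso_iff_cone[OF diag_map_cochain_map] quasi_iso_iff_cone[OF bmap])
qed

end
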